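(* Let $L\subseteq\{1,\dots,m\}$ be a fixed nonempty set and let $H_L=\bigcap_{l\in L}H_l$ be the hypothesis that $\beta^l=\beta^l_0$ for all $l\in L$. Let $\psi:\mathbb{R}^{|L|}\to\mathbb{R}$ be any non-decreasing function (non-decreasing in each argument). For each $1\le j\le w$ define $$T^n_j=\psi\big((|S^{j,l}_{\hat\gamma}|)_{l\in L}\big),$$ where $S^{j,l}_{\hat\gamma}$ is the sign-flipped standardized score of the $l$-th model for the $j$-th flip, and let $T^n_{(1)}\le\dots\le T^n_{(w)}$ be the sorted values of $T^n_1,\dots,T^n_w$. Let $\alpha\in(0,1)$ and consider the test that rejects $H_L$ if $T^n_1>T^n_{(\lceil(1-\alpha)w\rceil)}$. Then, as $n\to\infty$ (with $w,m$ fixed), under $H_L$ the rejection probability converges to $\lfloor\alpha w\rfloor/w\le\alpha$.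
   Context: Model. Fix $m\ge 2$ and a number of flips $w\in\mathbb{N}$. For each $n$ there are $m$ response vectors $Y^l=(Y^l_1,\dots,Y^l_n)^T$, $1\le l\le m$. The $m$-vectors $(Y^1_i,\dots,Y^m_i)$, $i=1,\dots,n$, are independent over $i$; the dependence among the $m$ responses of the same unit $i$ is arbitrary and unknown. Each $Y^l_i$ follows an exponential dispersion family with density $\exp\{(y\theta-b(\theta))/a(\phi)+c(y,\phi)\}$, where $\theta=\theta^l_i$ and $\phi=\phi^l_i$ are the canonical and dispersion parameters and the known functions $a,b,c$ may depend on $l$. With $\mu^l=\mathbb{E}(Y^l)$, the $l$-th model is $\mu^l=(h^l)^{-1}(\eta^l)$ (componentwise), $\eta^l=X\beta^l+Z\gamma^l$, where $h^l$ is the link function (assumed correctly specified), $X$ is an $n\times 1$ matrix of target covariates, $\beta^l\in\mathbb{R}$, $Z$ is an $n\times(k-1)$ matrix of nuisance covariates, and $\gamma^l\in\mathbb{R}^{k-1}$ is a nuisance parameter with true value $\gamma^l_0$, consistently estimated by $\hat\gamma^l$. The null hypothesis is $H_l:\beta^l=\beta^l_0$, with $\beta^l_0$ given. Effective scores. For each $l$ let $D^l=\mathrm{diag}\{\partial\mu^l_i/\partial\eta^l_i\}$, $V^l=\mathrm{diag}\{\mathrm{Var}(Y^l_i)\}$, $W^l=D^l(V^l)^{-1}D^l$, and $P^l=(W^l)^{1/2}Z(Z^TW^lZ)^{-1}Z^T(W^l)^{1/2}$, evaluated at $\beta^l=\beta^l_0$ and at a value of the nuisance parameter. For that value $\gamma^l$,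 the effective score is $S^{*,l}_{\gamma}=n^{-1/2}X^T(W^l)^{1/2}(I-P^l)(V^l)^{-1/2}(Y^l-\mu^l)=n^{-1/2}\sum_{i=1}^n\nu^{*l}_{\gamma,i}$, where $\nu^{*l}_{\gamma,i}$ is the product of the $i$-th entry of the row vector $X^T(W^l)^{1/2}(I-P^l)(V^l)^{-1/2}$ and the $i$-th entry of $Y^l-\mu^l$. Subscript $\hat\gamma$ means that $\hat\gamma^l$ is plugged in (so $\mu^l$ becomes $\hat\mu^l$), and subscript $\gamma_0$ means that the true nuisance parameter is used. Sign flips. $g_1=(1,\dots,1)\in\mathbb{R}^n$, and $g_2,\dots,g_w$ are drawn independently and uniformly (with replacement) from $\{-1,1\}^n$, independently of the data. The same flips are used for all $m$ models. $G_j$ is the diagonal matrix with diagonal $g_{j1},\dots,g_{jn}$. The sign-flipped effective score is $S^{*,j,l}_{\gamma}=n^{-1/2}X^T(W^l)^{1/2}(I-P^l)(V^l)^{-1/2}G_j(Y^l-\mu^l)=n^{-1/2}\sum_{i=1}^n g_{ji}\nu^{*l}_{\gamma,i}$. Standardized scores. With $\mathrm{Var}\{S^{*,j,l}_{\hat\gamma}\}$ denoting the quantity $n^{-1}X^T(W^l)^{1/2}(I-P^l)G_j(I-P^l)G_j(I-P^l)(W^l)^{1/2}X$, the sign-flipped standardized score is $S^{j,l}_{\hat\gamma}=S^{*,j,l}_{\hat\gamma}\,\mathrm{Var}\{S^{*,j,l}_{\hat\gamma}\}^{-1/2}$. Standing regularity conditions, for all $l,l'$ whose null hypotheses are true: (i)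 $n^{-1}\sum_{i=1}^n\mathrm{Cov}(\nu^{*l}_{\gamma_0,i},\nu^{*l'}_{\gamma_0,i})$ converges as $n\to\infty$ to a finite limit, which is positive when $l=l'$; (ii) (Lindeberg) for every $\epsilon>0$, $n^{-1}\sum_{i=1}^n\mathbb{E}[(\nu^{*l}_{\gamma_0,i})^2\mathbf{1}\{|\nu^{*l}_{\gamma_0,i}|>\epsilon\sqrt n\}]\to0$; (iii) the nuisance estimators are such that $S^{*,j,l}_{\hat\gamma}=S^{*,j,l}_{\gamma_0}+o_p(1)$ for each $1\le j\le w$; (iv) $\mathrm{Var}\{S^{*,j,l}_{\hat\gamma}\}$ converges in probability to a positive constant depending on $l$ but not on $j$ (asymptotic equivalence of standardized and effective scores).
   Formalization: The exact limit is claimed only if ψ strictly increases when all its positive arguments strictly increase, or if ties T_j=T_j' have probability tending to 0; for other non-decreasing ψ (e.g. constant) the limit exists and is at most ⌊αw⌋/w; the T_j are assumed measurable. *)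

theory Defs
  imports "HOL-Probability.Probability"
    "Jordan_Normal_Form.Gauss_Jordan_Elimination"
begin

hide_type (open) Finite_Cartesian_Product.vec

section \<open>Exponential dispersion families and link functions\<close>

text \<open>
  The known ingredients of one model: a dominating measure on the real line (for instance Lebesgue
  or counting measure), the functions \<open>a\<close>, \<open>b\<close>, \<open>c\<close> of the density and the link function \<open>h\<close>.
\<close>

record edf_glm =
  dominating :: "real measure"
  fun_a :: "real \<Rightarrow> real"
  fun_b :: "real \<Rightarrow> real"
  fun_c :: "real \<Rightarrow> real \<Rightarrow> real"
  link :: "real \<Rightarrow> real"

definition edf_law :: "edf_glm \<Rightarrow> real \<Rightarrow> real \<Rightarrow> real measure" where
  "edf_law F \<theta> \<phi> =
     density (dominating F)
       (\<lambda>y. ennreal (exp ((y * \<theta> - fun_b F \<theta>) / fun_a F \<phi> + fun_c F y \<phi>)))"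

definition edf_params :: "edf_glm \<Rightarrow> real \<Rightarrow> real \<Rightarrow> bool" where
  "edf_params F \<theta> \<phi> \<longleftrightarrow>
     fun_a F \<phi> > 0 \<and> prob_space (edf_law F \<theta> \<phi>) \<and> integrable (edf_law F \<theta> \<phi>) (\<lambda>y. y\<^sup>2)"

definition edf_mean :: "edf_glm \<Rightarrow> real \<Rightarrow> real \<Rightarrow> real" where
  "edf_mean F \<theta> \<phi> = (\<integral>y. y \<partial>edf_law F \<theta> \<phi>)"

definition mean_space :: "edf_glm \<Rightarrow> real set" where
  "mean_space F = {edf_mean F \<theta> \<phi> | \<theta> \<phi>. edf_params F \<theta> \<phi>}"

definition inv_link :: "edf_glm \<Rightarrow> real \<Rightarrow> real" where
  "inv_link F = inv_into (mean_space F) (link F)"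

text \<open>
  Variance of the member of the family with mean \<open>\<mu>\<close> and dispersion parameter \<open>\<phi>\<close>.  The mean
  is strictly increasing in \<open>\<theta>\<close> unless the law is degenerate, so the value does not depend on
  which \<open>\<theta>\<close> is selected.
\<close>

definition edf_variance :: "edf_glm \<Rightarrow> real \<Rightarrow> real \<Rightarrow> real" where
  "edf_variance F \<phi> \<mu> =
     (let \<theta> = (SOME \<theta>. edf_params F \<theta> \<phi> \<and> edf_mean F \<theta> \<phi> = \<mu>)
      in \<integral>y. (y - \<mu>)\<^sup>2 \<partial>edf_law F \<theta> \<phi>)"

definition valid_edf_glm :: "edf_glm \<Rightarrow> bool" where
  "valid_edf_glm F \<longleftrightarrow>
     sigma_finite_measure (dominating F) \<and> sets (dominating F) = sets borel \<and>
     (\<forall>\<phi>. (\<lambda>y. fun_c F y \<phi>) \<in> borel_measurable borel) \<and>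
     inj_on (link F) (mean_space F)"

section \<open>Probabilistic notions\<close>

definition cov :: "'a measure \<Rightarrow> ('a \<Rightarrow> real) \<Rightarrow> ('a \<Rightarrow> real) \<Rightarrow> real" where
  "cov M U V = (\<integral>\<omega>. (U \<omega> - (\<integral>\<omega>'. U \<omega>' \<partial>M)) * (V \<omega> - (\<integral>\<omega>'. V \<omega>' \<partial>M)) \<partial>M)"

text \<open>
  The probability space may change with \<open>n\<close>, which is harmless as the limit is a constant.
\<close>

definition tendsto_in_prob ::
    "(nat \<Rightarrow> 'a measure) \<Rightarrow> (nat \<Rightarrow> 'a \<Rightarrow> real) \<Rightarrow> real \<Rightarrow> bool" where
  "tendsto_in_prob M U u \<longleftrightarrow>
     (\<forall>n. U n \<in> borel_measurable (M n)) \<and>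
     (\<forall>\<epsilon>>0. (\<lambda>n. measure (M n) {\<omega> \<in> space (M n). \<bar>U n \<omega> - u\<bar> > \<epsilon>}) \<longlonglongrightarrow> 0)"

section \<open>The data, the flips and the scores\<close>

text \<open>
  Index conventions: models are numbered \<open>1, \<dots>, nmodels\<close> and flips \<open>1, \<dots>, nflips\<close>; units (and
  hence rows and columns of matrices) are numbered from \<open>0\<close> to \<open>n - 1\<close>.  Everything may depend on
  the sample size \<open>n\<close>, except for the families and the parameters \<open>\<beta>\<close> and \<open>\<gamma>\<close>.  The design has
  \<open>ncovs\<close> columns in total: one target column and \<open>ncovs - 1\<close> nuisance columns.
\<close>

record 'a flip_glm =
  nmodels :: nat
  nflips :: nat
  ncovs :: nat
  pspace :: "nat \<Rightarrow> 'a measure"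
  family :: "nat \<Rightarrow> edf_glm"
  Xmat :: "nat \<Rightarrow> real mat"
  Zmat :: "nat \<Rightarrow> real mat"
  dispersion :: "nat \<Rightarrow> nat \<Rightarrow> nat \<Rightarrow> real"            \<comment> \<open>sample size, model, unit\<close>
  response :: "nat \<Rightarrow> nat \<Rightarrow> nat \<Rightarrow> 'a \<Rightarrow> real"        \<comment> \<open>sample size, model, unit\<close>
  beta_true :: "nat \<Rightarrow> real"
  beta_null :: "nat \<Rightarrow> real"
  gamma_true :: "nat \<Rightarrow> real Matrix.vec"
  gamma_hat :: "nat \<Rightarrow> nat \<Rightarrow> 'a \<Rightarrow> real Matrix.vec"    \<comment> \<open>sample size, model\<close>
  flip :: "nat \<Rightarrow> nat \<Rightarrow> 'a \<Rightarrow> nat \<Rightarrow> real"            \<comment> \<open>sample size, flip, outcome, unit\<close>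

definition lin_pred ::
    "'a flip_glm \<Rightarrow> nat \<Rightarrow> real \<Rightarrow> real Matrix.vec \<Rightarrow> nat \<Rightarrow> real" where
  "lin_pred D n b \<gamma> i = Xmat D n $$ (i, 0) * b + vec_index (Zmat D n *\<^sub>v \<gamma>) i"

definition null_true :: "'a flip_glm \<Rightarrow> nat \<Rightarrow> bool" where
  "null_true D l \<longleftrightarrow> beta_true D l = beta_null D l"

definition true_nulls :: "'a flip_glm \<Rightarrow> nat set" where
  "true_nulls D = {l \<in> {1..nmodels D}. null_true D l}"

subsection \<open>Effective and standardized scores\<close>

text \<open>
  The following quantities are evaluated at \<open>\<beta>\<^sup>l = \<beta>\<^sup>l\<^sub>0\<close> and at the nuisance value \<open>\<gamma>\<close>.
  \<open>W\<close> is diagonal with nonnegative entries, so its square root is taken entrywise.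
\<close>

definition mu :: "'a flip_glm \<Rightarrow> nat \<Rightarrow> nat \<Rightarrow> real Matrix.vec \<Rightarrow> nat \<Rightarrow> real" where
  "mu D n l \<gamma> i = inv_link (family D l) (lin_pred D n (beta_null D l) \<gamma> i)"

definition dmu :: "'a flip_glm \<Rightarrow> nat \<Rightarrow> nat \<Rightarrow> real Matrix.vec \<Rightarrow> nat \<Rightarrow> real" where
  "dmu D n l \<gamma> i = deriv (inv_link (family D l)) (lin_pred D n (beta_null D l) \<gamma> i)"

definition var :: "'a flip_glm \<Rightarrow> nat \<Rightarrow> nat \<Rightarrow> real Matrix.vec \<Rightarrow> nat \<Rightarrow> real" where
  "var D n l \<gamma> i = edf_variance (family D l) (dispersion D n l i) (mu D n l \<gamma> i)"

definition weight :: "'a flip_glm \<Rightarrow> nat \<Rightarrow> nat \<Rightarrow> real Matrix.vec \<Rightarrow> nat \<Rightarrow> real" where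
  "weight D n l \<gamma> i = dmu D n l \<gamma> i * inverse (var D n l \<gamma> i) * dmu D n l \<gamma> i"

definition Wmat :: "'a flip_glm \<Rightarrow> nat \<Rightarrow> nat \<Rightarrow> real Matrix.vec \<Rightarrow> real mat" where
  "Wmat D n l \<gamma> = mat_diag n (weight D n l \<gamma>)"

definition Wsqrt :: "'a flip_glm \<Rightarrow> nat \<Rightarrow> nat \<Rightarrow> real Matrix.vec \<Rightarrow> real mat" where
  "Wsqrt D n l \<gamma> = mat_diag n (\<lambda>i. sqrt (weight D n l \<gamma> i))"

definition Vinvsqrt :: "'a flip_glm \<Rightarrow> nat \<Rightarrow> nat \<Rightarrow> real Matrix.vec \<Rightarrow> real mat" where
  "Vinvsqrt D n l \<gamma> = mat_diag n (\<lambda>i. inverse (sqrt (var D n l \<gamma> i)))"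

definition Pmat :: "'a flip_glm \<Rightarrow> nat \<Rightarrow> nat \<Rightarrow> real Matrix.vec \<Rightarrow> real mat" where
  "Pmat D n l \<gamma> =
     Wsqrt D n l \<gamma> * Zmat D n
       * the (mat_inverse (transpose_mat (Zmat D n) * Wmat D n l \<gamma> * Zmat D n))
       * transpose_mat (Zmat D n) * Wsqrt D n l \<gamma>"

definition Rmat :: "'a flip_glm \<Rightarrow> nat \<Rightarrow> nat \<Rightarrow> real Matrix.vec \<Rightarrow> real mat" where
  "Rmat D n l \<gamma> = 1\<^sub>m n - Pmat D n l \<gamma>"

definition score_row :: "'a flip_glm \<Rightarrow> nat \<Rightarrow> nat \<Rightarrow> real Matrix.vec \<Rightarrow> real mat" where
  "score_row D n l \<gamma> =
     transpose_mat (Xmat D n) * Wsqrt D n l \<gamma> * Rmat D n l \<gamma> * Vinvsqrt D n l \<gamma>"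

definition nu ::
    "'a flip_glm \<Rightarrow> nat \<Rightarrow> nat \<Rightarrow> real Matrix.vec \<Rightarrow> nat \<Rightarrow> 'a \<Rightarrow> real" where
  "nu D n l \<gamma> i \<omega> = score_row D n l \<gamma> $$ (0, i) * (response D n l i \<omega> - mu D n l \<gamma> i)"

definition Gmat :: "'a flip_glm \<Rightarrow> nat \<Rightarrow> nat \<Rightarrow> 'a \<Rightarrow> real mat" where
  "Gmat D n j \<omega> = mat_diag n (flip D n j \<omega>)"

definition eff_score ::
    "'a flip_glm \<Rightarrow> nat \<Rightarrow> nat \<Rightarrow> nat \<Rightarrow> real Matrix.vec \<Rightarrow> 'a \<Rightarrow> real" where
  "eff_score D n j l \<gamma> \<omega> = (\<Sum>i<n. flip D n j \<omega> i * nu D n l \<gamma> i \<omega>) / sqrt (real n)"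

definition score_var ::
    "'a flip_glm \<Rightarrow> nat \<Rightarrow> nat \<Rightarrow> nat \<Rightarrow> real Matrix.vec \<Rightarrow> 'a \<Rightarrow> real" where
  "score_var D n j l \<gamma> \<omega> =
     (transpose_mat (Xmat D n) * Wsqrt D n l \<gamma> * Rmat D n l \<gamma> * Gmat D n j \<omega> * Rmat D n l \<gamma>
        * Gmat D n j \<omega> * Rmat D n l \<gamma> * Wsqrt D n l \<gamma> * Xmat D n) $$ (0, 0) / real n"

definition std_score :: "'a flip_glm \<Rightarrow> nat \<Rightarrow> nat \<Rightarrow> nat \<Rightarrow> 'a \<Rightarrow> real" where
  "std_score D n j l \<omega> =
     eff_score D n j l (gamma_hat D n l \<omega>) \<omega> / sqrt (score_var D n j l (gamma_hat D n l \<omega>) \<omega>)"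

text \<open>The sum defining \<open>eff_score\<close> is the matrix product \<open>X\<^sup>T W\<^sup>1\<^sup>/\<^sup>2 (I - P) V\<^sup>-\<^sup>1\<^sup>/\<^sup>2 G\<^sub>j (Y - \<mu>)\<close>.\<close>

lemma eff_score_matrix:
  assumes "Xmat D n \<in> carrier_mat n 1"
  shows "eff_score D n j l \<gamma> \<omega> =
    (score_row D n l \<gamma> * Gmat D n j \<omega>
       * Matrix.mat n 1 (\<lambda>(i, _). response D n l i \<omega> - mu D n l \<gamma> i)) $$ (0, 0) / sqrt (real n)"
proof -
  have R: "score_row D n l \<gamma> \<in> carrier_mat 1 n"
    using assms by (auto simp: score_row_def Vinvsqrt_def mat_diag_def)
  show ?thesis
    using R
    by (subst Gmat_def, subst mat_diag_mult_right[OF R])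
      (auto simp: eff_score_def nu_def scalar_prod_def lessThan_atLeast0 mult_ac intro!: sum.cong)
qed

subsection \<open>Model assumptions\<close>

definition unit_vec_space :: "'a flip_glm \<Rightarrow> (nat \<Rightarrow> real) measure" where
  "unit_vec_space D = PiM {1..nmodels D} (\<lambda>_. borel)"

definition data_space :: "'a flip_glm \<Rightarrow> nat \<Rightarrow> (nat \<Rightarrow> nat \<Rightarrow> real) measure" where
  "data_space D n = PiM {..<n} (\<lambda>_. unit_vec_space D)"

definition unit_vec :: "'a flip_glm \<Rightarrow> nat \<Rightarrow> nat \<Rightarrow> 'a \<Rightarrow> nat \<Rightarrow> real" where
  "unit_vec D n i \<omega> = (\<lambda>l\<in>{1..nmodels D}. response D n l i \<omega>)"

definition data :: "'a flip_glm \<Rightarrow> nat \<Rightarrow> 'a \<Rightarrow> nat \<Rightarrow> nat \<Rightarrow> real" where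
  "data D n \<omega> = (\<lambda>i\<in>{..<n}. unit_vec D n i \<omega>)"

text \<open>
  The law of a response has canonical parameter \<open>\<theta>\<close>, whose value is tied to the linear predictor
  through the mean.  No assumption is made on the dependence between the components of \<open>unit_vec\<close>.
\<close>

definition response_model :: "'a flip_glm \<Rightarrow> bool" where
  "response_model D \<longleftrightarrow>
     2 \<le> nmodels D \<and> 1 \<le> ncovs D \<and>
     (\<forall>n. prob_space (pspace D n)) \<and>
     (\<forall>n. Xmat D n \<in> carrier_mat n 1 \<and> Zmat D n \<in> carrier_mat n (ncovs D - 1)) \<and>
     (\<forall>l\<in>{1..nmodels D}. valid_edf_glm (family D l) \<and> gamma_true D l \<in> carrier_vec (ncovs D - 1)) \<and>
     (\<forall>n. \<forall>l\<in>{1..nmodels D}. \<forall>i<n.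
        let \<eta> = lin_pred D n (beta_true D l) (gamma_true D l) i in
        response D n l i \<in> borel_measurable (pspace D n) \<and>
        (\<exists>\<theta>. edf_params (family D l) \<theta> (dispersion D n l i) \<and>
             distr (pspace D n) borel (response D n l i)
               = edf_law (family D l) \<theta> (dispersion D n l i)) \<and>
        \<eta> \<in> link (family D l) ` mean_space (family D l) \<and>
        (\<integral>\<omega>. response D n l i \<omega> \<partial>pspace D n) = inv_link (family D l) \<eta>) \<and>
     (\<forall>n. prob_space.indep_vars (pspace D n) (\<lambda>_. unit_vec_space D) (unit_vec D n) {..<n})"

text \<open>The estimators are statistics: they are measurable functions of the responses.\<close>

definition nuisance_estimators :: "'a flip_glm \<Rightarrow> bool" where
  "nuisance_estimators D \<longleftrightarrow>
     (\<forall>l\<in>{1..nmodels D}.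
        (\<forall>n. \<forall>\<omega>\<in>space (pspace D n). gamma_hat D n l \<omega> \<in> carrier_vec (ncovs D - 1)) \<and>
        (\<forall>r<ncovs D - 1.
           (\<forall>n. (\<lambda>\<omega>. vec_index (gamma_hat D n l \<omega>) r) \<in> borel_measurable
                  (vimage_algebra (space (pspace D n)) (data D n) (data_space D n))) \<and>
           tendsto_in_prob (pspace D) (\<lambda>n \<omega>. vec_index (gamma_hat D n l \<omega>) r)
             (vec_index (gamma_true D l) r)))"

definition sign_vectors :: "nat \<Rightarrow> (nat \<Rightarrow> real) set" where
  "sign_vectors n = {..<n} \<rightarrow>\<^sub>E {-1, 1}"

text \<open>The flips carry no model index: the same ones are used for all models.\<close>

definition random_flips :: "'a flip_glm \<Rightarrow> bool" where
  "random_flips D \<longleftrightarrow>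
     1 \<le> nflips D \<and>
     (\<forall>n. \<forall>\<omega>\<in>space (pspace D n). flip D n 1 \<omega> = (\<lambda>i\<in>{..<n}. 1)) \<and>
     (\<forall>n. \<forall>j\<in>{2..nflips D}.
        flip D n j \<in> measurable (pspace D n) (count_space (sign_vectors n)) \<and>
        distr (pspace D n) (count_space (sign_vectors n)) (flip D n j)
          = uniform_count_measure (sign_vectors n)) \<and>
     (\<forall>n. prob_space.indep_vars (pspace D n)
            (\<lambda>_. count_space (sign_vectors n)) (flip D n) {2..nflips D}) \<and>
     (\<forall>n. prob_space.indep_var (pspace D n)
            (data_space D n) (data D n)
            (PiM {2..nflips D} (\<lambda>_. count_space (sign_vectors n)))
            (\<lambda>\<omega>. \<lambda>j\<in>{2..nflips D}. flip D n j \<omega>))"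

text \<open>
  In this order: convergence of the averaged covariances, the Lindeberg condition, asymptotic
  negligibility of the nuisance estimation, and stabilisation of the variance used for
  standardizing.  The last two include measurability of the plug-in scores and variances.
\<close>

definition regularity :: "'a flip_glm \<Rightarrow> bool" where
  "regularity D \<longleftrightarrow>
     (\<exists>\<Sigma>. \<forall>l\<in>true_nulls D. \<Sigma> l l > 0 \<and>
        (\<forall>l'\<in>true_nulls D.
           (\<lambda>n. (\<Sum>i<n. cov (pspace D n) (nu D n l (gamma_true D l) i)
                                         (nu D n l' (gamma_true D l') i)) / real n)
             \<longlonglongrightarrow> \<Sigma> l l')) \<and>
     (\<forall>l\<in>true_nulls D. \<forall>\<epsilon>>0.
        (\<lambda>n. (\<Sum>i<n. \<integral>\<omega>. (nu D n l (gamma_true D l) i \<omega>)\<^sup>2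
                 * indicator {\<omega>. \<bar>nu D n l (gamma_true D l) i \<omega>\<bar> > \<epsilon> * sqrt (real n)} \<omega>
               \<partial>pspace D n) / real n) \<longlonglongrightarrow> 0) \<and>
     (\<forall>l\<in>true_nulls D. \<forall>j\<in>{1..nflips D}.
        tendsto_in_prob (pspace D)
          (\<lambda>n \<omega>. eff_score D n j l (gamma_hat D n l \<omega>) \<omega> - eff_score D n j l (gamma_true D l) \<omega>)
          0) \<and>
     (\<forall>l\<in>true_nulls D. \<exists>c>0. \<forall>j\<in>{1..nflips D}.
        tendsto_in_prob (pspace D)
          (\<lambda>n \<omega>. score_var D n j l (gamma_hat D n l \<omega>) \<omega>) c)"

section \<open>The test\<close>

definition test_stat ::
    "'a flip_glm \<Rightarrow> ((nat \<Rightarrow> real) \<Rightarrow> real) \<Rightarrow> nat set \<Rightarrow> nat \<Rightarrow> nat \<Rightarrow> 'a \<Rightarrow> real" where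
  "test_stat D \<psi> L n j \<omega> = \<psi> (\<lambda>l\<in>L. \<bar>std_score D n j l \<omega>\<bar>)"

text \<open>\<open>order_stat w t k\<close> is the \<open>k\<close>-th smallest of \<open>t 1, \<dots>, t w\<close>, with \<open>1 \<le> k \<le> w\<close>.\<close>

definition order_stat :: "nat \<Rightarrow> (nat \<Rightarrow> real) \<Rightarrow> nat \<Rightarrow> real" where
  "order_stat w t k = sort (map t [1..<w + 1]) ! (k - 1)"

definition rejects ::
    "'a flip_glm \<Rightarrow> ((nat \<Rightarrow> real) \<Rightarrow> real) \<Rightarrow> nat set \<Rightarrow> real \<Rightarrow> nat \<Rightarrow> 'a \<Rightarrow> bool" where
  "rejects D \<psi> L \<alpha> n \<omega> \<longleftrightarrow>
     test_stat D \<psi> L n 1 \<omega>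
       > order_stat (nflips D) (\<lambda>j. test_stat D \<psi> L n j \<omega>) (nat \<lceil>(1 - \<alpha>) * real (nflips D)\<rceil>)"

definition rejection_prob ::
    "'a flip_glm \<Rightarrow> ((nat \<Rightarrow> real) \<Rightarrow> real) \<Rightarrow> nat set \<Rightarrow> real \<Rightarrow> nat \<Rightarrow> real" where
  "rejection_prob D \<psi> L \<alpha> n =
     measure (pspace D n) {\<omega> \<in> space (pspace D n). rejects D \<psi> L \<alpha> n \<omega>}"

text \<open>
  Functions on \<open>\<real>\<^sup>L\<close> are represented as functions on \<open>L \<rightarrow>\<^sub>E UNIV\<close>.  Being non-decreasing in each
  argument is the same as being monotone for the componentwise order.
\<close>

definition nondecreasing_on :: "nat set \<Rightarrow> ((nat \<Rightarrow> real) \<Rightarrow> real) \<Rightarrow> bool" where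
  "nondecreasing_on L \<psi> \<longleftrightarrow>
     (\<forall>x \<in> L \<rightarrow>\<^sub>E UNIV. \<forall>l\<in>L. \<forall>t. x l \<le> t \<longrightarrow> \<psi> x \<le> \<psi> (x(l := t)))"

text \<open>
  The limit \<open>\<lfloor>\<alpha>w\<rfloor> / w\<close> is not attained for a non-decreasing function with flat stretches, as
  ties between the statistics make the test conservative (a constant \<open>\<psi>\<close> never rejects).  Ties are
  asymptotically absent if \<open>\<psi>\<close> increases whenever all its arguments do; sums, maxima, minima and
  all other order statistics are of this type.
\<close>

definition jointly_increasing_on :: "nat set \<Rightarrow> ((nat \<Rightarrow> real) \<Rightarrow> real) \<Rightarrow> bool" where
  "jointly_increasing_on L \<psi> \<longleftrightarrow>
     (\<forall>x \<in> L \<rightarrow>\<^sub>E UNIV. \<forall>y \<in> L \<rightarrow>\<^sub>E UNIV. (\<forall>l\<in>L. 0 < x l \<and> x l < y l) \<longrightarrow> \<psi> x < \<psi> y)"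

definition asymptotically_untied ::
    "'a flip_glm \<Rightarrow> ((nat \<Rightarrow> real) \<Rightarrow> real) \<Rightarrow> nat set \<Rightarrow> bool" where
  "asymptotically_untied D \<psi> L \<longleftrightarrow>
     (\<forall>j\<in>{1..nflips D}. \<forall>j'\<in>{1..nflips D}. j \<noteq> j' \<longrightarrow>
        (\<lambda>n. measure (pspace D n)
               {\<omega> \<in> space (pspace D n). test_stat D \<psi> L n j \<omega> = test_stat D \<psi> L n j' \<omega>})
          \<longlonglongrightarrow> 0)"

end

theory Submission
  imports Defs
begin

text \<open>
  The test compares the statistic of the observed data with those of randomly sign-flipped data.  It
  has the right size asymptotically because, under the null hypothesis, the vectors of scores of the
  \<open>w\<close> flips become independent and identically distributed.  Then each flip, the observed one
  included, is equally likely to be among those of the \<open>w - k\<close> largest statistics, where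
  \<open>k = \<lceil>(1 - \<alpha>) w\<rceil>\<close> and hence \<open>w - k = \<lfloor>\<alpha> w\<rfloor>\<close>.

  Asymptotic normality is proved through characteristic functions.  Given the data, the flips can be
  integrated out exactly, each sign contributing a cosine (\<open>char_flipped_sum\<close>).  What remains is a
  product over the independent units.  A second-order expansion of the factors together with the
  Lindeberg condition yields the limit \<open>exp (- q / 2)\<close>, where \<open>q\<close> is a sum over the flips of the same
  quadratic form (\<open>flip_factor_product_tendsto\<close>).  The random signs remove the correlation between
  flips, while the correlation between models, whatever it is, survives in the quadratic form and is
  common to all flips because they act on all models simultaneously.  Standardizing changes the
  scores only by constants and errors that vanish in probability (\<open>std_score_tendsto\<close>).

  It remains to pass to the limit in the rejection probability, although the function \<open>\<psi>\<close> is merely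
  monotone and the limiting Gaussian law may be degenerate.  Rejection is a Boolean combination of
  comparisons \<open>T j < T i\<close>.  If all scores of flip \<open>i\<close> are multiplied by \<open>s\<close> and those of flip \<open>j\<close> are
  divided by \<open>s\<close>, then as \<open>s\<close> increases the array of scores meets the frontier of such a comparison
  event at most once (\<open>frontier_comparison_once\<close>).  Since these rescalings preserve null sets of the
  limiting law, the frontier is negligible (\<open>gauss_vec_null_of_scaling\<close>), and a portmanteau theorem
  shows that the rejection probability converges (\<open>portmanteau_open\<close>, \<open>prob_high_rank_tendsto\<close>).

  The value of the limit follows by counting: at most \<open>w - k\<close> of the \<open>w\<close> statistics exceed at least
  \<open>k\<close> others, with equality if there are no ties (\<open>card_high_rank_le\<close>, \<open>card_high_rank_eq\<close>), and all
  flips have the same chance to do so (\<open>prob_high_rank_le\<close>).  Ties are excluded in the limit either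
  by the scaling argument, if \<open>\<psi>\<close> is jointly increasing, or by assumption.
\<close>

section \<open>Sums of randomly flipped contributions\<close>

lemma iexp_quadratic_remainder:
  "cmod (iexp x - (1 + \<i> * x - of_real (x\<^sup>2 / 2))) \<le> min (x\<^sup>2) (\<bar>x\<bar> ^ 3)"
proof -
  have eq: "(\<Sum>k \<le> 2. (\<i> * x)^k / fact k) = 1 + \<i> * x - of_real (x\<^sup>2 / 2)"
    by (simp add: numeral_2_eq_2 power2_eq_square) (simp add: algebra_simps)
  have fact3: "fact (Suc 2) = (6::real)" "fact 2 = (2::real)" by (simp_all add: eval_nat_numeral)
  have "cmod (iexp x - (1 + \<i> * x - of_real (x\<^sup>2 / 2))) \<le> \<bar>x\<bar> ^ Suc 2 / 6"
    using iexp_approx1[of x 2] unfolding eq fact3 .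
  also have "\<dots> \<le> \<bar>x\<bar> ^ Suc 2" by simp
  also have "\<dots> = \<bar>x\<bar> ^ 3" by (simp only: eval_nat_numeral)
  finally have cubic: "cmod (iexp x - (1 + \<i> * x - of_real (x\<^sup>2 / 2))) \<le> \<bar>x\<bar> ^ 3" .
  have "cmod (iexp x - (1 + \<i> * x - of_real (x\<^sup>2 / 2))) \<le> 2 * \<bar>x\<bar> ^ 2 / 2"
    using iexp_approx2[of x 2] unfolding eq fact3 .
  also have "\<dots> = x\<^sup>2" by simp
  finally show ?thesis using cubic by (rule min.boundedI)
qed

text \<open>
  The left product is the average of \<open>iexp (v + \<Sum>j\<in>J. \<plusminus>u j)\<close> over all choices of signs, so this is
  the average of the one-dimensional expansion: the cross terms cancel and only the sum of the
  squares survives.  Keeping the minimum of the quadratic and the cubic bound is what makes a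
  Lindeberg condition sufficient later on.
\<close>

lemma sign_average_quadratic_remainder:
  assumes "finite J" and "\<bar>v\<bar> + (\<Sum>j\<in>J. \<bar>u j\<bar>) \<le> r"
  shows "cmod (iexp v * (\<Prod>j\<in>J. of_real (cos (u j)))
      - (1 + \<i> * v - of_real ((v\<^sup>2 + (\<Sum>j\<in>J. (u j)\<^sup>2)) / 2))) \<le> min (r\<^sup>2) (r ^ 3)"
  using assms
proof (induction J arbitrary: v rule: finite_induct)
  case empty
  have "min (v\<^sup>2) (\<bar>v\<bar> ^ 3) \<le> min (r\<^sup>2) (r ^ 3)"
    using empty power_mono[of "\<bar>v\<bar>" r 2] power_mono[of "\<bar>v\<bar>" r 3] by (intro min.mono) auto
  moreover have "cmod (iexp v - (1 + \<i> * v - of_real (v\<^sup>2 / 2))) \<le> min (v\<^sup>2) (\<bar>v\<bar> ^ 3)"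
    by (rule iexp_quadratic_remainder)
  ultimately show ?case by (simp only: prod.empty sum.empty mult_1_right add_0_right)
next
  case (insert a J)
  let ?P = "\<Prod>j\<in>J. complex_of_real (cos (u j))" and ?S = "\<Sum>j\<in>J. (u j)\<^sup>2"
  \<comment> \<open>Adding one sign averages the two expansions at \<open>v + u a\<close> and \<open>v - u a\<close>.\<close>
  have half_le: "(x + y) / 2 \<le> m" if "x \<le> m" "y \<le> m" for x y m :: real using that by simp
  have half: "cmod ((x + y) / 2) \<le> (cmod x + cmod y) / 2" for x y
    by (simp add: norm_divide norm_triangle_ineq)
  let ?D = "\<lambda>v. iexp v * ?P - (1 + \<i> * v - of_real ((v\<^sup>2 + ?S) / 2))"
  have b: "cmod (?D (v + u a)) \<le> min (r\<^sup>2) (r ^ 3)" "cmod (?D (v - u a)) \<le> min (r\<^sup>2) (r ^ 3)"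
    using insert.prems insert.hyps
    by (intro insert.IH; simp; linarith)+
  have c: "of_real (cos (u a)) = (iexp (u a) + iexp (- u a)) / (2::complex)"
    by (simp add: cos_of_real[symmetric] cos_exp_eq)
  have e: "iexp (v + u a) = iexp v * iexp (u a)" "iexp (v - u a) = iexp v * iexp (- u a)"
    by (simp_all add: exp_add[symmetric] algebra_simps)
  have half_sum: "(x - y) / 2 + (x + y) / 2 = x" for x y :: complex
    by (simp add: field_simps)
  have alg: "x * ((A + B) / 2 * P) - (1 + \<i> * w - (w\<^sup>2 + (y\<^sup>2 + S)) / 2)
      = (x * A * P - (1 + \<i> * (w + y) - ((w + y)\<^sup>2 + S) / 2)
        + (x * B * P - (1 + \<i> * (w - y) - ((w - y)\<^sup>2 + S) / 2))) / 2" for x A B P w y S :: complex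
    by (simp add: power2_sum power2_diff add_divide_distrib diff_divide_distrib,
        simp add: algebra_simps, rule half_sum)
  have "iexp v * (\<Prod>j\<in>insert a J. of_real (cos (u j)))
      - (1 + \<i> * v - of_real ((v\<^sup>2 + (\<Sum>j\<in>insert a J. (u j)\<^sup>2)) / 2))
      = (?D (v + u a) + ?D (v - u a)) / 2"
    unfolding e using alg[of "iexp v" "iexp (u a)" "iexp (- u a)" ?P v "u a" ?S]
    by (simp only: prod.insert[OF insert.hyps] sum.insert[OF insert.hyps] c of_real_add of_real_diff
        of_real_divide of_real_power of_real_numeral)
  also have "cmod \<dots> \<le> (cmod (?D (v + u a)) + cmod (?D (v - u a))) / 2"
    by (rule half)
  also have "\<dots> \<le> min (r\<^sup>2) (r ^ 3)" by (rule half_le[OF b])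
  finally show ?case .
qed

lemma exp_minus_linear_remainder:
  fixes x :: real assumes "0 \<le> x" shows "\<bar>exp (- x) - (1 - x)\<bar> \<le> x\<^sup>2"
proof -
  have "1 - x \<le> exp (- x)" using exp_ge_add_one_self[of "- x"] by simp
  moreover have "exp (- x) \<le> 1 / (1 + x)"
    using exp_ge_add_one_self[of x] assms by (simp add: exp_minus field_simps)
  moreover have "1 / (1 + x) \<le> 1 - x + x\<^sup>2"
    using assms by (simp add: field_simps power2_eq_square)
  ultimately show ?thesis by linarith
qed

text \<open>
  The deterministic core of the Lindeberg central limit theorem: factors close to \<open>1 - s/2\<close>, with
  uniformly small \<open>s\<close>, are close to \<open>exp (- s/2)\<close>, and products of numbers in the unit disc
  differ by at most the sum of the differences.
\<close>

lemma prod_tendsto_exp: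
  fixes a :: "nat \<Rightarrow> nat \<Rightarrow> complex" and s :: "nat \<Rightarrow> nat \<Rightarrow> real"
  assumes a: "\<And>n i. i < n \<Longrightarrow> cmod (a n i) \<le> 1" and s: "\<And>n i. i < n \<Longrightarrow> 0 \<le> s n i"
    and approx: "(\<lambda>n. \<Sum>i<n. cmod (a n i - (1 - of_real (s n i / 2)))) \<longlonglongrightarrow> 0"
    and total: "(\<lambda>n. \<Sum>i<n. s n i) \<longlonglongrightarrow> \<sigma>"
    and small: "\<And>e. 0 < e \<Longrightarrow> \<forall>\<^sub>F n in sequentially. \<forall>i<n. s n i \<le> e"
  shows "(\<lambda>n. \<Prod>i<n. a n i) \<longlonglongrightarrow> of_real (exp (- \<sigma> / 2))"
proof -
  let ?b = "\<lambda>n i. complex_of_real (exp (- (s n i / 2)))"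
  have sq: "(\<lambda>n. \<Sum>i<n. (s n i)\<^sup>2) \<longlonglongrightarrow> 0"
  proof (rule LIMSEQ_I)
    fix r :: real assume r: "0 < r"
    define e where "e = r / (2 * (\<bar>\<sigma>\<bar> + 1))"
    have e: "0 < e" using r by (simp add: e_def)
    have "\<forall>\<^sub>F n in sequentially. (\<Sum>i<n. s n i) < \<bar>\<sigma>\<bar> + 1"
      by (rule order_tendstoD[OF total]) simp
    then have "\<forall>\<^sub>F n in sequentially. norm ((\<Sum>i<n. (s n i)\<^sup>2) - 0) < r"
      using small[OF e]
    proof eventually_elim
      case (elim n)
      have "(\<Sum>i<n. (s n i)\<^sup>2) \<le> (\<Sum>i<n. e * s n i)"
        using elim s by (auto intro!: sum_mono mult_right_mono simp: power2_eq_square)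
      also have "\<dots> = e * (\<Sum>i<n. s n i)" by (simp add: sum_distrib_left)
      also have "\<dots> \<le> e * (\<bar>\<sigma>\<bar> + 1)" using elim e by (intro mult_left_mono) auto
      also have "\<dots> = r / 2"
        using abs_ge_zero[of \<sigma>] by (simp add: e_def field_simps add_nonneg_eq_0_iff)
      also have "\<dots> < r" using r by simp
      finally show ?case by (simp add: sum_nonneg)
    qed
    then show "\<exists>no. \<forall>n\<ge>no. norm ((\<Sum>i<n. (s n i)\<^sup>2) - 0) < r"
      by (simp add: eventually_sequentially)
  qed
  have "(\<lambda>n. (\<Prod>i<n. a n i) - (\<Prod>i<n. ?b n i)) \<longlonglongrightarrow> 0"
  proof (rule Lim_null_comparison)
    show "(\<lambda>n. (\<Sum>i<n. cmod (a n i - (1 - of_real (s n i / 2)))) + (\<Sum>i<n. (s n i)\<^sup>2)) \<longlonglongrightarrow> 0"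
      using tendsto_add[OF approx sq] by simp
    have "cmod ((\<Prod>i<n. a n i) - (\<Prod>i<n. ?b n i))
        \<le> (\<Sum>i<n. cmod (a n i - (1 - of_real (s n i / 2)))) + (\<Sum>i<n. (s n i)\<^sup>2)" for n
    proof -
      have "cmod ((\<Prod>i<n. a n i) - (\<Prod>i<n. ?b n i)) \<le> (\<Sum>i<n. cmod (a n i - ?b n i))"
        using a s by (intro norm_prod_diff) auto
      also have "\<dots> \<le> (\<Sum>i<n. cmod (a n i - (1 - of_real (s n i / 2))) + (s n i)\<^sup>2)"
      proof (rule sum_mono)
        fix i assume "i \<in> {..<n}"
        then have "0 \<le> s n i" using s by simp
        have "?b n i - (1 - of_real (s n i / 2)) = of_real (exp (- (s n i / 2)) - (1 - s n i / 2))"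
          by simp
        then have "cmod (?b n i - (1 - of_real (s n i / 2))) = \<bar>exp (- (s n i / 2)) - (1 - s n i / 2)\<bar>"
          by (simp only: norm_of_real)
        also have "\<dots> \<le> (s n i / 2)\<^sup>2" by (rule exp_minus_linear_remainder) (use \<open>0 \<le> s n i\<close> in simp)
        also have "\<dots> \<le> (s n i)\<^sup>2" by (simp add: power_divide)
        finally have "cmod (?b n i - (1 - of_real (s n i / 2))) \<le> (s n i)\<^sup>2" .
        moreover have "cmod (a n i - ?b n i) \<le> cmod (a n i - (1 - of_real (s n i / 2)))
            + cmod (?b n i - (1 - of_real (s n i / 2)))"
          using norm_triangle_ineq4[of "a n i - (1 - of_real (s n i / 2))" "?b n i - (1 - of_real (s n i / 2))"]
          by simp
        ultimately show "cmod (a n i - ?b n i) \<le> cmod (a n i - (1 - of_real (s n i / 2))) + (s n i)\<^sup>2"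
          by linarith
      qed
      finally show ?thesis by (simp add: sum.distrib)
    qed
    then show "\<forall>\<^sub>F n in sequentially. cmod ((\<Prod>i<n. a n i) - (\<Prod>i<n. ?b n i))
        \<le> (\<Sum>i<n. cmod (a n i - (1 - of_real (s n i / 2)))) + (\<Sum>i<n. (s n i)\<^sup>2)" by simp
  qed
  moreover have "(\<lambda>n. \<Prod>i<n. ?b n i) \<longlonglongrightarrow> of_real (exp (- \<sigma> / 2))"
  proof -
    have eq: "(\<Prod>i<n. ?b n i) = of_real (exp (- (\<Sum>i<n. s n i) / 2))" for n
      by (simp add: exp_sum sum_negf[symmetric] sum_divide_distrib)
    show ?thesis unfolding eq by (intro tendsto_intros total) simp
  qed
  ultimately have "(\<lambda>n. ((\<Prod>i<n. a n i) - (\<Prod>i<n. ?b n i)) + (\<Prod>i<n. ?b n i)) \<longlonglongrightarrow> 0 + of_real (exp (- \<sigma> / 2))"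
    by (rule tendsto_add)
  then show ?thesis by simp
qed

lemma finite_sign_vectors: "finite (sign_vectors n)"
  and card_sign_vectors: "card (sign_vectors n) = 2 ^ n"
  by (auto simp: sign_vectors_def card_PiE numeral_2_eq_2 intro!: finite_PiE)

lemma sign_vector_average:
  "(\<Sum>u\<in>sign_vectors n. iexp (\<Sum>i<n. u i * c i)) /\<^sub>R real (card (sign_vectors n))
     = (\<Prod>i<n. of_real (cos (c i)))"
proof -
  have two: "(\<Sum>y\<in>{-1,1}. iexp (y * c i)) = 2 * of_real (cos (c i))" for i
    by (simp add: cos_of_real[symmetric] cos_exp_eq)
  have "(\<Sum>u\<in>sign_vectors n. iexp (\<Sum>i<n. u i * c i))
      = (\<Sum>u\<in>sign_vectors n. \<Prod>i<n. iexp (u i * c i))"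
    by (simp add: exp_sum sum_distrib_left)
  also have "\<dots> = (\<Prod>i<n. \<Sum>y\<in>{-1,1}. iexp (y * c i))"
    unfolding sign_vectors_def by (subst prod_sum_PiE) auto
  also have "\<dots> = 2 ^ n * (\<Prod>i<n. of_real (cos (c i)))"
    unfolding two by (simp add: prod.distrib)
  finally show ?thesis by (simp add: card_sign_vectors scaleR_conv_of_real)
qed

lemma (in prob_space) expectation_uniform_flip:
  assumes "g \<in> measurable M (count_space (sign_vectors n))"
    and "distr M (count_space (sign_vectors n)) g = uniform_count_measure (sign_vectors n)"
  shows "expectation (\<lambda>\<omega>. iexp (\<Sum>i<n. g \<omega> i * c i)) = (\<Prod>i<n. of_real (cos (c i)))"
proof -
  have "expectation (\<lambda>\<omega>. iexp (\<Sum>i<n. g \<omega> i * c i))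
      = (\<integral>u. iexp (\<Sum>i<n. u i * c i) \<partial>uniform_count_measure (sign_vectors n))"
    unfolding assms(2)[symmetric] by (subst integral_distr[OF assms(1)]) auto
  also have "\<dots> = (\<Sum>u\<in>sign_vectors n. iexp (\<Sum>i<n. u i * c i) /\<^sub>R real (card (sign_vectors n)))"
    unfolding uniform_count_measure_def
    by (subst lebesgue_integral_point_measure_finite) (auto simp: finite_sign_vectors inverse_eq_divide)
  also have "\<dots> = (\<Prod>i<n. of_real (cos (c i)))"
    by (simp only: scaleR_sum_right[symmetric] sign_vector_average)
  finally show ?thesis .
qed

text \<open>
  Conditionally on the data the flips are independent signs, and the characteristic function of a
  sign is a cosine; integrating out the flips first leaves a function of the data that is a product
  over the units, so that independence of the units finishes the computation.  In this way the flips
  are eliminated exactly before any limit is taken.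
\<close>

lemma (in prob_space) char_flipped_sum:
  fixes n :: nat and X :: "nat \<Rightarrow> 'a \<Rightarrow> nat \<Rightarrow> real" and g :: "nat \<Rightarrow> 'a \<Rightarrow> nat \<Rightarrow> real"
  assumes J: "finite J"
    and X: "indep_vars (\<lambda>_. N) X {..<n}"
    and g: "indep_vars (\<lambda>_. count_space (sign_vectors n)) g J"
      "\<And>j. j \<in> J \<Longrightarrow> distr M (count_space (sign_vectors n)) (g j) = uniform_count_measure (sign_vectors n)"
    and Xg: "indep_var (PiM {..<n} (\<lambda>_. N)) (\<lambda>\<omega>. \<lambda>i\<in>{..<n}. X i \<omega>)
      (PiM J (\<lambda>_. count_space (sign_vectors n))) (\<lambda>\<omega>. \<lambda>j\<in>J. g j \<omega>)"
    and f: "\<And>i. i < n \<Longrightarrow> f i \<in> borel_measurable N"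
      "\<And>j i. j \<in> J \<Longrightarrow> i < n \<Longrightarrow> h j i \<in> borel_measurable N"
  shows "expectation (\<lambda>\<omega>. iexp (\<Sum>i<n. f i (X i \<omega>) + (\<Sum>j\<in>J. g j \<omega> i * h j i (X i \<omega>))))
    = (\<Prod>i<n. expectation (\<lambda>\<omega>. iexp (f i (X i \<omega>)) * (\<Prod>j\<in>J. of_real (cos (h j i (X i \<omega>))))))"
proof -
  let ?S = "PiM {..<n} (\<lambda>_. N)" and ?T = "PiM J (\<lambda>_. count_space (sign_vectors n))"
  let ?X = "\<lambda>\<omega>. \<lambda>i\<in>{..<n}. X i \<omega>" and ?Y = "\<lambda>\<omega>. \<lambda>j\<in>J. g j \<omega>"
  define F where "F x y = iexp (\<Sum>i<n. f i (x i) + (\<Sum>j\<in>J. y j i * h j i (x i)))"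
    for x :: "nat \<Rightarrow> (nat \<Rightarrow> real)" and y :: "nat \<Rightarrow> nat \<Rightarrow> real"
  define K where "K x = (\<Prod>i<n. iexp (f i (x i)) * (\<Prod>j\<in>J. of_real (cos (h j i (x i)))))"
    for x :: "nat \<Rightarrow> (nat \<Rightarrow> real)"
  have rv: "random_variable ?S ?X" "random_variable ?T ?Y"
    and dist: "distr M ?S ?X \<Otimes>\<^sub>M distr M ?T ?Y = distr M (?S \<Otimes>\<^sub>M ?T) (\<lambda>\<omega>. (?X \<omega>, ?Y \<omega>))"
    using Xg unfolding indep_var_distribution_eq by auto
  have gm: "\<And>j. j \<in> J \<Longrightarrow> random_variable (count_space (sign_vectors n)) (g j)"
    using g(1) by (auto simp: indep_vars_def)
  have Xm: "\<And>i. i < n \<Longrightarrow> random_variable N (X i)"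
    using X by (auto simp: indep_vars_def)
  interpret DX: prob_space "distr M ?S ?X" by (rule prob_space_distr[OF rv(1)])
  interpret DY: prob_space "distr M ?T ?Y" by (rule prob_space_distr[OF rv(2)])
  interpret P: pair_prob_space "distr M ?S ?X" "distr M ?T ?Y" ..
  have coord: "(\<lambda>z. snd z j i) \<in> borel_measurable (?S \<Otimes>\<^sub>M ?T)" if "j \<in> J" for j i
  proof -
    have "(\<lambda>y. y j) \<in> measurable ?T (count_space (sign_vectors n))"
      using that by (rule measurable_component_singleton)
    then have "(\<lambda>z. snd z j) \<in> measurable (?S \<Otimes>\<^sub>M ?T) (count_space (sign_vectors n))"
      by (rule measurable_compose[OF measurable_snd])
    then show ?thesis by (rule measurable_compose) simp
  qed
  have fst_coord: "(\<lambda>z. \<phi> (fst z i)) \<in> borel_measurable (?S \<Otimes>\<^sub>M ?T)"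
    if "i < n" "\<phi> \<in> borel_measurable N" for i and \<phi> :: "(nat \<Rightarrow> real) \<Rightarrow> real"
  proof -
    have "(\<lambda>x. x i) \<in> measurable ?S N" using that by (intro measurable_component_singleton) auto
    then have "(\<lambda>z. fst z i) \<in> measurable (?S \<Otimes>\<^sub>M ?T) N"
      by (rule measurable_compose[OF measurable_fst])
    then show ?thesis by (rule measurable_compose) (rule that)
  qed
  have "(\<lambda>z. \<Sum>i<n. f i (fst z i) + (\<Sum>j\<in>J. snd z j i * h j i (fst z i)))
      \<in> borel_measurable (?S \<Otimes>\<^sub>M ?T)"
    by (intro borel_measurable_sum borel_measurable_add borel_measurable_times coord fst_coord f) auto
  then have Fm: "(\<lambda>z. F (fst z) (snd z)) \<in> borel_measurable (?S \<Otimes>\<^sub>M ?T)"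
    unfolding F_def by (rule measurable_compose) measurable
  have "sets (distr M ?S ?X \<Otimes>\<^sub>M distr M ?T ?Y) = sets (?S \<Otimes>\<^sub>M ?T)"
    by (intro sets_pair_measure_cong) simp_all
  then have Fm': "(\<lambda>z. F (fst z) (snd z)) \<in> borel_measurable (distr M ?S ?X \<Otimes>\<^sub>M distr M ?T ?Y)"
    using Fm measurable_cong_sets[OF _ refl] by blast
  have m: "(\<lambda>x. iexp (f i x) * (\<Prod>j\<in>J. complex_of_real (cos (h j i x)))) \<in> borel_measurable N"
    if i: "i < n" for i
  proof (intro borel_measurable_times borel_measurable_prod)
    show "(\<lambda>x. iexp (f i x)) \<in> borel_measurable N"
      by (rule measurable_compose[OF f(1)[OF i]]) measurable
    fix j assume "j \<in> J"
    show "(\<lambda>x. complex_of_real (cos (h j i x))) \<in> borel_measurable N"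
      by (rule measurable_compose[OF f(2)[OF \<open>j \<in> J\<close> i]]) measurable
  qed
  have inner: "(\<integral>y. F x y \<partial>distr M ?T ?Y) = K x" if x: "x \<in> space ?S" for x
  proof -
    have "(\<lambda>y. F x y) \<in> borel_measurable ?T"
      using measurable_compose[OF measurable_Pair1'[OF x] Fm] by simp
    then have "(\<integral>y. F x y \<partial>distr M ?T ?Y) = expectation (\<lambda>\<omega>. F x (?Y \<omega>))"
      by (subst integral_distr[OF rv(2)]) auto
    also have "\<dots> = expectation (\<lambda>\<omega>. iexp (\<Sum>i<n. f i (x i))
        * (\<Prod>j\<in>J. iexp (\<Sum>i<n. g j \<omega> i * h j i (x i))))"
    proof (rule Bochner_Integration.integral_cong[OF refl])
      fix \<omega>
      have "F x (?Y \<omega>) = iexp ((\<Sum>i<n. f i (x i)) + (\<Sum>j\<in>J. \<Sum>i<n. g j \<omega> i * h j i (x i)))"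
        unfolding F_def by (subst sum.swap) (simp add: sum.distrib)
      also have "\<dots> = iexp (\<Sum>i<n. f i (x i)) * iexp (\<Sum>j\<in>J. \<Sum>i<n. g j \<omega> i * h j i (x i))"
        by (simp only: of_real_add distrib_left exp_add)
      also have "iexp (\<Sum>j\<in>J. \<Sum>i<n. g j \<omega> i * h j i (x i))
          = (\<Prod>j\<in>J. iexp (\<Sum>i<n. g j \<omega> i * h j i (x i)))"
        by (simp only: of_real_sum[of _ J] sum_distrib_left[of _ _ J] exp_sum[OF J])
      finally show "F x (?Y \<omega>) = iexp (\<Sum>i<n. f i (x i))
        * (\<Prod>j\<in>J. iexp (\<Sum>i<n. g j \<omega> i * h j i (x i)))" .
    qed
    also have "\<dots> = iexp (\<Sum>i<n. f i (x i))
        * expectation (\<lambda>\<omega>. \<Prod>j\<in>J. iexp (\<Sum>i<n. g j \<omega> i * h j i (x i)))"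
      by simp
    also have "expectation (\<lambda>\<omega>. \<Prod>j\<in>J. iexp (\<Sum>i<n. g j \<omega> i * h j i (x i)))
        = (\<Prod>j\<in>J. expectation (\<lambda>\<omega>. iexp (\<Sum>i<n. g j \<omega> i * h j i (x i))))"
    proof (rule indep_vars_lebesgue_integral[OF J])
      show "indep_vars (\<lambda>_. borel) (\<lambda>j \<omega>. iexp (\<Sum>i<n. g j \<omega> i * h j i (x i))) J"
        by (rule indep_vars_compose2[OF g(1), where Y = "\<lambda>j u. iexp (\<Sum>i<n. u i * h j i (x i))"]) auto
      fix j assume "j \<in> J"
      then show "integrable M (\<lambda>\<omega>. iexp (\<Sum>i<n. g j \<omega> i * h j i (x i)))"
        by (intro integrable_const_bound[where B=1] measurable_compose[OF gm]) auto
    qed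
    also have "\<dots> = (\<Prod>j\<in>J. \<Prod>i<n. of_real (cos (h j i (x i))))"
      by (intro prod.cong refl expectation_uniform_flip gm g(2)) auto
    also have "iexp (\<Sum>i<n. f i (x i)) * \<dots> = K x"
      unfolding K_def prod.distrib by (subst prod.swap) (simp add: exp_sum sum_distrib_left)
    finally show ?thesis .
  qed
  have "expectation (\<lambda>\<omega>. iexp (\<Sum>i<n. f i (X i \<omega>) + (\<Sum>j\<in>J. g j \<omega> i * h j i (X i \<omega>))))
      = expectation (\<lambda>\<omega>. F (fst (?X \<omega>, ?Y \<omega>)) (snd (?X \<omega>, ?Y \<omega>)))"
    by (intro Bochner_Integration.integral_cong refl) (simp add: F_def)
  also have "\<dots> = (\<integral>z. F (fst z) (snd z) \<partial>(distr M ?S ?X \<Otimes>\<^sub>M distr M ?T ?Y))"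
    unfolding dist by (rule integral_distr[symmetric, OF _ Fm]) (intro measurable_Pair rv)
  also have "\<dots> = (\<integral>x. (\<integral>y. F x y \<partial>distr M ?T ?Y) \<partial>distr M ?S ?X)"
    using P.integral_fst'[of "\<lambda>z. F (fst z) (snd z)"] Fm'
    by (simp add: P.integrable_const_bound[where B=1] F_def)
  also have "\<dots> = (\<integral>x. K x \<partial>distr M ?S ?X)"
    by (intro Bochner_Integration.integral_cong refl inner) simp
  also have "\<dots> = expectation (\<lambda>\<omega>. K (?X \<omega>))"
  proof (rule integral_distr[OF rv(1)])
    show "K \<in> borel_measurable ?S"
      unfolding K_def
    proof (rule borel_measurable_prod)
      fix i assume i: "i \<in> {..<n}"
      then have "i < n" by simp
      show "(\<lambda>x. iexp (f i (x i)) * (\<Prod>j\<in>J. complex_of_real (cos (h j i (x i))))) \<in> borel_measurable ?S"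
        using measurable_compose[OF measurable_component_singleton[OF i] m[OF \<open>i < n\<close>]] .
    qed
  qed
  also have "\<dots> = expectation (\<lambda>\<omega>. \<Prod>i<n. iexp (f i (X i \<omega>)) * (\<Prod>j\<in>J. of_real (cos (h j i (X i \<omega>)))))"
    by (intro Bochner_Integration.integral_cong refl) (simp add: K_def)
  also have "\<dots> = (\<Prod>i<n. expectation (\<lambda>\<omega>. iexp (f i (X i \<omega>)) * (\<Prod>j\<in>J. of_real (cos (h j i (X i \<omega>))))))"
  proof (rule indep_vars_lebesgue_integral)
    show "indep_vars (\<lambda>_. borel)
        (\<lambda>i \<omega>. iexp (f i (X i \<omega>)) * (\<Prod>j\<in>J. complex_of_real (cos (h j i (X i \<omega>))))) {..<n}"
      by (rule indep_vars_compose2[OF X, where Y = "\<lambda>i x. iexp (f i x) * (\<Prod>j\<in>J. of_real (cos (h j i x)))"])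
        (rule m, simp only: lessThan_iff)
    fix i assume i: "i \<in> {..<n}"
    show "integrable M (\<lambda>\<omega>. iexp (f i (X i \<omega>)) * (\<Prod>j\<in>J. complex_of_real (cos (h j i (X i \<omega>)))))"
    proof (rule integrable_const_bound[where B=1])
      show "(\<lambda>\<omega>. iexp (f i (X i \<omega>)) * (\<Prod>j\<in>J. complex_of_real (cos (h j i (X i \<omega>)))))
        \<in> borel_measurable M"
        using measurable_compose[OF Xm[of i] m[of i]] i by (simp only: lessThan_iff)
      have "\<bar>\<Prod>j\<in>J. cos (h j i x)\<bar> \<le> 1" for x
        unfolding abs_prod by (intro prod_le_1) auto
      then have "cmod (iexp (f i (X i \<omega>)) * (\<Prod>j\<in>J. complex_of_real (cos (h j i (X i \<omega>))))) \<le> 1" for \<omega>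
        by (simp only: norm_mult norm_exp_i_times of_real_prod[symmetric] norm_of_real mult_1)
      then show "AE \<omega> in M. cmod (iexp (f i (X i \<omega>)) * (\<Prod>j\<in>J. complex_of_real (cos (h j i (X i \<omega>))))) \<le> 1"
        by (rule AE_I2)
    qed
  qed simp
  finally show ?thesis .
qed

section \<open>A Lindeberg theorem for flipped and unflipped sums\<close>

text \<open>
  The truncation step of the Lindeberg argument: \<open>r\<close> is at most \<open>C\<close> times the largest coordinate, which
  either exceeds \<open>e\<close> (use the square) or does not (use one factor \<open>e\<close> of the cube).
\<close>

lemma largest_coordinate_split:
  fixes x :: "'l \<Rightarrow> real"
  assumes L: "finite L" and c: "0 \<le> c" and r: "0 \<le> r" "r \<le> c * (\<Sum>l\<in>L. \<bar>x l\<bar>)" and e: "0 < e"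
  defines "C \<equiv> c * real (card L)"
  shows "min (r\<^sup>2) (r ^ 3) \<le> (\<Sum>l\<in>L. C\<^sup>2 * ((x l)\<^sup>2 * indicator {e<..} \<bar>x l\<bar>) + C ^ 3 * (e * (x l)\<^sup>2))"
    and "r\<^sup>2 \<le> (\<Sum>l\<in>L. C\<^sup>2 * (e\<^sup>2 + (x l)\<^sup>2 * indicator {e<..} \<bar>x l\<bar>))"
proof -
  let ?f = "\<lambda>l. C\<^sup>2 * ((x l)\<^sup>2 * indicator {e<..} \<bar>x l\<bar>) + C ^ 3 * (e * (x l)\<^sup>2)"
  let ?g = "\<lambda>l. C\<^sup>2 * (e\<^sup>2 + (x l)\<^sup>2 * indicator {e<..} \<bar>x l\<bar>)"
  have C: "0 \<le> C" using c by (simp add: C_def)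
  have f: "0 \<le> ?f l" and g: "0 \<le> ?g l" for l
    using C e by (auto intro!: add_nonneg_nonneg mult_nonneg_nonneg)
  have "min (r\<^sup>2) (r ^ 3) \<le> (\<Sum>l\<in>L. ?f l) \<and> r\<^sup>2 \<le> (\<Sum>l\<in>L. ?g l)"
  proof (cases "L = {}")
    case True
    then have "r = 0" using r by simp
    then show ?thesis using True by simp
  next
    case False
    obtain m where m: "m \<in> L" "\<And>l. l \<in> L \<Longrightarrow> \<bar>x l\<bar> \<le> \<bar>x m\<bar>"
    proof -
      have "Max ((\<lambda>l. \<bar>x l\<bar>) ` L) \<in> (\<lambda>l. \<bar>x l\<bar>) ` L" using L False by (intro Max_in) auto
      then obtain m where "m \<in> L" "\<bar>x m\<bar> = Max ((\<lambda>l. \<bar>x l\<bar>) ` L)" by auto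
      then show thesis using L by (intro that[of m]) (auto intro: Max_ge)
    qed
    have "(\<Sum>l\<in>L. \<bar>x l\<bar>) \<le> real (card L) * \<bar>x m\<bar>"
      using m(2) by (rule sum_bounded_above)
    then have rm: "r \<le> C * \<bar>x m\<bar>"
      using r(2) mult_left_mono[OF _ c] unfolding C_def mult.assoc by fastforce
    have sq: "r\<^sup>2 \<le> C\<^sup>2 * (x m)\<^sup>2"
      using power_mono[OF rm r(1), of 2] by (simp add: power_mult_distrib)
    have cub: "r ^ 3 \<le> C ^ 3 * \<bar>x m\<bar> ^ 3"
      using power_mono[OF rm r(1), of 3] by (simp add: power_mult_distrib)
    have fm: "?f m \<le> (\<Sum>l\<in>L. ?f l)" and gm: "?g m \<le> (\<Sum>l\<in>L. ?g l)"
      using m(1) L f g by (auto intro!: member_le_sum)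
    have C3: "0 \<le> C ^ 3 * (e * (x m)\<^sup>2)" using C e by auto
    show ?thesis
    proof (cases "e < \<bar>x m\<bar>")
      case True
      have "min (r\<^sup>2) (r ^ 3) \<le> r\<^sup>2" by simp
      moreover have "r\<^sup>2 \<le> ?f m" using sq C3 True by simp
      moreover have "r\<^sup>2 \<le> ?g m" using sq True by (simp add: distrib_left add_increasing)
      ultimately show ?thesis using fm gm by linarith
    next
      case False
      then have xe: "\<bar>x m\<bar> \<le> e" by simp
      have "\<bar>x m\<bar> ^ 3 = \<bar>x m\<bar> * (x m)\<^sup>2" by (simp add: power3_eq_cube power2_eq_square)
      also have "\<dots> \<le> e * (x m)\<^sup>2" using xe by (intro mult_right_mono) auto
      finally have "C ^ 3 * \<bar>x m\<bar> ^ 3 \<le> C ^ 3 * (e * (x m)\<^sup>2)" using C by (intro mult_left_mono) auto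
      then have "r ^ 3 \<le> ?f m" using cub False by simp
      moreover have "min (r\<^sup>2) (r ^ 3) \<le> r ^ 3" by simp
      moreover have "(x m)\<^sup>2 \<le> e\<^sup>2" using power_mono[OF xe, of 2] by simp
      then have "C\<^sup>2 * (x m)\<^sup>2 \<le> C\<^sup>2 * e\<^sup>2" by (intro mult_left_mono) auto
      then have "r\<^sup>2 \<le> ?g m" using sq False by simp
      ultimately show ?thesis using fm gm by linarith
    qed
  qed
  then show "min (r\<^sup>2) (r ^ 3) \<le> (\<Sum>l\<in>L. ?f l)" "r\<^sup>2 \<le> (\<Sum>l\<in>L. ?g l)" by auto
qed

lemma (in prob_space) integrable_mult_of_square_integrable:
  fixes X Y :: "'a \<Rightarrow> real"
  assumes [measurable]: "X \<in> borel_measurable M" "Y \<in> borel_measurable M"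
    and "integrable M (\<lambda>\<omega>. (X \<omega>)\<^sup>2)" "integrable M (\<lambda>\<omega>. (Y \<omega>)\<^sup>2)"
  shows "integrable M (\<lambda>\<omega>. X \<omega> * Y \<omega>)"
proof (rule Bochner_Integration.integrable_bound)
  show "integrable M (\<lambda>\<omega>. (X \<omega>)\<^sup>2 + (Y \<omega>)\<^sup>2)" using assms(3,4) by simp
  have "\<bar>a * b\<bar> \<le> \<bar>a\<^sup>2 + b\<^sup>2\<bar>" for a b :: real
  proof -
    have "0 \<le> (\<bar>a\<bar> - \<bar>b\<bar>)\<^sup>2" by simp
    then have "2 * (\<bar>a\<bar> * \<bar>b\<bar>) \<le> a\<^sup>2 + b\<^sup>2" by (simp add: power2_diff)
    moreover have "0 \<le> \<bar>a\<bar> * \<bar>b\<bar>" by simp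
    ultimately have "\<bar>a\<bar> * \<bar>b\<bar> \<le> a\<^sup>2 + b\<^sup>2" by linarith
    then show ?thesis by (simp add: abs_mult)
  qed
  then show "AE \<omega> in M. norm (X \<omega> * Y \<omega>) \<le> norm ((X \<omega>)\<^sup>2 + (Y \<omega>)\<^sup>2)" by simp
qed measurable

text \<open>
  The contribution of one unit.  Here \<open>x l\<close> is the normalized score contribution of the unit in model
  \<open>l\<close>, the index \<open>a\<close> stands for the unflipped data and \<open>J\<close> for the random flips.  The expansion is
  that of a centred variable with variance \<open>\<Sum>j. E (v j)\<^sup>2\<close>: the random flips make the linear
  combinations for different \<open>j\<close> uncorrelated, and the linear term of the unflipped one vanishes in
  expectation.
\<close>

lemma (in prob_space) flip_factor_estimate:
  fixes x :: "'l \<Rightarrow> 'a \<Rightarrow> real" and t :: "'j \<Rightarrow> 'l \<Rightarrow> real"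
  assumes L: "finite L" and J: "finite J" "a \<notin> J"
    and x: "\<And>l. l \<in> L \<Longrightarrow> x l \<in> borel_measurable M"
      "\<And>l. l \<in> L \<Longrightarrow> integrable M (\<lambda>\<omega>. (x l \<omega>)\<^sup>2)" "\<And>l. l \<in> L \<Longrightarrow> expectation (x l) = 0"
    and e: "0 < e"
  defines "v \<equiv> \<lambda>j \<omega>. \<Sum>l\<in>L. t j l * x l \<omega>"
  defines "C \<equiv> (\<Sum>j\<in>insert a J. \<Sum>l\<in>L. \<bar>t j l\<bar>) * real (card L)"
  shows "cmod (expectation (\<lambda>\<omega>. iexp (v a \<omega>) * (\<Prod>j\<in>J. of_real (cos (v j \<omega>))))
        - (1 - of_real (expectation (\<lambda>\<omega>. \<Sum>j\<in>insert a J. (v j \<omega>)\<^sup>2) / 2)))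
      \<le> (\<Sum>l\<in>L. C\<^sup>2 * expectation (\<lambda>\<omega>. (x l \<omega>)\<^sup>2 * indicator {e<..} \<bar>x l \<omega>\<bar>)
          + C ^ 3 * (e * expectation (\<lambda>\<omega>. (x l \<omega>)\<^sup>2)))"
    and "expectation (\<lambda>\<omega>. \<Sum>j\<in>insert a J. (v j \<omega>)\<^sup>2)
      \<le> (\<Sum>l\<in>L. C\<^sup>2 * (e\<^sup>2 + expectation (\<lambda>\<omega>. (x l \<omega>)\<^sup>2 * indicator {e<..} \<bar>x l \<omega>\<bar>)))"
    and "cmod (expectation (\<lambda>\<omega>. iexp (v a \<omega>) * (\<Prod>j\<in>J. of_real (cos (v j \<omega>))))) \<le> 1"
    and "expectation (\<lambda>\<omega>. \<Sum>j\<in>insert a J. (v j \<omega>)\<^sup>2)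
      = (\<Sum>j\<in>insert a J. \<Sum>k\<in>L. \<Sum>l\<in>L. t j k * t j l * expectation (\<lambda>\<omega>. x k \<omega> * x l \<omega>))"
proof -
  define c where "c = (\<Sum>j\<in>insert a J. \<Sum>l\<in>L. \<bar>t j l\<bar>)"
  define r where "r \<omega> = (\<Sum>j\<in>insert a J. \<bar>v j \<omega>\<bar>)" for \<omega>
  define \<zeta> where "\<zeta> \<omega> = iexp (v a \<omega>) * (\<Prod>j\<in>J. complex_of_real (cos (v j \<omega>)))" for \<omega>
  define q where "q \<omega> = (\<Sum>j\<in>insert a J. (v j \<omega>)\<^sup>2)" for \<omega>
  let ?tail = "\<lambda>l \<omega>. (x l \<omega>)\<^sup>2 * indicator {e<..} \<bar>x l \<omega>\<bar>"
  have C: "C = c * real (card L)" by (simp add: C_def c_def)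
  have c: "0 \<le> c" by (simp add: c_def sum_nonneg)
  have vm: "v j \<in> borel_measurable M" for j
    unfolding v_def by (intro borel_measurable_sum borel_measurable_times borel_measurable_const x)
  have r: "0 \<le> r \<omega>" "r \<omega> \<le> c * (\<Sum>l\<in>L. \<bar>x l \<omega>\<bar>)" for \<omega>
  proof -
    show "0 \<le> r \<omega>" by (simp add: r_def sum_nonneg)
    have "\<bar>v j \<omega>\<bar> \<le> (\<Sum>l\<in>L. \<bar>t j l\<bar>) * (\<Sum>l\<in>L. \<bar>x l \<omega>\<bar>)" for j
    proof -
      have "\<bar>v j \<omega>\<bar> \<le> (\<Sum>l\<in>L. \<bar>t j l\<bar> * \<bar>x l \<omega>\<bar>)"
        unfolding v_def abs_mult[symmetric] by (rule sum_abs)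
      also have "\<dots> \<le> (\<Sum>l\<in>L. \<bar>t j l\<bar> * (\<Sum>l\<in>L. \<bar>x l \<omega>\<bar>))"
        using L by (intro sum_mono mult_left_mono member_le_sum) auto
      finally show ?thesis by (simp add: sum_distrib_right)
    qed
    then show "r \<omega> \<le> c * (\<Sum>l\<in>L. \<bar>x l \<omega>\<bar>)"
      unfolding r_def c_def sum_distrib_right by (intro sum_mono)
  qed
  have intxx: "integrable M (\<lambda>\<omega>. x k \<omega> * x l \<omega>)" if "k \<in> L" "l \<in> L" for k l
    by (rule integrable_mult_of_square_integrable[OF x(1)[OF that(1)] x(1)[OF that(2)] x(2)[OF that(1)] x(2)[OF that(2)]])
  have intx: "integrable M (x l)" if "l \<in> L" for l
    by (rule square_integrable_imp_integrable[OF x(1)[OF that] x(2)[OF that]])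
  have inttail: "integrable M (?tail l)" if "l \<in> L" for l
  proof (rule Bochner_Integration.integrable_bound[OF x(2)[OF that]])
    note [measurable] = x(1)[OF that]
    show "?tail l \<in> borel_measurable M" by measurable
    show "AE \<omega> in M. norm (?tail l \<omega>) \<le> norm ((x l \<omega>)\<^sup>2)" by (simp add: indicator_def)
  qed
  have sq: "(v j \<omega>)\<^sup>2 = (\<Sum>k\<in>L. \<Sum>l\<in>L. t j k * t j l * (x k \<omega> * x l \<omega>))" for j \<omega>
    by (simp add: v_def power2_eq_square sum_product mult_ac)
  have intv2: "integrable M (\<lambda>\<omega>. (v j \<omega>)\<^sup>2)" for j
    unfolding sq by (intro Bochner_Integration.integrable_sum integrable_mult_right intxx)
  have intq: "integrable M q" unfolding q_def by (intro Bochner_Integration.integrable_sum intv2)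
  have intv: "integrable M (v j)" "expectation (v j) = 0" for j
  proof -
    show "integrable M (v j)" unfolding v_def
      by (intro Bochner_Integration.integrable_sum integrable_mult_right intx)
    have "expectation (v j) = (\<Sum>l\<in>L. t j l * expectation (x l))"
      unfolding v_def using intx by (subst Bochner_Integration.integral_sum) auto
    then show "expectation (v j) = 0" using x(3) by simp
  qed
  show eq: "expectation (\<lambda>\<omega>. \<Sum>j\<in>insert a J. (v j \<omega>)\<^sup>2)
      = (\<Sum>j\<in>insert a J. \<Sum>k\<in>L. \<Sum>l\<in>L. t j k * t j l * expectation (\<lambda>\<omega>. x k \<omega> * x l \<omega>))"
    unfolding sq
  proof -
    have "expectation (\<lambda>\<omega>. \<Sum>k\<in>L. \<Sum>l\<in>L. t j k * t j l * (x k \<omega> * x l \<omega>))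
        = (\<Sum>k\<in>L. \<Sum>l\<in>L. t j k * t j l * expectation (\<lambda>\<omega>. x k \<omega> * x l \<omega>))" for j
    proof -
      have "expectation (\<lambda>\<omega>. \<Sum>k\<in>L. \<Sum>l\<in>L. t j k * t j l * (x k \<omega> * x l \<omega>))
          = (\<Sum>k\<in>L. expectation (\<lambda>\<omega>. \<Sum>l\<in>L. t j k * t j l * (x k \<omega> * x l \<omega>)))"
        by (intro Bochner_Integration.integral_sum Bochner_Integration.integrable_sum integrable_mult_right intxx)
      also have "\<dots> = (\<Sum>k\<in>L. \<Sum>l\<in>L. expectation (\<lambda>\<omega>. t j k * t j l * (x k \<omega> * x l \<omega>)))"
        by (intro sum.cong refl Bochner_Integration.integral_sum integrable_mult_right intxx)
      finally show ?thesis by (simp only: integral_mult_right_zero)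
    qed
    moreover have "expectation (\<lambda>\<omega>. \<Sum>j\<in>insert a J. \<Sum>k\<in>L. \<Sum>l\<in>L. t j k * t j l * (x k \<omega> * x l \<omega>))
        = (\<Sum>j\<in>insert a J. expectation (\<lambda>\<omega>. \<Sum>k\<in>L. \<Sum>l\<in>L. t j k * t j l * (x k \<omega> * x l \<omega>)))"
      by (intro Bochner_Integration.integral_sum Bochner_Integration.integrable_sum integrable_mult_right intxx)
    ultimately show "expectation (\<lambda>\<omega>. \<Sum>j\<in>insert a J. \<Sum>k\<in>L. \<Sum>l\<in>L. t j k * t j l * (x k \<omega> * x l \<omega>))
      = (\<Sum>j\<in>insert a J. \<Sum>k\<in>L. \<Sum>l\<in>L. t j k * t j l * expectation (\<lambda>\<omega>. x k \<omega> * x l \<omega>))"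
      by (simp only:)
  qed
  have norm_\<zeta>: "cmod (\<zeta> \<omega>) \<le> 1" for \<omega>
  proof -
    have "\<bar>\<Prod>j\<in>J. cos (v j \<omega>)\<bar> \<le> 1" unfolding abs_prod by (intro prod_le_1) auto
    then show ?thesis
      unfolding \<zeta>_def by (simp only: norm_mult norm_exp_i_times of_real_prod[symmetric] norm_of_real mult_1)
  qed
  have \<zeta>m: "\<zeta> \<in> borel_measurable M"
    unfolding \<zeta>_def
  proof (intro borel_measurable_times borel_measurable_prod)
    show "(\<lambda>\<omega>. iexp (v a \<omega>)) \<in> borel_measurable M" by (rule measurable_compose[OF vm]) measurable
    show "(\<lambda>\<omega>. complex_of_real (cos (v j \<omega>))) \<in> borel_measurable M" for j
      by (rule measurable_compose[OF vm]) measurable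
  qed
  have int\<zeta>: "integrable M \<zeta>"
    using norm_\<zeta> \<zeta>m by (intro integrable_const_bound[where B=1]) auto
  have "cmod (expectation \<zeta>) \<le> expectation (\<lambda>\<omega>. cmod (\<zeta> \<omega>))"
    by (rule integral_norm_bound)
  also have "\<dots> \<le> 1"
    using norm_\<zeta> int\<zeta> by (intro integral_le_const) auto
  finally show "cmod (expectation (\<lambda>\<omega>. iexp (v a \<omega>) * (\<Prod>j\<in>J. of_real (cos (v j \<omega>))))) \<le> 1"
    by (simp only: \<zeta>_def[abs_def])
  have q_le: "q \<omega> \<le> (r \<omega>)\<^sup>2" for \<omega>
  proof -
    have "q \<omega> = (\<Sum>j\<in>insert a J. \<bar>v j \<omega>\<bar> * \<bar>v j \<omega>\<bar>)" by (simp add: q_def power2_eq_square)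
    also have "\<dots> \<le> (\<Sum>j\<in>insert a J. \<bar>v j \<omega>\<bar> * r \<omega>)"
      unfolding r_def using J by (intro sum_mono mult_left_mono member_le_sum) auto
    also have "\<dots> = (r \<omega>)\<^sup>2"
      unfolding power2_eq_square by (subst (2) r_def) (simp only: sum_distrib_right)
    finally show ?thesis .
  qed
  have "expectation q \<le> expectation (\<lambda>\<omega>. \<Sum>l\<in>L. C\<^sup>2 * (e\<^sup>2 + ?tail l \<omega>))"
  proof (rule integral_mono[OF intq])
    show "integrable M (\<lambda>\<omega>. \<Sum>l\<in>L. C\<^sup>2 * (e\<^sup>2 + ?tail l \<omega>))"
      by (intro Bochner_Integration.integrable_sum integrable_mult_right Bochner_Integration.integrable_add integrable_const inttail)
    show "q \<omega> \<le> (\<Sum>l\<in>L. C\<^sup>2 * (e\<^sup>2 + ?tail l \<omega>))" for \<omega>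
      unfolding C using q_le[of \<omega>] largest_coordinate_split(2)[OF L c r e, of \<omega>] by linarith
  qed
  also have "\<dots> = (\<Sum>l\<in>L. C\<^sup>2 * (e\<^sup>2 + expectation (?tail l)))"
    using inttail by (subst Bochner_Integration.integral_sum) (auto simp: prob_space)
  finally show "expectation (\<lambda>\<omega>. \<Sum>j\<in>insert a J. (v j \<omega>)\<^sup>2)
      \<le> (\<Sum>l\<in>L. C\<^sup>2 * (e\<^sup>2 + expectation (\<lambda>\<omega>. (x l \<omega>)\<^sup>2 * indicator {e<..} \<bar>x l \<omega>\<bar>)))"
    by (simp only: q_def[abs_def])
  let ?lin = "\<lambda>\<omega>. 1 + \<i> * complex_of_real (v a \<omega>) - complex_of_real (q \<omega> / 2)"
  have intlin: "integrable M ?lin"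
    by (intro Bochner_Integration.integrable_diff Bochner_Integration.integrable_add integrable_const
        integrable_mult_right integrable_of_real intv integrable_divide intq)
  have Elin: "expectation ?lin = 1 - of_real (expectation q / 2)"
  proof -
    have "expectation ?lin = expectation (\<lambda>\<omega>. 1 + \<i> * complex_of_real (v a \<omega>)) - expectation (\<lambda>\<omega>. complex_of_real (q \<omega> / 2))"
      by (intro Bochner_Integration.integral_diff Bochner_Integration.integrable_add integrable_const
          integrable_mult_right integrable_of_real intv integrable_divide intq)
    also have "expectation (\<lambda>\<omega>. 1 + \<i> * complex_of_real (v a \<omega>)) = expectation (\<lambda>\<omega>. 1) + expectation (\<lambda>\<omega>. \<i> * complex_of_real (v a \<omega>))"
      by (intro Bochner_Integration.integral_add integrable_const integrable_mult_right integrable_of_real intv)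
    also have "expectation (\<lambda>\<omega>. \<i> * complex_of_real (v a \<omega>)) = 0"
      by (simp add: intv(2))
    also have "expectation (\<lambda>\<omega>. complex_of_real (q \<omega> / 2)) = of_real (expectation q / 2)"
      unfolding integral_complex_of_real by simp
    finally show ?thesis by (simp add: prob_space)
  qed
  have bound: "cmod (\<zeta> \<omega> - ?lin \<omega>) \<le> (\<Sum>l\<in>L. C\<^sup>2 * ?tail l \<omega> + C ^ 3 * (e * (x l \<omega>)\<^sup>2))" for \<omega>
  proof -
    have "\<bar>v a \<omega>\<bar> + (\<Sum>j\<in>J. \<bar>v j \<omega>\<bar>) \<le> r \<omega>" using J by (simp add: r_def)
    from sign_average_quadratic_remainder[OF J(1) this]
    have "cmod (\<zeta> \<omega> - ?lin \<omega>) \<le> min ((r \<omega>)\<^sup>2) (r \<omega> ^ 3)"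
      unfolding \<zeta>_def q_def sum.insert[OF J] .
    also have "\<dots> \<le> (\<Sum>l\<in>L. C\<^sup>2 * ?tail l \<omega> + C ^ 3 * (e * (x l \<omega>)\<^sup>2))"
      unfolding C by (rule largest_coordinate_split(1)[OF L c r e])
    finally show ?thesis .
  qed
  have "cmod (expectation \<zeta> - (1 - of_real (expectation q / 2))) = cmod (expectation (\<lambda>\<omega>. \<zeta> \<omega> - ?lin \<omega>))"
    unfolding Elin[symmetric] by (subst Bochner_Integration.integral_diff[OF int\<zeta> intlin]) (rule refl)
  also have "\<dots> \<le> expectation (\<lambda>\<omega>. cmod (\<zeta> \<omega> - ?lin \<omega>))"
    by (rule integral_norm_bound)
  also have "\<dots> \<le> expectation (\<lambda>\<omega>. \<Sum>l\<in>L. C\<^sup>2 * ?tail l \<omega> + C ^ 3 * (e * (x l \<omega>)\<^sup>2))"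
    by (intro integral_mono integrable_norm Bochner_Integration.integrable_diff int\<zeta> intlin bound
        Bochner_Integration.integrable_sum Bochner_Integration.integrable_add integrable_mult_right inttail x(2))
  also have "\<dots> = (\<Sum>l\<in>L. C\<^sup>2 * expectation (?tail l) + C ^ 3 * (e * expectation (\<lambda>\<omega>. (x l \<omega>)\<^sup>2)))"
    using inttail x(2) by (subst Bochner_Integration.integral_sum) auto
  finally show "cmod (expectation (\<lambda>\<omega>. iexp (v a \<omega>) * (\<Prod>j\<in>J. of_real (cos (v j \<omega>))))
        - (1 - of_real (expectation (\<lambda>\<omega>. \<Sum>j\<in>insert a J. (v j \<omega>)\<^sup>2) / 2)))
      \<le> (\<Sum>l\<in>L. C\<^sup>2 * expectation (\<lambda>\<omega>. (x l \<omega>)\<^sup>2 * indicator {e<..} \<bar>x l \<omega>\<bar>)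
          + C ^ 3 * (e * expectation (\<lambda>\<omega>. (x l \<omega>)\<^sup>2)))"
    by (simp only: \<zeta>_def[abs_def] q_def[abs_def])
qed

text \<open>
  A Lindeberg central limit theorem for the unflipped and the flipped sums jointly.  The limit
  variance is a sum over the flips with no cross terms, which means that the limits for different
  flips are independent, each with covariance matrix \<open>S\<close>.
\<close>

lemma flip_factor_product_tendsto:
  fixes M :: "nat \<Rightarrow> 'a measure" and x :: "nat \<Rightarrow> nat \<Rightarrow> 'l \<Rightarrow> 'a \<Rightarrow> real" and t :: "'j \<Rightarrow> 'l \<Rightarrow> real"
  assumes M: "\<And>n. prob_space (M n)" and L: "finite L" and J: "finite J" "a \<notin> J"
    and x: "\<And>n i l. i < n \<Longrightarrow> l \<in> L \<Longrightarrow> x n i l \<in> borel_measurable (M n)"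
      "\<And>n i l. i < n \<Longrightarrow> l \<in> L \<Longrightarrow> integrable (M n) (\<lambda>\<omega>. (x n i l \<omega>)\<^sup>2)"
      "\<And>n i l. i < n \<Longrightarrow> l \<in> L \<Longrightarrow> (\<integral>\<omega>. x n i l \<omega> \<partial>M n) = 0"
    and cov: "\<And>k l. k \<in> L \<Longrightarrow> l \<in> L \<Longrightarrow> (\<lambda>n. \<Sum>i<n. \<integral>\<omega>. x n i k \<omega> * x n i l \<omega> \<partial>M n) \<longlonglongrightarrow> S k l"
    and lindeberg: "\<And>l e. l \<in> L \<Longrightarrow> 0 < e \<Longrightarrow>
      (\<lambda>n. \<Sum>i<n. \<integral>\<omega>. (x n i l \<omega>)\<^sup>2 * indicator {e<..} \<bar>x n i l \<omega>\<bar> \<partial>M n) \<longlonglongrightarrow> 0"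
  defines "v \<equiv> \<lambda>n i j \<omega>. \<Sum>l\<in>L. t j l * x n i l \<omega>"
  shows "(\<lambda>n. \<Prod>i<n. \<integral>\<omega>. iexp (v n i a \<omega>) * (\<Prod>j\<in>J. of_real (cos (v n i j \<omega>))) \<partial>M n)
    \<longlonglongrightarrow> of_real (exp (- (\<Sum>j\<in>insert a J. \<Sum>k\<in>L. \<Sum>l\<in>L. t j k * t j l * S k l) / 2))"
proof -
  define C where "C = (\<Sum>j\<in>insert a J. \<Sum>l\<in>L. \<bar>t j l\<bar>) * real (card L)"
  define \<beta> where "\<beta> n i = (\<integral>\<omega>. iexp (v n i a \<omega>) * (\<Prod>j\<in>J. complex_of_real (cos (v n i j \<omega>))) \<partial>M n)" for n i
  define s where "s n i = (\<integral>\<omega>. (\<Sum>j\<in>insert a J. (v n i j \<omega>)\<^sup>2) \<partial>M n)" for n i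
  define \<tau> where "\<tau> e n i l = (\<integral>\<omega>. (x n i l \<omega>)\<^sup>2 * indicator {e<..} \<bar>x n i l \<omega>\<bar> \<partial>M n)" for e n i l
  have C: "0 \<le> C" by (auto simp: C_def intro!: mult_nonneg_nonneg sum_nonneg)
  have \<tau>: "0 \<le> \<tau> e n i l" for e n i l by (simp add: \<tau>_def)
  have est1: "cmod (\<beta> n i - (1 - of_real (s n i / 2)))
      \<le> (\<Sum>l\<in>L. C\<^sup>2 * \<tau> e n i l + C ^ 3 * (e * (\<integral>\<omega>. (x n i l \<omega>)\<^sup>2 \<partial>M n)))"
    and est2: "s n i \<le> (\<Sum>l\<in>L. C\<^sup>2 * (e\<^sup>2 + \<tau> e n i l))"
    and est3: "cmod (\<beta> n i) \<le> 1"
    and est4: "s n i = (\<Sum>j\<in>insert a J. \<Sum>k\<in>L. \<Sum>l\<in>L. t j k * t j l * (\<integral>\<omega>. x n i k \<omega> * x n i l \<omega> \<partial>M n))"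
    if i: "i < n" and e: "0 < e" for n i e
  proof -
    interpret prob_space "M n" by (rule M)
    note est = flip_factor_estimate[where x = "x n i" and t = t, OF L J x(1)[OF i] x(2)[OF i] x(3)[OF i] e]
    show "cmod (\<beta> n i - (1 - of_real (s n i / 2)))
        \<le> (\<Sum>l\<in>L. C\<^sup>2 * \<tau> e n i l + C ^ 3 * (e * (\<integral>\<omega>. (x n i l \<omega>)\<^sup>2 \<partial>M n)))"
      unfolding \<beta>_def s_def \<tau>_def v_def C_def by (rule est(1))
    show "s n i \<le> (\<Sum>l\<in>L. C\<^sup>2 * (e\<^sup>2 + \<tau> e n i l))"
      unfolding s_def \<tau>_def v_def C_def by (rule est(2))
    show "cmod (\<beta> n i) \<le> 1" unfolding \<beta>_def v_def by (rule est(3))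
    show "s n i = (\<Sum>j\<in>insert a J. \<Sum>k\<in>L. \<Sum>l\<in>L. t j k * t j l * (\<integral>\<omega>. x n i k \<omega> * x n i l \<omega> \<partial>M n))"
      unfolding s_def v_def by (rule est(4))
  qed
  have "(\<lambda>n. \<Prod>i<n. \<beta> n i) \<longlonglongrightarrow> of_real (exp (- (\<Sum>j\<in>insert a J. \<Sum>k\<in>L. \<Sum>l\<in>L. t j k * t j l * S k l) / 2))"
  proof (rule prod_tendsto_exp)
    show "cmod (\<beta> n i) \<le> 1" if "i < n" for n i by (rule est3[where e = 1, OF that]) simp
    show "0 \<le> s n i" for n i by (simp add: s_def sum_nonneg)
    have "(\<lambda>n. \<Sum>j\<in>insert a J. \<Sum>k\<in>L. \<Sum>l\<in>L. t j k * t j l * (\<Sum>i<n. \<integral>\<omega>. x n i k \<omega> * x n i l \<omega> \<partial>M n))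
        \<longlonglongrightarrow> (\<Sum>j\<in>insert a J. \<Sum>k\<in>L. \<Sum>l\<in>L. t j k * t j l * S k l)"
      by (intro tendsto_sum tendsto_mult_left cov)
    moreover have "(\<Sum>i<n. s n i)
        = (\<Sum>j\<in>insert a J. \<Sum>k\<in>L. \<Sum>l\<in>L. t j k * t j l * (\<Sum>i<n. \<integral>\<omega>. x n i k \<omega> * x n i l \<omega> \<partial>M n))" for n
    proof -
      have "(\<Sum>i<n. s n i) = (\<Sum>i<n. \<Sum>j\<in>insert a J. \<Sum>k\<in>L. \<Sum>l\<in>L. t j k * t j l * (\<integral>\<omega>. x n i k \<omega> * x n i l \<omega> \<partial>M n))"
        by (intro sum.cong refl est4[where e = 1]) simp_all
      also have "\<dots> = (\<Sum>j\<in>insert a J. \<Sum>i<n. \<Sum>k\<in>L. \<Sum>l\<in>L. t j k * t j l * (\<integral>\<omega>. x n i k \<omega> * x n i l \<omega> \<partial>M n))"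
        by (rule sum.swap)
      also have "\<dots> = (\<Sum>j\<in>insert a J. \<Sum>k\<in>L. \<Sum>i<n. \<Sum>l\<in>L. t j k * t j l * (\<integral>\<omega>. x n i k \<omega> * x n i l \<omega> \<partial>M n))"
        by (intro sum.cong refl sum.swap)
      also have "\<dots> = (\<Sum>j\<in>insert a J. \<Sum>k\<in>L. \<Sum>l\<in>L. \<Sum>i<n. t j k * t j l * (\<integral>\<omega>. x n i k \<omega> * x n i l \<omega> \<partial>M n))"
        by (intro sum.cong refl sum.swap)
      finally show ?thesis by (simp only: sum_distrib_left)
    qed
    ultimately show "(\<lambda>n. \<Sum>i<n. s n i) \<longlonglongrightarrow> (\<Sum>j\<in>insert a J. \<Sum>k\<in>L. \<Sum>l\<in>L. t j k * t j l * S k l)"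
      by (simp only:)
    have tail: "(\<lambda>n. \<Sum>l\<in>L. C\<^sup>2 * (\<Sum>i<n. \<tau> e n i l)) \<longlonglongrightarrow> 0" if "0 < e" for e
    proof -
      have "(\<lambda>n. \<Sum>l\<in>L. C\<^sup>2 * (\<Sum>i<n. \<tau> e n i l)) \<longlonglongrightarrow> (\<Sum>l\<in>L. C\<^sup>2 * 0)"
        unfolding \<tau>_def using that by (intro tendsto_sum tendsto_mult_left lindeberg)
      then show ?thesis by simp
    qed
    show "\<forall>\<^sub>F n in sequentially. \<forall>i<n. s n i \<le> d" if d: "0 < d" for d
    proof -
      \<comment> \<open>The truncation level \<open>e\<close> makes the contribution of the small coordinates at most \<open>d / 2\<close>.\<close>
      define b where "b = C\<^sup>2 * real (card L)"
      define e where "e = sqrt (d / (2 * (b + 1)))"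
      have b: "0 \<le> b" by (simp add: b_def)
      have e: "0 < e" "e\<^sup>2 = d / (2 * (b + 1))" using d b by (auto simp: e_def)
      have be: "b * e\<^sup>2 \<le> d / 2" unfolding e(2) using b d by (simp add: field_simps)
      have "\<forall>\<^sub>F n in sequentially. (\<Sum>l\<in>L. C\<^sup>2 * (\<Sum>i<n. \<tau> e n i l)) < d / 2"
        using d by (intro order_tendstoD(2)[OF tail[OF e(1)]]) simp
      then show ?thesis
      proof eventually_elim
        case (elim n)
        show ?case
        proof (intro allI impI)
          fix i assume i: "i < n"
          have "s n i \<le> (\<Sum>l\<in>L. C\<^sup>2 * (e\<^sup>2 + \<tau> e n i l))" using i e(1) by (rule est2)
          also have "\<dots> = b * e\<^sup>2 + (\<Sum>l\<in>L. C\<^sup>2 * \<tau> e n i l)"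
            by (simp add: b_def distrib_left sum.distrib)
          also have "(\<Sum>l\<in>L. C\<^sup>2 * \<tau> e n i l) \<le> (\<Sum>l\<in>L. C\<^sup>2 * (\<Sum>i<n. \<tau> e n i l))"
            using i \<tau> by (intro sum_mono mult_left_mono member_le_sum) auto
          finally show "s n i \<le> d" using elim be by linarith
        qed
      qed
    qed
    show "(\<lambda>n. \<Sum>i<n. cmod (\<beta> n i - (1 - of_real (s n i / 2)))) \<longlonglongrightarrow> 0"
    proof (rule LIMSEQ_I)
      fix d :: real assume d: "0 < d"
      \<comment> \<open>The truncation level \<open>e\<close> makes the limit of the cubic terms at most \<open>d / 3\<close>.\<close>
      define b where "b = C ^ 3 * (\<Sum>l\<in>L. S l l)"
      define e where "e = d / (3 * (\<bar>b\<bar> + 1))"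
      have e: "0 < e" using d by (simp add: e_def)
      have "e * b \<le> e * \<bar>b\<bar>" using e by (intro mult_left_mono) auto
      also have "\<dots> \<le> d / 3" using d by (simp add: e_def field_simps)
      finally have be: "e * b \<le> d / 3" .
      have "(\<lambda>n. C ^ 3 * (e * (\<Sum>l\<in>L. \<Sum>i<n. \<integral>\<omega>. x n i l \<omega> * x n i l \<omega> \<partial>M n))) \<longlonglongrightarrow> C ^ 3 * (e * (\<Sum>l\<in>L. S l l))"
        by (intro tendsto_mult_left tendsto_sum cov)
      then have "(\<lambda>n. C ^ 3 * (e * (\<Sum>l\<in>L. \<Sum>i<n. \<integral>\<omega>. (x n i l \<omega>)\<^sup>2 \<partial>M n))) \<longlonglongrightarrow> e * b"
        by (simp add: b_def power2_eq_square mult_ac)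
      then have "\<forall>\<^sub>F n in sequentially. C ^ 3 * (e * (\<Sum>l\<in>L. \<Sum>i<n. \<integral>\<omega>. (x n i l \<omega>)\<^sup>2 \<partial>M n)) < 2 * d / 3"
        by (rule order_tendstoD(2)) (use be d in linarith)
      moreover have "\<forall>\<^sub>F n in sequentially. (\<Sum>l\<in>L. C\<^sup>2 * (\<Sum>i<n. \<tau> e n i l)) < d / 3"
        using d by (intro order_tendstoD(2)[OF tail[OF e]]) simp
      ultimately have "\<forall>\<^sub>F n in sequentially. norm ((\<Sum>i<n. cmod (\<beta> n i - (1 - of_real (s n i / 2)))) - 0) < d"
      proof eventually_elim
        case (elim n)
        have "(\<Sum>i<n. cmod (\<beta> n i - (1 - of_real (s n i / 2))))
            \<le> (\<Sum>i<n. \<Sum>l\<in>L. C\<^sup>2 * \<tau> e n i l + C ^ 3 * (e * (\<integral>\<omega>. (x n i l \<omega>)\<^sup>2 \<partial>M n)))"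
          using e by (intro sum_mono est1) auto
        also have "\<dots> = (\<Sum>l\<in>L. \<Sum>i<n. C\<^sup>2 * \<tau> e n i l + C ^ 3 * (e * (\<integral>\<omega>. (x n i l \<omega>)\<^sup>2 \<partial>M n)))"
          by (rule sum.swap)
        also have "\<dots> = (\<Sum>l\<in>L. C\<^sup>2 * (\<Sum>i<n. \<tau> e n i l)) + C ^ 3 * (e * (\<Sum>l\<in>L. \<Sum>i<n. \<integral>\<omega>. (x n i l \<omega>)\<^sup>2 \<partial>M n))"
          by (simp only: sum.distrib sum_distrib_left)
        finally show ?case using elim by (simp add: sum_nonneg)
      qed
      then show "\<exists>no. \<forall>n\<ge>no. norm ((\<Sum>i<n. cmod (\<beta> n i - (1 - of_real (s n i / 2)))) - 0) < d"
        by (simp only: eventually_sequentially)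
    qed
  qed
  then show ?thesis by (simp only: \<beta>_def)
qed

section \<open>Gaussian vectors and sets that are negligible for them\<close>

text \<open>
  A Cholesky factorization, obtained by eliminating one index at a time: subtracting the rank-one
  matrix \<open>s k * s l\<close> with \<open>s k = R k p / sqrt (R p p)\<close> leaves a matrix that is again positive
  semidefinite (the Schur complement) and no longer involves \<open>p\<close>.  If \<open>R p p = 0\<close>, the whole row
  vanishes and so does \<open>s\<close>.
\<close>

lemma psd_gram:
  fixes R :: "'l \<Rightarrow> 'l \<Rightarrow> real"
  assumes "finite L"
    and "\<And>k l. k \<in> L \<Longrightarrow> l \<in> L \<Longrightarrow> R k l = R l k"
    and "\<And>x. 0 \<le> (\<Sum>k\<in>L. \<Sum>l\<in>L. x k * x l * R k l)"
  shows "\<exists>a. \<forall>k\<in>L. \<forall>l\<in>L. R k l = (\<Sum>r\<in>L. a k r * a l r)"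
  using assms
proof (induction L arbitrary: R rule: finite_induct)
  case empty
  then show ?case by simp
next
  case (insert p L)
  note fin = insert.hyps(1) and p = insert.hyps(2)
  have sym: "R k l = R l k" if "k \<in> insert p L" "l \<in> insert p L" for k l
    using insert.prems(1) that by blast
  have expand: "(\<Sum>k\<in>insert p L. \<Sum>l\<in>insert p L. x k * x l * R k l)
      = (x p)\<^sup>2 * R p p + 2 * x p * (\<Sum>l\<in>L. x l * R l p) + (\<Sum>k\<in>L. \<Sum>l\<in>L. x k * x l * R k l)" for x
  proof -
    have "(\<Sum>l\<in>L. x p * x l * R p l) = x p * (\<Sum>l\<in>L. x l * R l p)"
      "(\<Sum>k\<in>L. x k * x p * R k p) = x p * (\<Sum>l\<in>L. x l * R l p)"
      using sym by (auto simp: sum_distrib_left mult_ac intro!: sum.cong)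
    then show ?thesis using fin p
      by (simp add: sum.distrib power2_eq_square)
  qed
  have pp: "0 \<le> R p p"
    using insert.prems(2)[of "\<lambda>k. if k = p then 1 else 0"] p unfolding expand
    by (simp add: sum.neutral)
  have zero: "R k p = 0" if "k \<in> L" "R p p = 0" for k
  proof (rule ccontr)
    assume nz: "R k p \<noteq> 0"
    \<comment> \<open>With this weight on \<open>p\<close> the quadratic form would take the value \<open>-1\<close>.\<close>
    define t where "t = - (R k k + 1) / (2 * R k p)"
    define x where "x j = (if j = p then t else if j = k then 1 else 0)" for j
    have kp: "k \<noteq> p" using that p by auto
    have "(\<Sum>l\<in>L. x l * R l p) = (\<Sum>l\<in>L. if l = k then R k p else 0)"
      using p by (intro sum.cong) (auto simp: x_def)
    then have 1: "(\<Sum>l\<in>L. x l * R l p) = R k p" using that fin by simp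
    have "(\<Sum>i\<in>L. \<Sum>l\<in>L. x i * x l * R i l) = (\<Sum>i\<in>L. if i = k then (\<Sum>l\<in>L. if l = k then R k k else 0) else 0)"
      using p by (intro sum.cong refl) (auto simp: x_def intro!: sum.cong)
    then have 2: "(\<Sum>i\<in>L. \<Sum>l\<in>L. x i * x l * R i l) = R k k" using that fin by simp
    have "0 \<le> 2 * t * R k p + R k k"
      using insert.prems(2)[of x] unfolding expand 1 2 using that by (simp add: x_def)
    moreover have "2 * t * R k p = - (R k k + 1)" using nz by (simp add: t_def field_simps)
    ultimately show False by linarith
  qed
  define s where "s k = R k p / sqrt (R p p)" for k
  have sp: "s k * sqrt (R p p) = R k p" if "k \<in> insert p L" for k
    using that zero pp by (cases "R p p = 0") (auto simp: s_def)
  have ss: "s p * s p = R p p" and s_p: "s p = sqrt (R p p)"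
    using pp by (auto simp: s_def real_div_sqrt)
  have "\<exists>a. \<forall>k\<in>L. \<forall>l\<in>L. R k l - s k * s l = (\<Sum>r\<in>L. a k r * a l r)"
  proof (rule insert.IH)
    fix k l assume "k \<in> L" "l \<in> L" then show "R k l - s k * s l = R l k - s l * s k" using sym by simp
  next
    fix x :: "'l \<Rightarrow> real"
    define q where "q = (\<Sum>l\<in>L. x l * s l)"
    \<comment> \<open>The extension of \<open>x\<close> to the index \<open>p\<close> that minimizes the quadratic form of \<open>R\<close>.\<close>
    define y where "y j = (if j = p then - q / sqrt (R p p) else x j)" for j
    have yL: "(\<Sum>l\<in>L. y l * R l p) = q * sqrt (R p p)"
      using p sp by (auto simp: y_def q_def sum_distrib_right mult.assoc intro!: sum.cong)
    have yL2: "(\<Sum>k\<in>L. \<Sum>l\<in>L. y k * y l * R k l) = (\<Sum>k\<in>L. \<Sum>l\<in>L. x k * x l * R k l)"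
      using p by (intro sum.cong refl) (auto simp: y_def)
    have q0: "q = 0" if "R p p = 0" using that by (simp add: q_def s_def)
    have "(y p)\<^sup>2 * R p p + 2 * y p * (\<Sum>l\<in>L. y l * R l p) = - q\<^sup>2"
    proof (cases "R p p = 0")
      case False
      then have "0 < R p p" using pp by simp
      then show ?thesis unfolding yL by (simp add: y_def power_divide) (simp add: power2_eq_square)
    qed (simp add: yL q0)
    moreover have "(\<Sum>k\<in>L. \<Sum>l\<in>L. x k * x l * (s k * s l)) = q\<^sup>2"
      unfolding q_def power2_eq_square by (simp add: sum_product mult_ac)
    ultimately have "(\<Sum>k\<in>L. \<Sum>l\<in>L. x k * x l * (R k l - s k * s l))
        = (\<Sum>k\<in>insert p L. \<Sum>l\<in>insert p L. y k * y l * R k l)"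
      unfolding expand yL2 by (simp add: right_diff_distrib sum_subtractf)
    then show "0 \<le> (\<Sum>k\<in>L. \<Sum>l\<in>L. x k * x l * (R k l - s k * s l))"
      using insert.prems(2)[of y] by simp
  qed
  then obtain a where a: "\<And>k l. k \<in> L \<Longrightarrow> l \<in> L \<Longrightarrow> R k l - s k * s l = (\<Sum>r\<in>L. a k r * a l r)"
    by blast
  define b where "b k r = (if r = p then s k else if k = p then 0 else a k r)" for k r
  have bsum: "(\<Sum>r\<in>insert p L. b k r * b l r) = s k * s l + (\<Sum>r\<in>L. b k r * b l r)" for k l
    using fin p by (simp add: b_def)
  have "R k l = (\<Sum>r\<in>insert p L. b k r * b l r)" if "k \<in> insert p L" "l \<in> insert p L" for k l
  proof (cases "k = p \<or> l = p")
    case True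
    have "(\<Sum>r\<in>L. b k r * b l r) = 0" using True p by (auto simp: b_def intro!: sum.neutral)
    moreover have "R k l = s k * s l"
      using True sp[OF that(1)] sp[OF that(2)] sym[OF that] s_p by (auto simp: mult_ac)
    ultimately show ?thesis by (simp only: bsum)
  next
    case False
    then have kl: "k \<in> L" "l \<in> L" using that by auto
    have "(\<Sum>r\<in>L. b k r * b l r) = (\<Sum>r\<in>L. a k r * a l r)"
      using False p by (intro sum.cong) (auto simp: b_def)
    then show ?thesis using a[OF kl] bsum by simp
  qed
  then show ?case by blast
qed

abbreviation gauss_vec :: "'i set \<Rightarrow> ('i \<Rightarrow> real) measure" where
  "gauss_vec I \<equiv> PiM I (\<lambda>_. std_normal_distribution)"

lemma prob_space_gauss_vec: "prob_space (gauss_vec I)"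
  by (intro prob_space_PiM prob_space_normal_density) simp

lemma AE_std_normal_iff:
  "Measurable.pred borel P \<Longrightarrow> (AE x in std_normal_distribution. P x) \<longleftrightarrow> (AE x in lborel. P x)"
  by (subst AE_density) (auto simp: normal_density_pos)

lemma AE_std_normal_scale:
  assumes "c \<noteq> 0" "Measurable.pred borel P" "AE x in std_normal_distribution. P (c * x)"
  shows "AE x in std_normal_distribution. P x"
proof -
  have m: "Measurable.pred borel (\<lambda>x. P (c * x))" 
    using assms(2) by measurable
  have "AE x in lborel. P (c * x)" using assms(3) m by (simp add: AE_std_normal_iff)
  then have "AE x in lborel. P (c * (0 + (1 / c) * x))"
    using AE_borel_affine[of "1 / c" "\<lambda>x. P (c * x)" 0] assms(1) m by simp
  then show ?thesis using assms by (simp add: AE_std_normal_iff)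
qed

text \<open>
  Rescaling the coordinates of a Gaussian vector does not change its null sets, as each coordinate
  has the same null sets as Lebesgue measure.
\<close>

lemma AE_gauss_vec_scale:
  assumes "finite I" "\<And>i. i \<in> I \<Longrightarrow> c i \<noteq> 0"
    and "Measurable.pred (gauss_vec I) P"
    and "AE z in gauss_vec I. P (\<lambda>i\<in>I. c i * z i)"
  shows "AE z in gauss_vec I. P z"
  using assms
proof (induction I arbitrary: P rule: finite_induct)
  case empty
  have "(\<lambda>i\<in>{}. c i * z i) = z" if "z \<in> space (gauss_vec {})" for z
    using that by (auto simp: space_PiM)
  then show ?case using empty by auto
next
  case (insert a I)
  interpret product_sigma_finite "\<lambda>_::'a. std_normal_distribution"
    by unfold_locales (intro sigma_finite_measure.sigma_finite_countable prob_space_imp_sigma_finite prob_space_normal_density; simp)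
  interpret N: sigma_finite_measure std_normal_distribution
    by (intro prob_space_imp_sigma_finite prob_space_normal_density) simp
  interpret G: sigma_finite_measure "gauss_vec I"
    by (intro prob_space_imp_sigma_finite prob_space_gauss_vec)
  interpret NG: pair_sigma_finite std_normal_distribution "gauss_vec I" ..
  have split: "(AE z in gauss_vec (insert a I). Q z)
      \<longleftrightarrow> (AE t in std_normal_distribution. AE z in gauss_vec I. Q (z(a := t)))"
    if Q: "Measurable.pred (gauss_vec (insert a I)) Q" for Q
  proof -
    have upd: "(\<lambda>(t, z). z(a := t)) \<in> measurable (std_normal_distribution \<Otimes>\<^sub>M gauss_vec I) (gauss_vec (insert a I))"
      using measurable_add_dim by measurable
    have d: "gauss_vec (insert a I) = distr (std_normal_distribution \<Otimes>\<^sub>M gauss_vec I) (gauss_vec (insert a I)) (\<lambda>(t, z). z(a := t))"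
      by (rule distr_pair_PiM_eq_PiM[symmetric]) (auto intro!: prob_space_normal_density)
    have "(AE z in gauss_vec (insert a I). Q z) \<longleftrightarrow> (AE x in std_normal_distribution \<Otimes>\<^sub>M gauss_vec I. Q ((\<lambda>(t, z). z(a := t)) x))"
      by (subst d, rule AE_distr_iff[OF upd]) (use Q in measurable)
    also have "\<dots> \<longleftrightarrow> (AE t in std_normal_distribution. AE z in gauss_vec I. Q (z(a := t)))"
      by (subst NG.AE_pair_iff[of "\<lambda>t z. Q (z(a := t))"])
        (use measurable_compose[OF upd Q] in \<open>auto simp: pred_def split_beta\<close>)
    finally show ?thesis .
  qed
  let ?c = "\<lambda>J z. \<lambda>i\<in>J. c i * z i"
  have scale_m: "?c J \<in> measurable (gauss_vec J) (gauss_vec J)" for J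
    by (intro measurable_restrict) (auto intro!: borel_measurable_times measurable_compose[OF measurable_component_singleton])
  have m: "Measurable.pred (gauss_vec (insert a I)) (\<lambda>z. P (?c (insert a I) z))"
    using measurable_compose[OF scale_m insert.prems(2)] .
  have upd2: "(\<lambda>z. z(a := t)) \<in> measurable (gauss_vec I) (gauss_vec (insert a I))" for t
    by (rule measurable_fun_upd[where J=I]) (auto simp: )
  have "AE t in std_normal_distribution. AE z in gauss_vec I. P (?c (insert a I) (z(a := t)))"
    by (rule split[OF m, THEN iffD1, OF insert.prems(3)])
  then have "AE t in std_normal_distribution. AE z in gauss_vec I. P ((?c I z)(a := c a * t))"
  proof eventually_elim
    case *: (elim t)
    have "?c (insert a I) (z(a := t)) = (?c I z)(a := c a * t)" for z
      using insert.hyps by (auto simp: fun_eq_iff)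
    then show "AE z in gauss_vec I. P ((?c I z)(a := c a * t))" using * by simp
  qed
  then have "AE t in std_normal_distribution. AE z in gauss_vec I. P (z(a := c a * t))"
  proof eventually_elim
    case (elim t)
    show "AE z in gauss_vec I. P (z(a := c a * t))"
    proof (rule insert.IH[of "\<lambda>z. P (z(a := c a * t))"])
      show "c i \<noteq> 0" if "i \<in> I" for i using that insert.prems(1) by blast
      show "Measurable.pred (gauss_vec I) (\<lambda>z. P (z(a := c a * t)))"
        by (rule measurable_compose[OF upd2 insert.prems(2)])
    qed (rule elim)
  qed
  moreover have "Measurable.pred borel (\<lambda>t. AE z in gauss_vec I. P (z(a := t)))"
  proof -
    have upd: "(\<lambda>x. (snd x)(a := fst x)) \<in> measurable (borel \<Otimes>\<^sub>M gauss_vec I) (gauss_vec (insert a I))"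
      by (rule measurable_fun_upd[where J=I]) auto
    have "Measurable.pred (borel \<Otimes>\<^sub>M gauss_vec I) (\<lambda>x. P ((snd x)(a := fst x)))"
      using measurable_compose[OF upd insert.prems(2)] .
    then have [measurable]: "Measurable.pred (borel \<Otimes>\<^sub>M gauss_vec I) (\<lambda>x. \<not> P ((snd x)(a := fst x)))"
      by simp
    have "(\<lambda>t. \<integral>\<^sup>+ z. indicator {x. \<not> P ((snd x)(a := fst x))} (t, z) \<partial>gauss_vec I) \<in> borel_measurable borel"
      by (rule G.borel_measurable_nn_integral_fst) measurable
    then have "Measurable.pred borel (\<lambda>t. (\<integral>\<^sup>+ z. indicator {x. \<not> P ((snd x)(a := fst x))} (t, z) \<partial>gauss_vec I) = 0)"
      by measurable
    moreover have "(AE z in gauss_vec I. P (z(a := t)))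
        \<longleftrightarrow> (\<integral>\<^sup>+ z. indicator {x. \<not> P ((snd x)(a := fst x))} (t, z) \<partial>gauss_vec I) = 0" for t
    proof -
      have "{z \<in> space (gauss_vec I). P (z(a := t))} \<in> sets (gauss_vec I)"
        using measurable_compose[OF upd2 insert.prems(2)] unfolding pred_def .
      moreover have "(\<lambda>z. indicator {x. \<not> P ((snd x)(a := fst x))} (t, z)) = (indicator {z. \<not> P (z(a := t))} :: _ \<Rightarrow> ennreal)"
        by (rule ext) (simp add: indicator_def)
      ultimately show ?thesis by (simp only: AE_iff_nn_integral)
    qed
    ultimately show ?thesis by simp
  qed
  ultimately have "AE t in std_normal_distribution. AE z in gauss_vec I. P (z(a := t))"
    using insert.prems(1)[of a] AE_std_normal_scale[of "c a" "\<lambda>t. AE z in gauss_vec I. P (z(a := t))"] by blast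
  then show ?case by (rule split[OF insert.prems(2), THEN iffD2])
qed

text \<open>
  A device for showing that a set is negligible without any computation: if almost every point visits
  \<open>B\<close> at most once while its coordinates are rescaled along a one-parameter family, then the
  preimages of \<open>B\<close> under these rescalings are essentially disjoint.  There are uncountably many of
  them, so one has probability zero, and by invariance of null sets \<open>B\<close> itself does.
\<close>

lemma gauss_vec_null_of_scaling:
  fixes c :: "real \<Rightarrow> 'i \<Rightarrow> real"
  assumes I: "finite I" and c: "\<And>s i. s \<in> {1..2} \<Longrightarrow> i \<in> I \<Longrightarrow> c s i \<noteq> 0"
    and B: "Measurable.pred (gauss_vec I) B"
    and once: "AE z in gauss_vec I. \<forall>s\<in>{1..2}. \<forall>t\<in>{1..2}. B (\<lambda>i\<in>I. c s i * z i) \<longrightarrow> B (\<lambda>i\<in>I. c t i * z i) \<longrightarrow> s = t"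
  shows "AE z in gauss_vec I. \<not> B z"
proof -
  interpret prob_space "gauss_vec I" by (rule prob_space_gauss_vec)
  let ?A = "\<lambda>s. {z \<in> space (gauss_vec I). B (\<lambda>i\<in>I. c s i * z i)}"
  have scale_m: "(\<lambda>z. \<lambda>i\<in>I. c s i * z i) \<in> measurable (gauss_vec I) (gauss_vec I)" for s
    by (intro measurable_restrict) (auto intro!: borel_measurable_times measurable_compose[OF measurable_component_singleton])
  have A: "?A s \<in> events" for s using measurable_compose[OF scale_m B] by (simp add: pred_def)
  \<comment> \<open>The events are almost surely disjoint, so at most \<open>1 / e\<close> of them have probability above \<open>e\<close>.\<close>
  have bound: "real (card F) * e \<le> 1" if F: "finite F" "F \<subseteq> {s\<in>{1..2}. e < prob (?A s)}" and "0 < e" for F e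
  proof -
    have "real (card F) * e = (\<Sum>s\<in>F. e)" by simp
    also have "\<dots> \<le> (\<Sum>s\<in>F. prob (?A s))" using F by (intro sum_mono) auto
    also have "\<dots> = (\<Sum>s\<in>F. expectation (indicator (?A s)))" using A by simp
    also have "\<dots> = expectation (\<lambda>z. \<Sum>s\<in>F. indicator (?A s) z)"
      using A by (subst Bochner_Integration.integral_sum) (auto simp: emeasure_eq_measure)
    also have "\<dots> \<le> expectation (\<lambda>z. 1)"
    proof (rule integral_mono_AE)
      show "AE z in gauss_vec I. (\<Sum>s\<in>F. indicator (?A s) z) \<le> (1::real)"
        using once
      proof (rule AE_mp, intro AE_I2 impI)
        fix z assume z: "\<forall>s\<in>{1..2}. \<forall>t\<in>{1..2}. B (\<lambda>i\<in>I. c s i * z i) \<longrightarrow> B (\<lambda>i\<in>I. c t i * z i) \<longrightarrow> s = t"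
        have uniq: "\<And>s t. s \<in> F \<Longrightarrow> t \<in> F \<Longrightarrow> z \<in> ?A s \<Longrightarrow> z \<in> ?A t \<Longrightarrow> t = s"
          using z F(2) by blast
        show "(\<Sum>s\<in>F. indicator (?A s) z) \<le> (1::real)"
        proof (cases "\<exists>s\<in>F. z \<in> ?A s")
          case True
          then obtain s where s: "s \<in> F" "z \<in> ?A s" by blast
          have "(\<Sum>t\<in>F. indicator (?A t) z) \<le> (\<Sum>t\<in>F. if t = s then 1 else (0::real))"
          proof (rule sum_mono)
            fix t assume "t \<in> F"
            then show "indicator (?A t) z \<le> (if t = s then 1 else (0::real))"
              using uniq[OF s(1) _ s(2), of t] by (cases "z \<in> ?A t") auto
          qed
          also have "\<dots> = 1" using s F by simp
          finally show ?thesis .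
        next
          case False
          then have "(\<Sum>s\<in>F. indicator (?A s) z) = (0::real)" by (intro sum.neutral) auto
          then show ?thesis by simp
        qed
      qed
    qed (use A in \<open>auto simp: emeasure_eq_measure\<close>)
    also have "\<dots> = 1" using prob_space by simp
    finally show ?thesis .
  qed
  have fin: "finite {s\<in>{1..2}. e < prob (?A s)}" if e: "0 < e" for e
  proof (rule ccontr)
    assume "infinite {s\<in>{1..2}. e < prob (?A s)}"
    then obtain F where F: "finite F" "F \<subseteq> {s\<in>{1..2}. e < prob (?A s)}" "card F = nat \<lceil>1 / e\<rceil> + 1"
      using infinite_arbitrarily_large[of "{s\<in>{1..2}. e < prob (?A s)}" "nat \<lceil>1 / e\<rceil> + 1"] by blast
    have "1 / e < real (card F)" using real_nat_ceiling_ge[of "1 / e"] unfolding F(3) by linarith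
    then have "1 < real (card F) * e" by (simp add: pos_divide_less_eq[OF e])
    then show False using bound[OF F(1,2) e] by linarith
  qed
  have "\<exists>s\<in>{1..2}. prob (?A s) = 0"
  proof (rule ccontr)
    assume "\<not> ?thesis"
    then have pos: "0 < prob (?A s)" if "s \<in> {1..2}" for s
      using that measure_nonneg[of "gauss_vec I" "?A s"] by (auto simp: order_le_less)
    have "{1..2::real} \<subseteq> (\<Union>m::nat. {s\<in>{1..2}. 1 / real (Suc m) < prob (?A s)})"
    proof
      fix s :: real assume s: "s \<in> {1..2}"
      obtain m where "1 / real (Suc m) < prob (?A s)" using nat_approx_posE[OF pos[OF s]] .
      then show "s \<in> (\<Union>m::nat. {s\<in>{1..2}. 1 / real (Suc m) < prob (?A s)})" using s by blast
    qed
    moreover have "countable (\<Union>m::nat. {s\<in>{1..2}. 1 / real (Suc m) < prob (?A s)})"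
    proof (rule countable_UN)
      fix m :: nat
      show "countable {s\<in>{1..2}. 1 / real (Suc m) < prob (?A s)}"
        by (rule countable_finite, rule fin) simp
    qed simp
    ultimately have "countable {1..2::real}" by (rule countable_subset)
    moreover have "uncountable {1..2::real}" by (subst uncountable_closed_interval) simp
    ultimately show False by contradiction
  qed
  then obtain s where s: "s \<in> {1..2}" "prob (?A s) = 0" by blast
  have "AE z in gauss_vec I. \<not> B (\<lambda>i\<in>I. c s i * z i)"
    using s(2) A[of s] by (subst AE_iff_measurable[OF A[of s]]) (auto simp: emeasure_eq_measure)
  then show ?thesis
    using c s(1) I B by (intro AE_gauss_vec_scale[of I "c s" "\<lambda>z. \<not> B z"]) auto
qed

lemma char_gauss_vec:
  assumes I: "finite I"
  shows "(\<integral>z. iexp (\<Sum>i\<in>I. c i * z i) \<partial>gauss_vec I) = of_real (exp (- (\<Sum>i\<in>I. (c i)\<^sup>2) / 2))"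
proof -
  interpret product_sigma_finite "\<lambda>_::'a. std_normal_distribution"
    by unfold_locales (intro sigma_finite_measure.sigma_finite_countable prob_space_imp_sigma_finite prob_space_normal_density; simp)
  interpret N: prob_space std_normal_distribution by (rule prob_space_normal_density) simp
  have "(\<integral>z. iexp (\<Sum>i\<in>I. c i * z i) \<partial>gauss_vec I) = (\<integral>z. (\<Prod>i\<in>I. iexp (c i * z i)) \<partial>gauss_vec I)"
    by (simp add: sum_distrib_left exp_sum[OF I])
  also have "\<dots> = (\<Prod>i\<in>I. \<integral>x. iexp (c i * x) \<partial>std_normal_distribution)"
    by (rule product_integral_prod[OF I]) (auto intro!: N.integrable_const_bound[where B=1])
  also have "\<dots> = (\<Prod>i\<in>I. of_real (exp (- (c i)\<^sup>2 / 2)))"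
    using fun_cong[OF char_std_normal_distribution] by (simp add: char_def)
  also have "\<dots> = of_real (exp (- (\<Sum>i\<in>I. (c i)\<^sup>2) / 2))"
    by (simp add: exp_sum[OF I] sum_negf[symmetric] sum_divide_distrib)
  finally show ?thesis .
qed

section \<open>Convergence in law of finitely many variables\<close>

text \<open>
  The functions whose expectation is determined by the joint characteristic function of the
  coordinates in \<open>K\<close>.
\<close>

inductive_set trig_poly :: "'k set \<Rightarrow> (('k \<Rightarrow> real) \<Rightarrow> complex) set" for K where
  mono: "(\<lambda>x. c * iexp (\<Sum>k\<in>K. t k * x k)) \<in> trig_poly K"
| add: "p \<in> trig_poly K \<Longrightarrow> q \<in> trig_poly K \<Longrightarrow> (\<lambda>x. p x + q x) \<in> trig_poly K"

lemma trig_poly_const: "(\<lambda>x. c) \<in> trig_poly K"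
  using trig_poly.mono[of c "\<lambda>_. 0" K] by simp

lemma trig_poly_mult:
  assumes "p \<in> trig_poly K" "q \<in> trig_poly K"
  shows "(\<lambda>x. p x * q x) \<in> trig_poly K"
  using assms(1)
proof induction
  case (mono c t)
  show ?case using assms(2)
  proof induction
    case (mono d u)
    have "c * iexp (\<Sum>k\<in>K. t k * x k) * (d * iexp (\<Sum>k\<in>K. u k * x k))
        = (c * d) * iexp (\<Sum>k\<in>K. (t k + u k) * x k)" for x
      by (simp only: distrib_right sum.distrib of_real_add distrib_left exp_add mult_ac)
    then show ?case using trig_poly.mono[of "c * d" "\<lambda>k. t k + u k" K] by presburger
  next
    case (add p q)
    then show ?case by (simp only: distrib_left trig_poly.add)
  qed
next
  case (add p q)
  then show ?case by (simp only: distrib_right trig_poly.add)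
qed

lemma trig_poly_sin:
  assumes "finite K" "k \<in> K"
  shows "(\<lambda>x. complex_of_real (sin (a * x k))) \<in> trig_poly K"
proof -
  have s: "(\<Sum>j\<in>K. (if j = k then b else 0) * x j) = b * x k" for b and x :: "'a \<Rightarrow> real"
    using assms by (subst sum.remove[of K k]) (auto intro!: sum.neutral)
  have "complex_of_real (sin (a * x k)) = (- \<i> / 2) * iexp (\<Sum>j\<in>K. (if j = k then a else 0) * x j)
      + (\<i> / 2) * iexp (\<Sum>j\<in>K. (if j = k then - a else 0) * x j)" for x
    unfolding s by (simp add: sin_of_real[symmetric] sin_exp_eq field_simps)
  then show ?thesis by (simp only: trig_poly.add[OF trig_poly.mono trig_poly.mono])
qed

text \<open>
  The inverse of \<open>x \<mapsto> sin (pi * x / (2 * R))\<close> on the interval from \<open>- R\<close> to \<open>R\<close>.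
\<close>

definition arcsin_scaled :: "real \<Rightarrow> real \<Rightarrow> real" where
  "arcsin_scaled R s = (2 * R / pi) * arcsin s"

lemma arcsin_scaled_sin:
  assumes "\<bar>x\<bar> \<le> R" "0 < R"
  shows "arcsin_scaled R (sin (pi / (2 * R) * x)) = x"
proof -
  have "\<bar>pi / (2 * R) * x\<bar> = pi / 2 * (\<bar>x\<bar> / R)" using assms by (simp add: abs_mult)
  also have "\<dots> \<le> pi / 2 * 1" using assms by (intro mult_left_mono) auto
  finally have "\<bar>pi / (2 * R) * x\<bar> \<le> pi / 2" by simp
  then have "arcsin (sin (pi / (2 * R) * x)) = pi / (2 * R) * x" by (intro arcsin_sin) linarith+
  then show ?thesis using assms by (simp add: arcsin_scaled_def)
qed

text \<open>
  Substituting \<open>x = arcsin_scaled R s\<close> turns \<open>f\<close> into a continuous function of \<open>s\<close> in a compact cube,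
  which the Stone--Weierstrass theorem approximates by polynomials in \<open>s\<close>.  Putting back
  \<open>s = sin (pi * x / (2 * R))\<close> gives a trigonometric polynomial that is close to \<open>f\<close> for \<open>x\<close> in a large
  cube and, because the sine stays within the cube for every \<open>x\<close>, is globally close to some value
  of \<open>f\<close>.  Hence it inherits the bound on \<open>f\<close>, so what happens outside the large cube is controlled
  by tightness alone.
\<close>

lemma trig_poly_approximation:
  fixes f :: "('k::countable \<Rightarrow> real) \<Rightarrow> real"
  assumes K: "finite K" and f: "continuous_on UNIV f" and R: "0 < R" and e: "0 < e"
    and fK: "\<And>x y. (\<And>k. k \<in> K \<Longrightarrow> x k = y k) \<Longrightarrow> f x = f y"
  obtains h p where "\<And>x. complex_of_real (h x) = p x" "p \<in> trig_poly K"
    "\<And>x. \<exists>y. \<bar>h x - f y\<bar> < e"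
    "\<And>x. \<forall>k\<in>K. \<bar>x k\<bar> \<le> R \<Longrightarrow> \<bar>h x - f x\<bar> < e"
proof -
  define S where "S = (PiE UNIV (\<lambda>k. if k \<in> K then {-1..1} else {0::real}))"
  define sn where "sn x = (\<lambda>k. if k \<in> K then sin (pi / (2 * R) * x k) else 0)" for x :: "'k \<Rightarrow> real"
  define F where "F s = f (\<lambda>k. arcsin_scaled R (s k))" for s
  define A where "A = {g. continuous_on S g \<and> (\<lambda>x. complex_of_real (g (sn x))) \<in> trig_poly K}"
  have snS: "sn x \<in> S" for x by (auto simp: sn_def S_def)
  have "compactin (product_topology (\<lambda>_. euclidean) UNIV) S"
    unfolding S_def by (subst compactin_PiE) auto
  then have comp: "compact S"
    by (simp add: euclidean_product_topology)
  have coord: "continuous_on S (\<lambda>s. s k)" for k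
    by (rule continuous_on_subset[OF continuous_on_product_coordinates]) simp
  have Fc: "continuous_on S F"
    unfolding F_def arcsin_scaled_def
  proof (rule continuous_on_compose2[OF f])
    show "continuous_on S (\<lambda>s k. 2 * R / pi * arcsin (s k))"
    proof (rule continuous_on_coordinatewise_then_product, rule continuous_on_mult_left,
        rule continuous_on_arcsin)
      fix k
      show "continuous_on S (\<lambda>s. s k)" by (rule coord)
      show "\<forall>s\<in>S. - 1 \<le> s k \<and> s k \<le> 1"
        by (cases "k \<in> K") (auto simp: S_def PiE_def Pi_def)
    qed
  qed auto
  interpret function_ring_on A S
  proof
    show "compact S" by (rule comp)
    show "continuous_on S g" if "g \<in> A" for g using that by (simp add: A_def)
    show "(\<lambda>x. g x + h x) \<in> A" if "g \<in> A" "h \<in> A" for g h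
      using that by (auto simp: A_def intro: continuous_on_add trig_poly.add)
    show "(\<lambda>x. g x * h x) \<in> A" if "g \<in> A" "h \<in> A" for g h
      using that by (auto simp: A_def intro: continuous_on_mult trig_poly_mult)
    show "(\<lambda>_. c) \<in> A" for c by (simp add: A_def trig_poly_const)
    show "\<exists>g\<in>A. g x \<noteq> g y" if xy: "x \<in> S" "y \<in> S" "x \<noteq> y" for x y
    proof -
      obtain k where k: "x k \<noteq> y k" using xy(3) by blast
      have kK: "k \<in> K"
      proof (rule ccontr)
        assume "k \<notin> K"
        then have "x k = 0" "y k = 0" using PiE_mem[OF xy(1)[unfolded S_def], of k]
            PiE_mem[OF xy(2)[unfolded S_def], of k] by simp_all
        then show False using k by simp
      qed
      have "(\<lambda>s. s k) \<in> A"
        using trig_poly_sin[OF K kK, of "pi / (2 * R)"] kK coord by (simp add: A_def sn_def)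
      then show ?thesis using k by (intro bexI[of _ "\<lambda>s. s k"])
    qed
  qed
  obtain g where g: "g \<in> A" "\<And>s. s \<in> S \<Longrightarrow> \<bar>F s - g s\<bar> < e"
    using Stone_Weierstrass_basic[OF Fc e] by blast
  show thesis
  proof
    show "complex_of_real (g (sn x)) = (\<lambda>x. complex_of_real (g (sn x))) x" for x by simp
    show "(\<lambda>x. complex_of_real (g (sn x))) \<in> trig_poly K" using g(1) by (simp add: A_def)
    show "\<exists>y. \<bar>g (sn x) - f y\<bar> < e" for x
      using g(2)[OF snS[of x]] unfolding F_def by (subst abs_minus_commute) (rule exI)
    show "\<bar>g (sn x) - f x\<bar> < e" if bounded: "\<forall>k\<in>K. \<bar>x k\<bar> \<le> R" for x
    proof -
      have "F (sn x) = f x"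
        unfolding F_def by (rule fK) (simp only: sn_def if_True arcsin_scaled_sin[OF bspec[OF bounded] R])
      then show ?thesis using g(2)[OF snS[of x]] by (simp add: abs_minus_commute)
    qed
  qed
qed

text \<open>
  Levy's continuity theorem on the real line gives convergence of the distribution functions at
  continuity points, of which there are arbitrarily large and arbitrarily small ones.
\<close>

lemma tight_of_char_tendsto:
  fixes M :: "nat \<Rightarrow> 'a measure" and X :: "nat \<Rightarrow> 'a \<Rightarrow> real" and Z :: "'b \<Rightarrow> real"
  assumes M: "\<And>n. prob_space (M n)" and N: "prob_space N"
    and X: "\<And>n. X n \<in> borel_measurable (M n)" and Z: "Z \<in> borel_measurable N"
    and lim: "\<And>t. (\<lambda>n. \<integral>\<omega>. iexp (t * X n \<omega>) \<partial>M n) \<longlonglongrightarrow> (\<integral>\<omega>. iexp (t * Z \<omega>) \<partial>N)"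
    and e: "0 < e"
  obtains B where "0 < B" "\<forall>\<^sub>F n in sequentially. \<P>(\<omega> in M n. B < \<bar>X n \<omega>\<bar>) < e"
proof -
  let ?\<mu> = "\<lambda>n. distr (M n) borel (X n)" and ?\<nu> = "distr N borel Z"
  interpret N: prob_space N by (rule N)
  interpret NU: real_distribution ?\<nu> by (rule N.real_distribution_distr[OF Z])
  have rd: "real_distribution (?\<mu> n)" for n
    using M X by (rule prob_space.real_distribution_distr)
  have "weak_conv_m ?\<mu> ?\<nu>"
    using lim by (intro levy_continuity rd NU.real_distribution_axioms)
      (simp add: char_def integral_distr X Z)
  then have wc: "isCont (cdf ?\<nu>) x \<Longrightarrow> (\<lambda>n. cdf (?\<mu> n) x) \<longlonglongrightarrow> cdf ?\<nu> x" for x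
    by (simp add: weak_conv_m_def weak_conv_def)
  have cont: "\<exists>x. c < x \<and> x < d \<and> isCont (cdf ?\<nu>) x" if "c < d" for c d
  proof (rule ccontr)
    assume "\<not> ?thesis"
    then have "{c<..<d} \<subseteq> {x. measure ?\<nu> {x} \<noteq> 0}" by (auto simp: NU.isCont_cdf)
    then have "countable {c<..<d}" using NU.countable_support by (rule countable_subset)
    moreover have "uncountable {c<..<d}" using that by (subst uncountable_open_interval)
    ultimately show False by contradiction
  qed
  have cc: "\<exists>x>a. isCont (cdf ?\<nu>) x \<and> P x" if ev: "\<forall>\<^sub>F x in at_top. P x" for a P
  proof -
    obtain b where b: "\<And>x. b \<le> x \<Longrightarrow> P x" using ev unfolding eventually_at_top_linorder by blast
    obtain x where "max a b < x" "isCont (cdf ?\<nu>) x" using cont[OF less_add_one[of "max a b"]] by blast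
    then show ?thesis using b by (intro exI[of _ x]) auto
  qed
  have cc': "\<exists>x<a. isCont (cdf ?\<nu>) x \<and> P x" if ev: "\<forall>\<^sub>F x in at_bot. P x" for a P
  proof -
    obtain b where b: "\<And>x. x \<le> b \<Longrightarrow> P x" using ev unfolding eventually_at_bot_linorder by blast
    obtain x where "x < min a b" "isCont (cdf ?\<nu>) x" using cont[of "min a b - 1" "min a b"]
      by (metis diff_less_eq less_add_one)
    then show ?thesis using b by (intro exI[of _ x]) auto
  qed
  have "\<forall>\<^sub>F x in at_top. 1 - e / 2 < cdf ?\<nu> x"
    using NU.cdf_lim_at_top_prob e by (intro order_tendstoD) auto
  then obtain x where x: "0 < x" "isCont (cdf ?\<nu>) x" "1 - e / 2 < cdf ?\<nu> x" using cc[of _ 0] by blast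
  have "\<forall>\<^sub>F y in at_bot. cdf ?\<nu> y < e / 2"
    using NU.cdf_lim_at_bot e by (intro order_tendstoD) auto
  then obtain y where y: "y < 0" "isCont (cdf ?\<nu>) y" "cdf ?\<nu> y < e / 2" using cc'[of _ 0] by blast
  define B where "B = max x (- y)"
  have "\<forall>\<^sub>F n in sequentially. \<P>(\<omega> in M n. B < \<bar>X n \<omega>\<bar>) < e"
    using order_tendstoD(1)[OF wc[OF x(2)] x(3)] order_tendstoD(2)[OF wc[OF y(2)] y(3)]
  proof eventually_elim
    case (elim n)
    interpret P: prob_space "M n" by (rule M)
    have [measurable]: "X n \<in> borel_measurable (M n)" by (rule X)
    have cdfx: "cdf (?\<mu> n) a = \<P>(\<omega> in M n. X n \<omega> \<le> a)" for a
      by (simp add: cdf_def measure_distr vimage_def Int_def conj_commute)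
    have "\<P>(\<omega> in M n. B < \<bar>X n \<omega>\<bar>)
        \<le> P.prob ({\<omega> \<in> space (M n). \<not> X n \<omega> \<le> x} \<union> {\<omega> \<in> space (M n). X n \<omega> \<le> y})"
      by (intro P.finite_measure_mono) (auto simp: B_def)
    also have "\<dots> \<le> \<P>(\<omega> in M n. \<not> X n \<omega> \<le> x) + \<P>(\<omega> in M n. X n \<omega> \<le> y)"
      by (intro measure_Un_le) measurable
    also have "\<P>(\<omega> in M n. \<not> X n \<omega> \<le> x) = 1 - \<P>(\<omega> in M n. X n \<omega> \<le> x)"
      by (intro P.prob_neg) measurable
    finally show ?case using elim by (simp add: cdfx)
  qed
  moreover have "0 < B" using x by (simp add: B_def)
  ultimately show thesis by (rule that[rotated])
qed

lemma (in prob_space) integrable_trig_poly: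
  assumes "p \<in> trig_poly K" and X: "\<And>k. k \<in> K \<Longrightarrow> (\<lambda>\<omega>. X \<omega> k) \<in> borel_measurable M"
  shows "integrable M (\<lambda>\<omega>. p (X \<omega>))"
  using assms(1)
proof induction
  case (mono c t)
  have "(\<lambda>\<omega>. \<Sum>k\<in>K. t k * X \<omega> k) \<in> borel_measurable M"
    by (intro borel_measurable_sum borel_measurable_times borel_measurable_const X)
  then have "(\<lambda>\<omega>. c * iexp (\<Sum>k\<in>K. t k * X \<omega> k)) \<in> borel_measurable M"
    by (rule measurable_compose) measurable
  then show ?case
    by (rule integrable_const_bound[where B="cmod c", rotated]) (simp add: norm_mult del: of_real_sum)
next
  case (add p q)
  show ?case by (rule Bochner_Integration.integrable_add[OF add.IH])
qed

text \<open>
  Pointwise convergence of joint characteristic functions of finitely many real variables.  The random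
  vectors are indexed by a countable type and vanish outside \<open>K\<close>, so that the product topology on
  functions is metrizable and the same type serves for every finite \<open>K\<close>.
\<close>

locale char_convergence =
  fixes K :: "'k::countable set"
    and M :: "nat \<Rightarrow> 'a measure" and X :: "nat \<Rightarrow> 'a \<Rightarrow> 'k \<Rightarrow> real"
    and N :: "'b measure" and Z :: "'b \<Rightarrow> 'k \<Rightarrow> real"
  assumes K: "finite K" and M: "\<And>n. prob_space (M n)" and N: "prob_space N"
    and X: "\<And>n k. k \<in> K \<Longrightarrow> (\<lambda>\<omega>. X n \<omega> k) \<in> borel_measurable (M n)"
    and Z: "\<And>k. k \<in> K \<Longrightarrow> (\<lambda>\<omega>. Z \<omega> k) \<in> borel_measurable N"
    and X0: "\<And>n \<omega> k. k \<notin> K \<Longrightarrow> X n \<omega> k = 0"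
    and Z0: "\<And>\<omega> k. k \<notin> K \<Longrightarrow> Z \<omega> k = 0"
    and char_tendsto: "\<And>t. (\<lambda>n. \<integral>\<omega>. iexp (\<Sum>k\<in>K. t k * X n \<omega> k) \<partial>M n)
      \<longlonglongrightarrow> (\<integral>\<omega>. iexp (\<Sum>k\<in>K. t k * Z \<omega> k) \<partial>N)"
begin

lemma X_borel: "X n \<in> borel_measurable (M n)"
proof (rule measurable_coordinatewise_then_product)
  fix k show "(\<lambda>\<omega>. X n \<omega> k) \<in> borel_measurable (M n)"
    using X[of k n] X0[of k n] by (cases "k \<in> K") auto
qed

lemma Z_borel: "Z \<in> borel_measurable N"
proof (rule measurable_coordinatewise_then_product)
  fix k show "(\<lambda>\<omega>. Z \<omega> k) \<in> borel_measurable N"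
    using Z[of k] Z0[of k] by (cases "k \<in> K") auto
qed

lemma integrable_X: "p \<in> trig_poly K \<Longrightarrow> integrable (M n) (\<lambda>\<omega>. p (X n \<omega>))"
  by (rule prob_space.integrable_trig_poly[where p=p and X="X n" and K=K, OF M _ X])

lemma integrable_Z: "p \<in> trig_poly K \<Longrightarrow> integrable N (\<lambda>\<omega>. p (Z \<omega>))"
  by (rule prob_space.integrable_trig_poly[where p=p and X=Z and K=K, OF N _ Z])

lemma trig_poly_tendsto:
  assumes "p \<in> trig_poly K"
  shows "(\<lambda>n. \<integral>\<omega>. p (X n \<omega>) \<partial>M n) \<longlonglongrightarrow> (\<integral>\<omega>. p (Z \<omega>) \<partial>N)"
  using assms
proof induction
  case (mono c t)
  show ?case unfolding integral_mult_right_zero by (intro tendsto_mult_left char_tendsto)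
next
  case (add p q)
  have "(\<integral>\<omega>. p (X n \<omega>) + q (X n \<omega>) \<partial>M n) = (\<integral>\<omega>. p (X n \<omega>) \<partial>M n) + (\<integral>\<omega>. q (X n \<omega>) \<partial>M n)" for n
    by (rule Bochner_Integration.integral_add[OF integrable_X[OF add.hyps(1)] integrable_X[OF add.hyps(2)]])
  moreover have "(\<integral>\<omega>. p (Z \<omega>) + q (Z \<omega>) \<partial>N) = (\<integral>\<omega>. p (Z \<omega>) \<partial>N) + (\<integral>\<omega>. q (Z \<omega>) \<partial>N)"
    by (rule Bochner_Integration.integral_add[OF integrable_Z[OF add.hyps(1)] integrable_Z[OF add.hyps(2)]])
  ultimately show ?case using tendsto_add[OF add.IH] by simp
qed

lemma coordinate_char_tendsto:
  assumes "k \<in> K"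
  shows "(\<lambda>n. \<integral>\<omega>. iexp (t * X n \<omega> k) \<partial>M n) \<longlonglongrightarrow> (\<integral>\<omega>. iexp (t * Z \<omega> k) \<partial>N)"
proof -
  have "(\<Sum>j\<in>K. (if j = k then t else 0) * x j) = t * x k" for x :: "'k \<Rightarrow> real"
    using K assms by (subst sum.remove[of K k]) (auto intro!: sum.neutral)
  then show ?thesis using char_tendsto[of "\<lambda>j. if j = k then t else 0"] by simp
qed

lemma uniformly_tight:
  assumes e: "0 < e"
  obtains R where "0 < R"
    "\<forall>\<^sub>F n in sequentially. \<forall>k\<in>K. \<P>(\<omega> in M n. R < \<bar>X n \<omega> k\<bar>) < e"
    "\<And>k. k \<in> K \<Longrightarrow> \<P>(\<omega> in N. R < \<bar>Z \<omega> k\<bar>) < e"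
proof -
  have ex: "\<exists>B. 0 < B \<and> (\<forall>\<^sub>F n in sequentially. \<P>(\<omega> in M n. B < \<bar>X n \<omega> k\<bar>) < e)
      \<and> \<P>(\<omega> in N. B < \<bar>Z \<omega> k\<bar>) < e" if k: "k \<in> K" for k
  proof -
    obtain B where B: "0 < B" "\<forall>\<^sub>F n in sequentially. \<P>(\<omega> in M n. B < \<bar>X n \<omega> k\<bar>) < e"
      by (rule tight_of_char_tendsto[where M=M and N=N and X="\<lambda>n \<omega>. X n \<omega> k" and Z="\<lambda>\<omega>. Z \<omega> k",
            OF M N X[OF k] Z[OF k] coordinate_char_tendsto[OF k] e])
    obtain B' where B': "0 < B'" "\<forall>\<^sub>F n in sequentially. \<P>(\<omega> in N. B' < \<bar>Z \<omega> k\<bar>) < e"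
      by (rule tight_of_char_tendsto[where M="\<lambda>_. N" and N=N and X="\<lambda>_ \<omega>. Z \<omega> k" and Z="\<lambda>\<omega>. Z \<omega> k",
            OF N N Z[OF k] Z[OF k] tendsto_const e])
    interpret N: prob_space N by (rule N)
    note [measurable] = Z[OF k] X[OF k]
    have "\<forall>\<^sub>F n in sequentially. \<P>(\<omega> in M n. max B B' < \<bar>X n \<omega> k\<bar>) < e"
      using B(2)
    proof eventually_elim
      case (elim n)
      interpret P: prob_space "M n" by (rule M)
      have "\<P>(\<omega> in M n. max B B' < \<bar>X n \<omega> k\<bar>)
          \<le> \<P>(\<omega> in M n. B < \<bar>X n \<omega> k\<bar>)"
        by (rule P.finite_measure_mono) auto
      then show ?case using elim by linarith
    qed
    moreover have "\<P>(\<omega> in N. max B B' < \<bar>Z \<omega> k\<bar>) < e"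
    proof -
      have "\<P>(\<omega> in N. max B B' < \<bar>Z \<omega> k\<bar>) \<le> \<P>(\<omega> in N. B' < \<bar>Z \<omega> k\<bar>)"
        by (rule N.finite_measure_mono) auto
      also have "\<dots> < e" using B'(2) by (simp add: eventually_const_iff)
      finally show ?thesis .
    qed
    moreover have "0 < max B B'" using B(1) by simp
    ultimately show ?thesis by blast
  qed
  have "\<exists>b. \<forall>k\<in>K. 0 < b k \<and> (\<forall>\<^sub>F n in sequentially. \<P>(\<omega> in M n. b k < \<bar>X n \<omega> k\<bar>) < e)
      \<and> \<P>(\<omega> in N. b k < \<bar>Z \<omega> k\<bar>) < e"
    by (rule bchoice, rule ballI, rule ex)
  then obtain b where b: "\<And>k. k \<in> K \<Longrightarrow> 0 < b k"
    "\<And>k. k \<in> K \<Longrightarrow> \<forall>\<^sub>F n in sequentially. \<P>(\<omega> in M n. b k < \<bar>X n \<omega> k\<bar>) < e"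
    "\<And>k. k \<in> K \<Longrightarrow> \<P>(\<omega> in N. b k < \<bar>Z \<omega> k\<bar>) < e"
    by blast
  define R where "R = 1 + (\<Sum>k\<in>K. b k)"
  have "0 \<le> (\<Sum>k\<in>K. b k)" using b(1) by (intro sum_nonneg) (auto intro: less_imp_le)
  then have "0 < R" by (simp add: R_def)
  have bR: "b k \<le> R" if "k \<in> K" for k
  proof -
    have "b k \<le> (\<Sum>k\<in>K. b k)"
      using that b(1) K by (intro member_le_sum) (auto intro: less_imp_le)
    then show ?thesis by (simp add: R_def)
  qed
  have "\<forall>\<^sub>F n in sequentially. \<forall>k\<in>K. \<P>(\<omega> in M n. b k < \<bar>X n \<omega> k\<bar>) < e"
    using b(2) K by (simp add: eventually_ball_finite)
  then have "\<forall>\<^sub>F n in sequentially. \<forall>k\<in>K. \<P>(\<omega> in M n. R < \<bar>X n \<omega> k\<bar>) < e"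
  proof eventually_elim
    case (elim n)
    show ?case
    proof
      fix k assume k: "k \<in> K"
      interpret P: prob_space "M n" by (rule M)
      note [measurable] = X[OF k]
      have "\<P>(\<omega> in M n. R < \<bar>X n \<omega> k\<bar>)
          \<le> \<P>(\<omega> in M n. b k < \<bar>X n \<omega> k\<bar>)"
        using bR[OF k] by (intro P.finite_measure_mono) auto
      then show "\<P>(\<omega> in M n. R < \<bar>X n \<omega> k\<bar>) < e" using elim k by force
    qed
  qed
  moreover have "\<P>(\<omega> in N. R < \<bar>Z \<omega> k\<bar>) < e" if k: "k \<in> K" for k
  proof -
    interpret N: prob_space N by (rule N)
    note [measurable] = Z[OF k]
    have "\<P>(\<omega> in N. R < \<bar>Z \<omega> k\<bar>) \<le> \<P>(\<omega> in N. b k < \<bar>Z \<omega> k\<bar>)"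
      using bR[OF k] by (intro N.finite_measure_mono) auto
    then show ?thesis using b(3)[OF k] by linarith
  qed
  ultimately show thesis using \<open>0 < R\<close> that by blast
qed

lemma approximation_error:
  fixes Y :: "'c \<Rightarrow> 'k \<Rightarrow> real"
  assumes "prob_space P" and Y: "\<And>k. k \<in> K \<Longrightarrow> (\<lambda>\<omega>. Y \<omega> k) \<in> borel_measurable P"
    and f: "(\<lambda>\<omega>. f (Y \<omega>)) \<in> borel_measurable P" "\<And>x. \<bar>f x\<bar> \<le> (1::real)"
    and h: "(\<lambda>\<omega>. h (Y \<omega>)) \<in> borel_measurable P" "\<And>x. \<bar>h x\<bar> \<le> 2"
    and near: "\<And>x. \<forall>k\<in>K. \<bar>x k\<bar> \<le> R \<Longrightarrow> \<bar>h x - f x\<bar> < e"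
    and tail: "\<And>k. k \<in> K \<Longrightarrow> measure P {\<omega> \<in> space P. R < \<bar>Y \<omega> k\<bar>} < d" and e: "0 < e"
  shows "\<bar>(\<integral>\<omega>. h (Y \<omega>) \<partial>P) - (\<integral>\<omega>. f (Y \<omega>) \<partial>P)\<bar> \<le> e + 3 * (real (card K) * d)"
proof -
  interpret P: prob_space P by (rule assms(1))
  let ?B = "\<lambda>k. {\<omega> \<in> space P. R < \<bar>Y \<omega> k\<bar>}"
  have B: "?B k \<in> P.events" if "k \<in> K" for k
  proof -
    note [measurable] = Y[OF that]
    show ?thesis by measurable
  qed
  have intf: "integrable P (\<lambda>\<omega>. f (Y \<omega>))" "integrable P (\<lambda>\<omega>. h (Y \<omega>))"
    using f h by (auto intro: P.integrable_const_bound[where B=1] P.integrable_const_bound[where B=2])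
  have intB: "integrable P (\<lambda>\<omega>. \<Sum>k\<in>K. indicator (?B k) \<omega> :: real)"
    using B by (intro Bochner_Integration.integrable_sum) (auto simp: P.emeasure_eq_measure)
  have "\<bar>(\<integral>\<omega>. h (Y \<omega>) \<partial>P) - (\<integral>\<omega>. f (Y \<omega>) \<partial>P)\<bar> = \<bar>\<integral>\<omega>. h (Y \<omega>) - f (Y \<omega>) \<partial>P\<bar>"
    using intf by simp
  also have "\<dots> \<le> (\<integral>\<omega>. \<bar>h (Y \<omega>) - f (Y \<omega>)\<bar> \<partial>P)"
    by (rule integral_abs_bound)
  also have "\<dots> \<le> (\<integral>\<omega>. e + 3 * (\<Sum>k\<in>K. indicator (?B k) \<omega>) \<partial>P)"
  proof (rule integral_mono)
    fix \<omega> assume \<omega>: "\<omega> \<in> space P"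
    show "\<bar>h (Y \<omega>) - f (Y \<omega>)\<bar> \<le> e + 3 * (\<Sum>k\<in>K. indicator (?B k) \<omega>)"
    proof (cases "\<forall>k\<in>K. \<bar>Y \<omega> k\<bar> \<le> R")
      case True
      have "0 \<le> (\<Sum>k\<in>K. indicator (?B k) \<omega> :: real)" by (intro sum_nonneg) simp
      then show ?thesis using near[OF True] by linarith
    next
      case False
      then obtain k where k: "k \<in> K" "\<omega> \<in> ?B k" using \<omega> by force
      have "1 = (indicator (?B k) \<omega> :: real)" using k by simp
      also have "\<dots> \<le> (\<Sum>k\<in>K. indicator (?B k) \<omega>)"
        using k K by (intro member_le_sum) auto
      finally show ?thesis using f(2)[of "Y \<omega>"] h(2)[of "Y \<omega>"] e by linarith
    qed
  qed (use intf intB in auto)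
  also have "\<dots> = e + 3 * (\<Sum>k\<in>K. P.prob (?B k))"
    using intB B by (simp add: P.prob_space Bochner_Integration.integral_sum P.emeasure_eq_measure)
  also have "(\<Sum>k\<in>K. P.prob (?B k)) \<le> (\<Sum>k\<in>K. d)"
    using tail by (intro sum_mono) (auto intro: less_imp_le)
  finally show ?thesis by simp
qed

text \<open>
  Convergence holds for trigonometric polynomials by assumption; on a cube that carries almost all of
  the mass, uniformly in \<open>n\<close>, they approximate \<open>f\<close>.
\<close>

lemma bounded_continuous_tendsto:
  assumes f: "continuous_on UNIV f" "\<And>x. \<bar>f x\<bar> \<le> (1::real)"
  shows "(\<lambda>n. \<integral>\<omega>. f (X n \<omega>) \<partial>M n) \<longlonglongrightarrow> (\<integral>\<omega>. f (Z \<omega>) \<partial>N)"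
proof (rule LIMSEQ_I)
  fix r :: real assume r: "0 < r"
  define restr where "restr x = (\<lambda>k. if k \<in> K then x k else 0)" for x :: "'k \<Rightarrow> real"
  have restr: "restr (X n \<omega>) = X n \<omega>" "restr (Z \<omega>') = Z \<omega>'" for n \<omega> \<omega>'
    by (auto simp: restr_def X0 Z0)
  have "continuous_on UNIV restr"
  proof (rule continuous_on_coordinatewise_then_product)
    fix k show "continuous_on UNIV (\<lambda>x. restr x k)"
      by (cases "k \<in> K") (simp_all add: restr_def)
  qed
  then have fr: "continuous_on UNIV (\<lambda>x. f (restr x))"
    by (rule continuous_on_compose2[OF f(1)]) simp
  \<comment> \<open>Three errors of at most \<open>e + 3 * e\<close>, \<open>e + 3 * e\<close> and \<open>e\<close> have to add up to less than \<open>r\<close>.\<close>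
  define e where "e = min 1 (r / 24)"
  define d where "d = e / (real (card K) + 1)"
  have e: "0 < e" "e \<le> 1" "e \<le> r / 24" using r by (auto simp: e_def)
  have d: "0 < d" "real (card K) * d \<le> e" using e by (auto simp: d_def field_simps)
  obtain R where R: "0 < R"
    "\<forall>\<^sub>F n in sequentially. \<forall>k\<in>K. \<P>(\<omega> in M n. R < \<bar>X n \<omega> k\<bar>) < d"
    "\<And>k. k \<in> K \<Longrightarrow> \<P>(\<omega> in N. R < \<bar>Z \<omega> k\<bar>) < d"
    using uniformly_tight[OF d(1)] by blast
  have f_restr: "f (restr x) = f (restr y)" if "\<And>k. k \<in> K \<Longrightarrow> x k = y k" for x y
  proof -
    have "restr x = restr y" using that by (auto simp: restr_def)
    then show ?thesis by simp
  qed
  obtain h p where hp: "\<And>x. complex_of_real (h x) = p x" "p \<in> trig_poly K"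
    "\<And>x. \<exists>y. \<bar>h x - f (restr y)\<bar> < e"
    "\<And>x. \<forall>k\<in>K. \<bar>x k\<bar> \<le> R \<Longrightarrow> \<bar>h x - f (restr x)\<bar> < e"
  proof (rule trig_poly_approximation[OF K fr R(1) e(1) f_restr])
    fix h p
    assume "\<And>x. complex_of_real (h x) = p x" "p \<in> trig_poly K"
      "\<And>x. \<exists>y. \<bar>h x - f (restr y)\<bar> < e"
      "\<And>x. \<forall>k\<in>K. \<bar>x k\<bar> \<le> R \<Longrightarrow> \<bar>h x - f (restr x)\<bar> < e"
    then show thesis by (rule that) 
  qed
  have h2: "\<bar>h x\<bar> \<le> 2" for x
  proof -
    obtain y where "\<bar>h x - f (restr y)\<bar> < e" using hp(3) by blast
    then show ?thesis using f(2)[of "restr y"] e(2) by linarith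
  qed
  have Re_p: "h x = Re (p x)" for x using hp(1)[of x] by (metis Re_complex_of_real)
  have hX: "(\<lambda>\<omega>. h (X n \<omega>)) \<in> borel_measurable (M n)" for n
    unfolding Re_p by (rule borel_measurable_integrable, rule integrable_Re, rule integrable_X, rule hp(2))
  have hZ: "(\<lambda>\<omega>. h (Z \<omega>)) \<in> borel_measurable N"
    unfolding Re_p by (rule borel_measurable_integrable, rule integrable_Re, rule integrable_Z, rule hp(2))
  have fm: "f \<in> borel_measurable borel"
    using f(1) by (rule borel_measurable_continuous_onI)
  have fX: "(\<lambda>\<omega>. f (restr (X n \<omega>))) \<in> borel_measurable (M n)" for n
    unfolding restr by (rule measurable_compose[OF X_borel fm])
  have fZ: "(\<lambda>\<omega>. f (restr (Z \<omega>))) \<in> borel_measurable N"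
    unfolding restr by (rule measurable_compose[OF Z_borel fm])
  have "(\<lambda>n. Re (\<integral>\<omega>. p (X n \<omega>) \<partial>M n)) \<longlonglongrightarrow> Re (\<integral>\<omega>. p (Z \<omega>) \<partial>N)"
    by (intro tendsto_Re trig_poly_tendsto hp(2))
  then have h_lim: "(\<lambda>n. \<integral>\<omega>. h (X n \<omega>) \<partial>M n) \<longlonglongrightarrow> (\<integral>\<omega>. h (Z \<omega>) \<partial>N)"
    by (simp add: hp(1)[symmetric])
  have errZ: "\<bar>(\<integral>\<omega>. h (Z \<omega>) \<partial>N) - (\<integral>\<omega>. f (restr (Z \<omega>)) \<partial>N)\<bar> \<le> e + 3 * (real (card K) * d)"
    by (rule approximation_error[OF N Z fZ f(2) hZ h2 hp(4) R(3) e(1)])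
  have "\<forall>\<^sub>F n in sequentially. \<bar>(\<integral>\<omega>. h (X n \<omega>) \<partial>M n) - (\<integral>\<omega>. h (Z \<omega>) \<partial>N)\<bar> < e"
    using h_lim e(1) by (auto simp: tendsto_iff dist_real_def)
  then have "\<forall>\<^sub>F n in sequentially. norm ((\<integral>\<omega>. f (X n \<omega>) \<partial>M n) - (\<integral>\<omega>. f (Z \<omega>) \<partial>N)) < r"
    using R(2)
  proof eventually_elim
    case (elim n)
    have "\<bar>(\<integral>\<omega>. h (X n \<omega>) \<partial>M n) - (\<integral>\<omega>. f (restr (X n \<omega>)) \<partial>M n)\<bar> \<le> e + 3 * (real (card K) * d)"
      by (rule approximation_error[OF M X fX f(2) hX h2 hp(4) bspec[OF elim(2)] e(1)])
    then have "\<bar>(\<integral>\<omega>. f (X n \<omega>) \<partial>M n) - (\<integral>\<omega>. f (Z \<omega>) \<partial>N)\<bar> < r"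
      using errZ elim(1) d(2) e(3) r unfolding restr by linarith
    then show ?case by simp
  qed
  then show "\<exists>no. \<forall>n\<ge>no. norm ((\<integral>\<omega>. f (X n \<omega>) \<partial>M n) - (\<integral>\<omega>. f (Z \<omega>) \<partial>N)) < r"
    by (simp add: eventually_sequentially)
qed

text \<open>
  The open half of the portmanteau theorem, by approximating the indicator of \<open>U\<close> from below with the
  continuous functions \<open>min 1 (m * infdist x (- U))\<close>.
\<close>

theorem portmanteau_open:
  assumes U: "open U" and c: "c < \<P>(\<omega> in N. Z \<omega> \<in> U)"
  shows "\<forall>\<^sub>F n in sequentially. c < \<P>(\<omega> in M n. X n \<omega> \<in> U)"
proof (cases "U = UNIV")
  case True
  interpret N: prob_space N by (rule N)
  have "measure (M n) (space (M n)) = 1" for n using M by (rule prob_space.prob_space)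
  then show ?thesis using True c N.prob_space by simp
next
  case False
  then have ne: "- U \<noteq> {}" by auto
  interpret N: prob_space N by (rule N)
  define f where "f m x = min 1 (real m * infdist x (- U))" for m x
  have fc: "continuous_on UNIV (f m)" for m
    unfolding f_def by (intro continuous_intros)
  have f1: "\<bar>f m x\<bar> \<le> 1" "0 \<le> f m x" for m x using infdist_nonneg[of x "- U"] by (auto simp: f_def)
  have fU: "f m x \<le> indicator U x" for m x
    using f1(1)[of m x] by (auto simp: f_def indicator_def)
  have fm: "f m \<in> borel_measurable borel" for m
    by (rule borel_measurable_continuous_onI[OF fc])
  have "(\<lambda>m. f m x) \<longlonglongrightarrow> indicator U x" for x
  proof (cases "x \<in> U")
    case True
    then have "0 < infdist x (- U)"
      using in_closed_iff_infdist_zero[of "- U" x] U ne infdist_nonneg[of x "- U"] by (auto simp: less_le)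
    then obtain m0 :: nat where m0: "1 < real m0 * infdist x (- U)" using ex_less_of_nat_mult by blast
    have "\<forall>\<^sub>F m in sequentially. f m x = indicator U x"
      using eventually_ge_at_top[of m0]
    proof eventually_elim
      case (elim m)
      then have "real m0 * infdist x (- U) \<le> real m * infdist x (- U)"
        by (intro mult_right_mono) (auto simp: infdist_nonneg)
      then show ?case using m0 True by (simp add: f_def)
    qed
    then show ?thesis by (rule tendsto_eventually)
  next
    case False
    then show ?thesis by (simp add: f_def)
  qed
  then have "(\<lambda>m. \<integral>\<omega>. f m (Z \<omega>) \<partial>N) \<longlonglongrightarrow> (\<integral>\<omega>. indicator U (Z \<omega>) \<partial>N)"
    using f1 U
    by (intro integral_dominated_convergence[where w="\<lambda>_. 1"] measurable_compose[OF Z_borel] fm) auto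
  moreover have "(\<integral>\<omega>. indicator U (Z \<omega>) \<partial>N) = \<P>(\<omega> in N. Z \<omega> \<in> U)"
  proof -
    have "(\<integral>\<omega>. indicator U (Z \<omega>) \<partial>N) = (\<integral>\<omega>. indicator {\<omega> \<in> space N. Z \<omega> \<in> U} \<omega> \<partial>N)"
      by (intro Bochner_Integration.integral_cong) (auto simp: indicator_def)
    also have "\<dots> = \<P>(\<omega> in N. Z \<omega> \<in> U)"
      using measurable_sets[OF Z_borel, of U] U by (simp add: vimage_def Int_def conj_commute)
    finally show ?thesis .
  qed
  ultimately have "\<forall>\<^sub>F m in sequentially. c < (\<integral>\<omega>. f m (Z \<omega>) \<partial>N)" using c by (auto intro: order_tendstoD)
  then obtain m where m: "c < (\<integral>\<omega>. f m (Z \<omega>) \<partial>N)" by (auto simp: eventually_sequentially)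
  have "\<forall>\<^sub>F n in sequentially. c < (\<integral>\<omega>. f m (X n \<omega>) \<partial>M n)"
    by (rule order_tendstoD(1)[OF bounded_continuous_tendsto[OF fc f1(1)] m])
  then show ?thesis
  proof eventually_elim
    case (elim n)
    interpret P: prob_space "M n" by (rule M)
    have Um: "{\<omega> \<in> space (M n). X n \<omega> \<in> U} \<in> P.events"
      using measurable_sets[OF X_borel, of U n] U by (simp add: vimage_def Int_def conj_commute)
    have "(\<integral>\<omega>. f m (X n \<omega>) \<partial>M n) \<le> (\<integral>\<omega>. indicator {\<omega> \<in> space (M n). X n \<omega> \<in> U} \<omega> \<partial>M n)"
    proof (rule integral_mono)
      show "integrable (M n) (\<lambda>\<omega>. f m (X n \<omega>))"
        using f1 by (intro P.integrable_const_bound[where B=1] measurable_compose[OF X_borel fm]) auto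
      show "integrable (M n) (indicator {\<omega> \<in> space (M n). X n \<omega> \<in> U} :: _ \<Rightarrow> real)"
        using Um by (simp add: P.emeasure_eq_measure)
      show "f m (X n \<omega>) \<le> indicator {\<omega> \<in> space (M n). X n \<omega> \<in> U} \<omega>" if "\<omega> \<in> space (M n)" for \<omega>
        using fU[of m "X n \<omega>"] that by (auto simp: indicator_def)
    qed
    then show ?case using elim Um by simp
  qed
qed
end

section \<open>Slutsky arguments\<close>

lemma inverse_sqrt_continuity:
  fixes c \<kappa> :: real
  assumes "0 < c" "0 < \<kappa>"
  obtains \<eta> where "0 < \<eta>" "\<And>v. \<bar>v - c\<bar> \<le> \<eta> \<Longrightarrow> \<bar>1 / sqrt v - 1 / sqrt c\<bar> \<le> \<kappa>"
proof -
  have "isCont (\<lambda>v. 1 / sqrt v) c"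
    using assms(1) by (intro continuous_intros) auto
  then obtain d where d: "0 < d" "\<And>v. dist v c < d \<Longrightarrow> dist (1 / sqrt v) (1 / sqrt c) < \<kappa>"
    using assms(2) unfolding continuous_at_eps_delta by blast
  show thesis
  proof
    show "0 < d / 2" using d(1) by simp
    fix v assume "\<bar>v - c\<bar> \<le> d / 2"
    then have "dist v c < d" using d(1) by (simp add: dist_real_def)
    then show "\<bar>1 / sqrt v - 1 / sqrt c\<bar> \<le> \<kappa>" using d(2)[of v] by (simp add: dist_real_def)
  qed
qed

lemma tendsto_in_probD:
  assumes "tendsto_in_prob M U u"
  shows "U n \<in> borel_measurable (M n)"
    and "0 < \<epsilon> \<Longrightarrow> (\<lambda>n. \<P>(\<omega> in M n. \<epsilon> < \<bar>U n \<omega> - u\<bar>)) \<longlonglongrightarrow> 0"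
  using assms unfolding tendsto_in_prob_def by blast+

text \<open>
  On the event that \<open>A - U\<close> is small, \<open>V\<close> is close to \<open>c\<close> and \<open>U\<close> is bounded by \<open>B\<close>, the difference is
  small because it equals \<open>(A - U) / sqrt V + U * (1 / sqrt V - 1 / sqrt c)\<close>.
\<close>

lemma slutsky_quotient:
  fixes U A V :: "nat \<Rightarrow> 'a \<Rightarrow> real"
  assumes M: "\<And>n. prob_space (M n)" and U: "\<And>n. U n \<in> borel_measurable (M n)"
    and tight: "\<And>e. 0 < e \<Longrightarrow> \<exists>B>0. \<forall>\<^sub>F n in sequentially. \<P>(\<omega> in M n. B < \<bar>U n \<omega>\<bar>) < e"
    and A: "tendsto_in_prob M (\<lambda>n \<omega>. A n \<omega> - U n \<omega>) 0"
    and V: "tendsto_in_prob M V c" and c: "0 < c"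
  shows "tendsto_in_prob M (\<lambda>n \<omega>. A n \<omega> / sqrt (V n \<omega>) - U n \<omega> / sqrt c) 0"
  unfolding tendsto_in_prob_def
proof (intro conjI allI impI)
  fix n
  have "(\<lambda>\<omega>. (A n \<omega> - U n \<omega>) + U n \<omega>) \<in> borel_measurable (M n)"
    using A U unfolding tendsto_in_prob_def by (intro borel_measurable_add) auto
  then have [measurable]: "A n \<in> borel_measurable (M n)" by simp
  have [measurable]: "V n \<in> borel_measurable (M n)" "U n \<in> borel_measurable (M n)"
    using V U unfolding tendsto_in_prob_def by auto
  show "(\<lambda>\<omega>. A n \<omega> / sqrt (V n \<omega>) - U n \<omega> / sqrt c) \<in> borel_measurable (M n)" by measurable
next
  fix \<epsilon> :: real assume \<epsilon>: "0 < \<epsilon>"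
  let ?bad = "\<lambda>n. {\<omega> \<in> space (M n). \<epsilon> < \<bar>A n \<omega> / sqrt (V n \<omega>) - U n \<omega> / sqrt c - 0\<bar>}"
  show "(\<lambda>n. measure (M n) (?bad n)) \<longlonglongrightarrow> 0"
  proof (rule LIMSEQ_I)
    fix d :: real assume d: "0 < d"
    then obtain B where B: "0 < B" "\<forall>\<^sub>F n in sequentially. \<P>(\<omega> in M n. B < \<bar>U n \<omega>\<bar>) < d / 3"
      using tight[of "d / 3"] by auto
    define a where "a = 1 / sqrt c + 1 + B"
    have a: "0 < a" using c B(1) by (simp add: a_def add_pos_pos)
    define \<kappa> where "\<kappa> = min 1 (\<epsilon> / a)"
    have \<kappa>: "0 < \<kappa>" "\<kappa> \<le> 1" "\<kappa> * a \<le> \<epsilon>" using \<epsilon> a by (auto simp: \<kappa>_def min_def field_simps)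
    obtain \<eta> where \<eta>: "0 < \<eta>" "\<And>v. \<bar>v - c\<bar> \<le> \<eta> \<Longrightarrow> \<bar>1 / sqrt v - 1 / sqrt c\<bar> \<le> \<kappa>"
      using inverse_sqrt_continuity[OF c \<kappa>(1)] by blast
    let ?E1 = "\<lambda>n. {\<omega> \<in> space (M n). \<kappa> < \<bar>A n \<omega> - U n \<omega> - 0\<bar>}"
    let ?E2 = "\<lambda>n. {\<omega> \<in> space (M n). \<eta> < \<bar>V n \<omega> - c\<bar>}"
    let ?E3 = "\<lambda>n. {\<omega> \<in> space (M n). B < \<bar>U n \<omega>\<bar>}"
    have "0 < d / 3" using d by simp
    then have "\<forall>\<^sub>F n in sequentially. measure (M n) (?E1 n) < d / 3"
      "\<forall>\<^sub>F n in sequentially. measure (M n) (?E2 n) < d / 3"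
      by (rule order_tendstoD(2)[OF tendsto_in_probD(2)[OF A \<kappa>(1)]],
          rule order_tendstoD(2)[OF tendsto_in_probD(2)[OF V \<eta>(1)]])
    then have "\<forall>\<^sub>F n in sequentially. norm (measure (M n) (?bad n) - 0) < d"
      using B(2)
    proof eventually_elim
      case (elim n)
      interpret prob_space "M n" by (rule M)
      have "(\<lambda>\<omega>. A n \<omega> - U n \<omega>) \<in> borel_measurable (M n)" "V n \<in> borel_measurable (M n)"
        using A V unfolding tendsto_in_prob_def by auto
      note [measurable] = this U[of n]
      have "?bad n \<subseteq> ?E1 n \<union> ?E2 n \<union> ?E3 n"
      proof (intro subsetI, rule ccontr)
        fix \<omega> assume \<omega>: "\<omega> \<in> ?bad n" "\<omega> \<notin> ?E1 n \<union> ?E2 n \<union> ?E3 n"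
        let ?q = "1 / sqrt (V n \<omega>) - 1 / sqrt c"
        have 1: "\<bar>A n \<omega> - U n \<omega>\<bar> \<le> \<kappa>" and 2: "\<bar>?q\<bar> \<le> \<kappa>" and 3: "\<bar>U n \<omega>\<bar> \<le> B"
          using \<omega> \<eta>(2) by auto
        have "\<bar>1 / sqrt (V n \<omega>)\<bar> \<le> 1 / sqrt c + 1"
        proof -
          have "0 < 1 / sqrt c" using c by simp
          then show ?thesis using 2 \<kappa>(2) by linarith
        qed
        then have "\<bar>A n \<omega> - U n \<omega>\<bar> * \<bar>1 / sqrt (V n \<omega>)\<bar> \<le> \<kappa> * (1 / sqrt c + 1)"
          using 1 \<kappa>(1) by (intro mult_mono) auto
        moreover have "\<bar>U n \<omega>\<bar> * \<bar>?q\<bar> \<le> B * \<kappa>"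
          using 2 3 B(1) by (intro mult_mono) auto
        moreover have "A n \<omega> / sqrt (V n \<omega>) - U n \<omega> / sqrt c = (A n \<omega> - U n \<omega>) * (1 / sqrt (V n \<omega>)) + U n \<omega> * ?q"
          by (simp add: algebra_simps diff_divide_distrib)
        then have "\<bar>A n \<omega> / sqrt (V n \<omega>) - U n \<omega> / sqrt c\<bar> \<le> \<bar>A n \<omega> - U n \<omega>\<bar> * \<bar>1 / sqrt (V n \<omega>)\<bar> + \<bar>U n \<omega>\<bar> * \<bar>?q\<bar>"
          by (simp only: abs_mult[symmetric] abs_triangle_ineq)
        moreover have "\<kappa> * (1 / sqrt c + 1) + B * \<kappa> = \<kappa> * a" by (simp add: a_def algebra_simps)
        ultimately have "\<bar>A n \<omega> / sqrt (V n \<omega>) - U n \<omega> / sqrt c\<bar> \<le> \<epsilon>" using \<kappa>(3) by linarith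
        then show False using \<omega>(1) by simp
      qed
      then have "prob (?bad n) \<le> prob (?E1 n \<union> ?E2 n \<union> ?E3 n)"
        by (intro finite_measure_mono) measurable
      also have "\<dots> \<le> prob (?E1 n \<union> ?E2 n) + prob (?E3 n)"
        by (intro measure_Un_le) measurable
      also have "prob (?E1 n \<union> ?E2 n) \<le> prob (?E1 n) + prob (?E2 n)"
        by (intro measure_Un_le) measurable
      finally show ?case using elim by simp
    qed
    then show "\<exists>no. \<forall>n\<ge>no. norm (measure (M n) (?bad n) - 0) < d"
      by (simp only: eventually_sequentially)
  qed
qed

lemma tendsto_in_prob_linear_combination:
  fixes Y :: "nat \<Rightarrow> 'k \<Rightarrow> 'a \<Rightarrow> real"
  assumes M: "\<And>n. prob_space (M n)" and K: "finite K"
    and Y: "\<And>k. k \<in> K \<Longrightarrow> tendsto_in_prob M (\<lambda>n. Y n k) 0"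
  shows "tendsto_in_prob M (\<lambda>n \<omega>. \<Sum>k\<in>K. t k * Y n k \<omega>) 0"
  unfolding tendsto_in_prob_def
proof (intro conjI allI impI)
  have Ym: "Y n k \<in> borel_measurable (M n)" if "k \<in> K" for n k
    using Y[OF that] unfolding tendsto_in_prob_def by auto
  then show "(\<lambda>\<omega>. \<Sum>k\<in>K. t k * Y n k \<omega>) \<in> borel_measurable (M n)" for n
    by (intro borel_measurable_sum borel_measurable_times borel_measurable_const)
  fix \<epsilon> :: real assume \<epsilon>: "0 < \<epsilon>"
  define b where "b = \<epsilon> / ((\<Sum>k\<in>K. \<bar>t k\<bar>) + 1)"
  have T: "0 \<le> (\<Sum>k\<in>K. \<bar>t k\<bar>)" by (intro sum_nonneg) simp
  have b: "0 < b" "(\<Sum>k\<in>K. \<bar>t k\<bar>) * b \<le> \<epsilon>" 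
  proof -
    have s: "0 < (\<Sum>k\<in>K. \<bar>t k\<bar>) + 1" using T by linarith
    then show "0 < b" unfolding b_def using \<epsilon> by (rule divide_pos_pos[rotated])
    have "((\<Sum>k\<in>K. \<bar>t k\<bar>) + 1) * b = \<epsilon>" using s by (simp add: b_def)
    then show "(\<Sum>k\<in>K. \<bar>t k\<bar>) * b \<le> \<epsilon>" using \<open>0 < b\<close> by (simp add: distrib_right)
  qed
  let ?E = "\<lambda>n k. {\<omega> \<in> space (M n). b < \<bar>Y n k \<omega> - 0\<bar>}"
  show "(\<lambda>n. \<P>(\<omega> in M n. \<epsilon> < \<bar>(\<Sum>k\<in>K. t k * Y n k \<omega>) - 0\<bar>)) \<longlonglongrightarrow> 0"
  proof (rule Lim_null_comparison)
    have "(\<lambda>n. \<Sum>k\<in>K. measure (M n) (?E n k)) \<longlonglongrightarrow> (\<Sum>k\<in>K. 0)"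
      using Y b(1) unfolding tendsto_in_prob_def by (intro tendsto_sum) auto
    then show "(\<lambda>n. \<Sum>k\<in>K. measure (M n) (?E n k)) \<longlonglongrightarrow> 0" by simp
    show "\<forall>\<^sub>F n in sequentially. norm (\<P>(\<omega> in M n. \<epsilon> < \<bar>(\<Sum>k\<in>K. t k * Y n k \<omega>) - 0\<bar>))
        \<le> (\<Sum>k\<in>K. measure (M n) (?E n k))"
    proof (intro always_eventually allI)
      fix n
      interpret prob_space "M n" by (rule M)
      have ev: "?E n k \<in> events" if "k \<in> K" for k
      proof -
        note [measurable] = Ym[OF that, of n]
        show ?thesis by measurable
      qed
      have "{\<omega> \<in> space (M n). \<epsilon> < \<bar>(\<Sum>k\<in>K. t k * Y n k \<omega>) - 0\<bar>} \<subseteq> (\<Union>k\<in>K. ?E n k)"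
      proof (intro subsetI, rule ccontr)
        fix \<omega> assume \<omega>: "\<omega> \<in> {\<omega> \<in> space (M n). \<epsilon> < \<bar>(\<Sum>k\<in>K. t k * Y n k \<omega>) - 0\<bar>}" "\<omega> \<notin> (\<Union>k\<in>K. ?E n k)"
        have "\<bar>\<Sum>k\<in>K. t k * Y n k \<omega>\<bar> \<le> (\<Sum>k\<in>K. \<bar>t k\<bar> * \<bar>Y n k \<omega>\<bar>)"
          unfolding abs_mult[symmetric] by (rule sum_abs)
        also have "\<dots> \<le> (\<Sum>k\<in>K. \<bar>t k\<bar> * b)"
          using \<omega> by (intro sum_mono mult_left_mono) (auto simp: not_less)
        also have "\<dots> \<le> \<epsilon>" using b(2) by (simp add: sum_distrib_right)
        finally show False using \<omega>(1) by simp
      qed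
      then have "\<P>(\<omega> in M n. \<epsilon> < \<bar>(\<Sum>k\<in>K. t k * Y n k \<omega>) - 0\<bar>) \<le> prob (\<Union>k\<in>K. ?E n k)"
        using ev K by (intro finite_measure_mono sets.finite_UN) auto
      also have "\<dots> \<le> (\<Sum>k\<in>K. prob (?E n k))"
        using ev K by (intro finite_measure_subadditive_finite) auto
      finally show "norm (\<P>(\<omega> in M n. \<epsilon> < \<bar>(\<Sum>k\<in>K. t k * Y n k \<omega>) - 0\<bar>)) \<le> (\<Sum>k\<in>K. prob (?E n k))"
        by simp
    qed
  qed
qed

lemma iexp_diff_le: "cmod (iexp x - iexp y) \<le> \<bar>x - y\<bar>"
proof -
  have "iexp x - iexp y = iexp y * (iexp (x - y) - 1)"
    by (simp add: right_diff_distrib exp_add[symmetric] distrib_left[symmetric])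
  then have "cmod (iexp x - iexp y) = cmod (iexp (x - y) - 1)"
    by (simp only: norm_mult norm_exp_i_times mult_1)
  also have "\<dots> \<le> \<bar>x - y\<bar>" using iexp_approx1[of "x - y" 0] by simp
  finally show ?thesis .
qed

lemma char_tendsto_of_tendsto_in_prob:
  fixes X Y :: "nat \<Rightarrow> 'a \<Rightarrow> real"
  assumes M: "\<And>n. prob_space (M n)"
    and X: "\<And>n. X n \<in> borel_measurable (M n)" and Y: "\<And>n. Y n \<in> borel_measurable (M n)"
    and XY: "tendsto_in_prob M (\<lambda>n \<omega>. X n \<omega> - Y n \<omega>) 0"
    and lim: "(\<lambda>n. \<integral>\<omega>. iexp (Y n \<omega>) \<partial>M n) \<longlonglongrightarrow> z"
  shows "(\<lambda>n. \<integral>\<omega>. iexp (X n \<omega>) \<partial>M n) \<longlonglongrightarrow> z"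
proof -
  have "(\<lambda>n. (\<integral>\<omega>. iexp (X n \<omega>) \<partial>M n) - (\<integral>\<omega>. iexp (Y n \<omega>) \<partial>M n)) \<longlonglongrightarrow> 0"
  proof (rule LIMSEQ_I)
    fix d :: real assume d: "0 < d"
    let ?E = "\<lambda>n. {\<omega> \<in> space (M n). d / 2 < \<bar>X n \<omega> - Y n \<omega> - 0\<bar>}"
    have "0 < d / 2" using d by simp
    then have "(\<lambda>n. measure (M n) (?E n)) \<longlonglongrightarrow> 0" by (rule tendsto_in_probD(2)[OF XY])
    then have "\<forall>\<^sub>F n in sequentially. measure (M n) (?E n) < d / 4"
      by (rule order_tendstoD(2)) (use d in simp)
    then have "\<forall>\<^sub>F n in sequentially. norm ((\<integral>\<omega>. iexp (X n \<omega>) \<partial>M n) - (\<integral>\<omega>. iexp (Y n \<omega>) \<partial>M n) - 0) < d"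
    proof eventually_elim
      case (elim n)
      interpret prob_space "M n" by (rule M)
      note [measurable] = X[of n] Y[of n]
      have int: "integrable (M n) (\<lambda>\<omega>. iexp (X n \<omega>))" "integrable (M n) (\<lambda>\<omega>. iexp (Y n \<omega>))"
        by (auto intro!: integrable_const_bound[where B = 1])
      have "norm ((\<integral>\<omega>. iexp (X n \<omega>) \<partial>M n) - (\<integral>\<omega>. iexp (Y n \<omega>) \<partial>M n)) = norm (\<integral>\<omega>. iexp (X n \<omega>) - iexp (Y n \<omega>) \<partial>M n)"
        using int by simp
      also have "\<dots> \<le> (\<integral>\<omega>. cmod (iexp (X n \<omega>) - iexp (Y n \<omega>)) \<partial>M n)"
        by (rule integral_norm_bound)
      also have "\<dots> \<le> (\<integral>\<omega>. d / 2 + 2 * indicator (?E n) \<omega> \<partial>M n)"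
      proof (rule integral_mono)
        show "integrable (M n) (\<lambda>\<omega>. cmod (iexp (X n \<omega>) - iexp (Y n \<omega>)))"
          using int by (intro integrable_norm Bochner_Integration.integrable_diff)
        have "?E n \<in> events" by measurable
        then show "integrable (M n) (\<lambda>\<omega>. d / 2 + 2 * indicator (?E n) \<omega>)"
          by (auto simp: emeasure_eq_measure)
        fix \<omega> assume \<omega>: "\<omega> \<in> space (M n)"
        show "cmod (iexp (X n \<omega>) - iexp (Y n \<omega>)) \<le> d / 2 + 2 * indicator (?E n) \<omega>"
        proof (cases "\<omega> \<in> ?E n")
          case True
          have "cmod (iexp (X n \<omega>) - iexp (Y n \<omega>)) \<le> cmod (iexp (X n \<omega>)) + cmod (iexp (Y n \<omega>))"
            by (rule norm_triangle_ineq4)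
          then have "cmod (iexp (X n \<omega>) - iexp (Y n \<omega>)) \<le> 2" by (simp only: norm_exp_i_times) 
          then show ?thesis using True d by simp
        next
          case False
          then show ?thesis using iexp_diff_le[of "X n \<omega>" "Y n \<omega>"] \<omega> by simp
        qed
      qed
      also have "\<dots> = d / 2 + 2 * prob (?E n)"
      proof -
        have "?E n \<in> events" by measurable
        then show ?thesis by (subst Bochner_Integration.integral_add) (auto simp: emeasure_eq_measure prob_space)
      qed
      finally show ?case using elim by simp
    qed
    then show "\<exists>no. \<forall>n\<ge>no. norm ((\<integral>\<omega>. iexp (X n \<omega>) \<partial>M n) - (\<integral>\<omega>. iexp (Y n \<omega>) \<partial>M n) - 0) < d"
      by (simp only: eventually_sequentially)
  qed
  from tendsto_add[OF this lim] show ?thesis by simp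
qed

section \<open>Monotone statistics, ranks and ties\<close>

text \<open>
  Monotonicity in each argument is monotonicity for the componentwise order: replace the arguments
  one after the other.
\<close>

lemma nondecreasing_onD:
  assumes L: "finite L" and psi: "nondecreasing_on L \<psi>"
    and xy: "x \<in> L \<rightarrow>\<^sub>E UNIV" "y \<in> L \<rightarrow>\<^sub>E UNIV" "\<And>l. l \<in> L \<Longrightarrow> x l \<le> y l"
  shows "\<psi> x \<le> \<psi> y"
proof -
  have "\<psi> x \<le> \<psi> (\<lambda>l. if l \<in> A then y l else x l)" if "finite A" "A \<subseteq> L" for A
    using that
  proof (induction A rule: finite_induct)
    case empty
    then show ?case by simp
  next
    case (insert a A)
    let ?x = "\<lambda>l. if l \<in> A then y l else x l"
    have "?x \<in> L \<rightarrow>\<^sub>E UNIV" using xy by (auto simp: PiE_def extensional_def)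
    moreover have "?x a \<le> y a" using insert xy(3) by auto
    moreover have "a \<in> L" using insert.prems by simp
    ultimately have "\<psi> ?x \<le> \<psi> (?x(a := y a))"
      using psi[unfolded nondecreasing_on_def, rule_format, of ?x a "y a"] by simp
    also have "?x(a := y a) = (\<lambda>l. if l \<in> insert a A then y l else x l)" by auto
    finally show ?case using insert by simp
  qed
  from this[OF L order_refl] show ?thesis
  proof -
    assume "\<psi> x \<le> \<psi> (\<lambda>l. if l \<in> L then y l else x l)"
    moreover have "(\<lambda>l. if l \<in> L then y l else x l) = y"
      using xy by (auto simp: PiE_def extensional_def)
    ultimately show ?thesis by simp
  qed
qed

text \<open>
  The statistic of flip \<open>j\<close> as a function of the whole array of scores: rejection becomes a subset of the
  space of arrays, and what matters below is the frontier of that subset.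
\<close>

definition flip_stat :: "((nat \<Rightarrow> real) \<Rightarrow> real) \<Rightarrow> nat set \<Rightarrow> nat \<Rightarrow> (nat \<times> nat \<Rightarrow> real) \<Rightarrow> real" where
  "flip_stat \<psi> L j z = \<psi> (\<lambda>l\<in>L. \<bar>z (j, l)\<bar>)"

lemma flip_stat_mono:
  assumes "finite L" "nondecreasing_on L \<psi>" "\<And>l. l \<in> L \<Longrightarrow> \<bar>z (j, l)\<bar> \<le> \<bar>y (i, l)\<bar>"
  shows "flip_stat \<psi> L j z \<le> flip_stat \<psi> L i y"
  unfolding flip_stat_def by (rule nondecreasing_onD[OF assms(1,2)]) (simp_all add: assms(3))

text \<open>
  Multiplying an array by these factors preserves the null sets of the limiting law and moves the
  statistics of flips \<open>i\<close> and \<open>j\<close> monotonically in opposite directions.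
\<close>

definition block_scale :: "nat \<Rightarrow> nat \<Rightarrow> real \<Rightarrow> nat \<times> nat \<Rightarrow> real" where
  "block_scale i j s p = (if fst p = i then s else if fst p = j then 1 / s else 1)"

text \<open>
  The event that flip \<open>i\<close> beats flip \<open>j\<close> is an upper set in the absolute scores of flip \<open>i\<close> and a lower
  set in those of flip \<open>j\<close>.  If the array is multiplied by \<open>block_scale i j s\<close> and \<open>s\<close> grows, the former strictly increase and
  the latter strictly decrease, so the frontier is left as soon as it has been met.  This is
  how monotonicity of \<open>\<psi>\<close> takes the place of continuity.
\<close>

lemma frontier_comparison_once:
  assumes L: "finite L" and psi: "nondecreasing_on L \<psi>" and ij: "i \<noteq> j"
    and nz: "\<And>l. l \<in> L \<Longrightarrow> z (i, l) \<noteq> 0" "\<And>l. l \<in> L \<Longrightarrow> z (j, l) \<noteq> 0"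
    and st: "0 < s" "s < t"
    and fs: "(\<lambda>p. block_scale i j s p * z p) \<in> frontier {z. flip_stat \<psi> L j z < flip_stat \<psi> L i z}"
    and ft: "(\<lambda>p. block_scale i j t p * z p) \<in> frontier {z. flip_stat \<psi> L j z < flip_stat \<psi> L i z}"
  shows False
proof -
  let ?C = "{z. flip_stat \<psi> L j z < flip_stat \<psi> L i z}"
  \<comment> \<open>Any intermediate scale separates neighbourhoods of the two points.\<close>
  define m where "m = (s + t) / 2"
  have m: "s < m" "m < t" "0 < m" "1 / m < 1 / s" "1 / t < 1 / m"
    using st by (auto simp: m_def field_simps)
  have mj: "\<bar>z (j, l)\<bar> / m < \<bar>z (j, l)\<bar> / s" "\<bar>z (j, l)\<bar> / t < \<bar>z (j, l)\<bar> / m" if "l \<in> L" for l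
    using m st nz(2)[OF that] by (auto intro!: divide_strict_left_mono)
  let ?a = "\<lambda>l. m * \<bar>z (i, l)\<bar>" and ?b = "\<lambda>l. 1 / m * \<bar>z (j, l)\<bar>"
  define V1 where "V1 = (\<Inter>l\<in>L. {y. \<bar>y (i, l)\<bar> < ?a l} \<inter> {y. ?b l < \<bar>y (j, l)\<bar>})"
  define V2 where "V2 = (\<Inter>l\<in>L. {y. ?a l < \<bar>y (i, l)\<bar>} \<inter> {y. \<bar>y (j, l)\<bar> < ?b l})"
  have open_V: "open V1" "open V2"
    unfolding V1_def V2_def using L
    by (intro open_INT ballI open_Int open_Collect_less continuous_on_const
        continuous_on_rabs continuous_on_product_coordinates; simp)+
  have "(\<lambda>p. block_scale i j s p * z p) \<in> V1"
    using m mj nz ij st by (auto simp: V1_def block_scale_def abs_mult)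
  then have "V1 \<inter> ?C \<noteq> {}"
    using fs open_Int_closure_eq_empty[OF open_V(1), of ?C] by (auto simp: frontier_def)
  then obtain y where y: "y \<in> V1" "flip_stat \<psi> L j y < flip_stat \<psi> L i y" by auto
  have "(\<lambda>p. block_scale i j t p * z p) \<in> V2"
    using m mj nz ij st by (auto simp: V2_def block_scale_def abs_mult)
  then have "\<not> V2 \<subseteq> ?C"
    using ft interior_maximal[OF _ open_V(2), of ?C] by (auto simp: frontier_def)
  then obtain y' where y': "y' \<in> V2" "\<not> flip_stat \<psi> L j y' < flip_stat \<psi> L i y'" by auto
  have "flip_stat \<psi> L i y \<le> flip_stat \<psi> L i y'"
    using y(1) y'(1) by (intro flip_stat_mono[OF L psi]) (fastforce simp: V1_def V2_def)
  moreover have "flip_stat \<psi> L j y' \<le> flip_stat \<psi> L j y"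
    using y(1) y'(1) by (intro flip_stat_mono[OF L psi]) (fastforce simp: V1_def V2_def)
  ultimately show False using y(2) y'(2) by linarith
qed

text \<open>
  Along the same curve the statistic of flip \<open>i\<close> strictly increases and that of flip \<open>j\<close> strictly
  decreases, so they agree at most once.
\<close>

lemma tie_once:
  assumes psi: "jointly_increasing_on L \<psi>" and ij: "i \<noteq> j"
    and nz: "\<And>l. l \<in> L \<Longrightarrow> z (i, l) \<noteq> 0" "\<And>l. l \<in> L \<Longrightarrow> z (j, l) \<noteq> 0"
    and st: "0 < s" "s < t"
    and ts: "flip_stat \<psi> L j (\<lambda>p. block_scale i j s p * z p) = flip_stat \<psi> L i (\<lambda>p. block_scale i j s p * z p)"
    and tt: "flip_stat \<psi> L j (\<lambda>p. block_scale i j t p * z p) = flip_stat \<psi> L i (\<lambda>p. block_scale i j t p * z p)"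
  shows False
proof -
  have "flip_stat \<psi> L i (\<lambda>p. block_scale i j s p * z p) < flip_stat \<psi> L i (\<lambda>p. block_scale i j t p * z p)"
    using psi st nz unfolding flip_stat_def jointly_increasing_on_def
    by (auto simp: block_scale_def abs_mult)
  moreover have "flip_stat \<psi> L j (\<lambda>p. block_scale i j t p * z p) < flip_stat \<psi> L j (\<lambda>p. block_scale i j s p * z p)"
    using psi st nz ij unfolding flip_stat_def jointly_increasing_on_def
    by (auto simp: block_scale_def abs_mult divide_strict_left_mono)
  ultimately show False using ts tt by linarith
qed

text \<open>
  Off the frontiers of finitely many sets, membership in all of them is constant near a point; hence
  every Boolean combination of the sets has its frontier in the union of theirs.
\<close>

lemma locally_constant_off_frontiers:
  assumes "finite J" "\<And>j. j \<in> J \<Longrightarrow> z \<notin> frontier (S j)"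
  obtains V where "open V" "z \<in> V" "\<And>y j. y \<in> V \<Longrightarrow> j \<in> J \<Longrightarrow> y \<in> S j \<longleftrightarrow> z \<in> S j"
proof -
  define V where "V = (\<Inter>j\<in>J. if z \<in> S j then interior (S j) else interior (- S j))"
  have z: "z \<in> (if z \<in> S j then interior (S j) else interior (- S j))" if "j \<in> J" for j
  proof (cases "z \<in> S j")
    case True
    then show ?thesis using assms(2)[OF that] closure_subset[of "S j"] by (auto simp: frontier_def)
  next
    case False
    then have "z \<notin> closure (S j)"
      using assms(2)[OF that] interior_subset[of "S j"] by (auto simp: frontier_def)
    then show ?thesis using False by (simp add: interior_complement)
  qed
  show thesis
  proof
    show "open V" unfolding V_def using assms(1) by (intro open_INT ballI) auto
    show "z \<in> V" unfolding V_def using z by (intro INT_I)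
    show "y \<in> S j \<longleftrightarrow> z \<in> S j" if "y \<in> V" "j \<in> J" for y j
    proof -
      have "y \<in> (if z \<in> S j then interior (S j) else interior (- S j))"
        using that unfolding V_def by (rule INT_D)
      then show ?thesis using interior_subset[of "S j"] interior_subset[of "- S j"]
        by (auto split: if_splits)
    qed
  qed
qed

lemma not_frontierI:
  assumes "open V" "z \<in> V" "\<And>y. y \<in> V \<Longrightarrow> y \<in> S \<longleftrightarrow> z \<in> S"
  shows "z \<notin> frontier S"
proof (cases "z \<in> S")
  case True
  then have "V \<subseteq> S" using assms(3) by blast
  then have "z \<in> interior S" using assms(1,2) interior_maximal by blast
  then show ?thesis by (simp add: frontier_def)
next
  case False
  then have "V \<inter> S = {}" using assms(3) by blast
  then have "z \<notin> closure S" using assms(1,2) open_Int_closure_eq_empty by blast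
  then show ?thesis by (simp add: frontier_def)
qed

lemma sorted_nth_less_iff:
  fixes xs :: "'b::linorder list"
  assumes "sorted xs" "i < length xs"
  shows "xs ! i < x \<longleftrightarrow> i < length (filter (\<lambda>y. y < x) xs)"
  using assms
proof (induction xs arbitrary: i)
  case (Cons a xs)
  show ?case
  proof (cases "a < x")
    case True
    then show ?thesis using Cons by (cases i) auto
  next
    case False
    have "\<not> y < x" if "y \<in> set (a # xs)" for y using Cons.prems(1) False that by force
    then have "filter (\<lambda>y. y < x) (a # xs) = []" "\<not> (a # xs) ! i < x"
      using nth_mem[OF Cons.prems(2)] by (simp_all only: filter_empty_conv) blast+
    then show ?thesis by simp
  qed
qed simp

text \<open>
  This turns rejection into a statement about the rank of the first statistic, which involves
  comparisons of pairs only.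
\<close>

lemma order_stat_less_iff:
  assumes "1 \<le> k" "k \<le> w"
  shows "order_stat w t k < x \<longleftrightarrow> k \<le> card {j \<in> {1..w}. t j < x}"
proof -
  let ?xs = "map t [1..<w + 1]"
  have "length (filter (\<lambda>y. y < x) (sort ?xs)) = length (filter (\<lambda>y. y < x) ?xs)"
    by (metis filter_sort length_sort)
  also have "\<dots> = length (filter (\<lambda>j. t j < x) [1..<w + 1])"
    by (simp add: filter_map comp_def)
  also have "\<dots> = card (set (filter (\<lambda>j. t j < x) [1..<w + 1]))"
    by (rule distinct_card[symmetric], rule distinct_filter, rule distinct_upt)
  also have "set (filter (\<lambda>j. t j < x) [1..<w + 1]) = {j \<in> {1..w}. t j < x}"
    by auto
  finally have "length (filter (\<lambda>y. y < x) (sort ?xs)) = card {j \<in> {1..w}. t j < x}" .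
  then show ?thesis
    using assms sorted_nth_less_iff[of "sort ?xs" "k - 1" x] unfolding order_stat_def by auto
qed

text \<open>
  Let \<open>m\<close> minimize \<open>T\<close> among the indices of high rank.  The at least \<open>k\<close> indices with a smaller value
  than \<open>T m\<close> are not of high rank themselves.
\<close>

lemma card_high_rank_le:
  fixes T :: "'j \<Rightarrow> real"
  assumes A: "finite A"
  shows "card {i \<in> A. k \<le> card {j \<in> A. T j < T i}} \<le> card A - k"
proof (cases "{i \<in> A. k \<le> card {j \<in> A. T j < T i}} = {}")
  case False
  let ?R = "{i \<in> A. k \<le> card {j \<in> A. T j < T i}}"
  have "finite ?R" using A by simp
  then obtain m where m: "m \<in> ?R" "\<And>i. i \<in> ?R \<Longrightarrow> T m \<le> T i"
    using False arg_min_if_finite(1)[of ?R T] arg_min_least[of ?R _ T] by blast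
  have "?R \<subseteq> A - {j \<in> A. T j < T m}" using m(2) by force
  then have "card ?R \<le> card (A - {j \<in> A. T j < T m})" using A by (intro card_mono) auto
  also have "\<dots> = card A - card {j \<in> A. T j < T m}" using A by (intro card_Diff_subset) auto
  also have "\<dots> \<le> card A - k" using m(1) by auto
  finally show ?thesis .
next
  case True
  show ?thesis unfolding True by simp
qed

text \<open>
  Without ties the ranks run through \<open>{..<card A}\<close> exactly once.
\<close>

lemma card_high_rank_eq:
  fixes T :: "'j \<Rightarrow> real"
  assumes A: "finite A" and inj: "inj_on T A"
  shows "card {i \<in> A. k \<le> card {j \<in> A. T j < T i}} = card A - k"
proof -
  define rk where "rk i = card {j \<in> A. T j < T i}" for i
  have less: "rk i < rk i'" if "i \<in> A" "T i < T i'" for i i'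
    unfolding rk_def using A that by (intro psubset_card_mono) auto
  have inj_rk: "inj_on rk A"
  proof (rule inj_onI)
    fix i i' assume "i \<in> A" "i' \<in> A" "rk i = rk i'"
    then show "i = i'"
      using less[of i i'] less[of i' i] inj_onD[OF inj, of i i'] by (cases "T i" "T i'" rule: linorder_cases) auto
  qed
  have "rk ` A \<subseteq> {..<card A}"
  proof
    fix r assume "r \<in> rk ` A"
    then obtain i where "i \<in> A" "r = rk i" by auto
    moreover from this have "rk i < card A" unfolding rk_def using A by (intro psubset_card_mono) auto
    ultimately show "r \<in> {..<card A}" by simp
  qed
  then have im: "rk ` A = {..<card A}"
    using A inj_rk by (intro card_subset_eq) (auto simp: card_image)
  have "card {i \<in> A. k \<le> rk i} = card (rk ` {i \<in> A. k \<le> rk i})"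
    using inj_rk by (intro card_image[symmetric]) (auto intro: inj_on_subset)
  also have "rk ` {i \<in> A. k \<le> rk i} = {r \<in> rk ` A. k \<le> r}" by auto
  also have "\<dots> = {k..<card A}" unfolding im by auto
  finally show ?thesis by (simp add: rk_def)
qed

section \<open>The limiting rejection probability\<close>

text \<open>
  The probabilistic situation of the test in the limit: the array of scores, with one row per flip,
  is asymptotically Gaussian, its rows are independent and each of them has covariance matrix \<open>R\<close>.
  The diagonal of \<open>R\<close> is positive, but the matrix may be singular.
\<close>

locale flip_limit =
  fixes w :: nat and L :: "nat set" and \<psi> :: "(nat \<Rightarrow> real) \<Rightarrow> real" and R :: "nat \<Rightarrow> nat \<Rightarrow> real"
    and M :: "nat \<Rightarrow> 'a measure" and X :: "nat \<Rightarrow> 'a \<Rightarrow> nat \<times> nat \<Rightarrow> real"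
  assumes w: "1 \<le> w" and L: "finite L" and psi: "nondecreasing_on L \<psi>"
    and R_sym: "\<And>k l. k \<in> L \<Longrightarrow> l \<in> L \<Longrightarrow> R k l = R l k"
    and R_psd: "\<And>x. 0 \<le> (\<Sum>k\<in>L. \<Sum>l\<in>L. x k * x l * R k l)"
    and R_pos: "\<And>l. l \<in> L \<Longrightarrow> 0 < R l l"
    and M: "\<And>n. prob_space (M n)"
    and X: "\<And>n k. k \<in> {1..w} \<times> L \<Longrightarrow> (\<lambda>\<omega>. X n \<omega> k) \<in> borel_measurable (M n)"
    and X0: "\<And>n \<omega> k. k \<notin> {1..w} \<times> L \<Longrightarrow> X n \<omega> k = 0"
    and stat: "\<And>n j. j \<in> {1..w} \<Longrightarrow> (\<lambda>\<omega>. flip_stat \<psi> L j (X n \<omega>)) \<in> borel_measurable (M n)"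
    and char_X: "\<And>t. (\<lambda>n. \<integral>\<omega>. iexp (\<Sum>k\<in>{1..w} \<times> L. t k * X n \<omega> k) \<partial>M n)
      \<longlonglongrightarrow> of_real (exp (- (\<Sum>j\<in>{1..w}. \<Sum>k\<in>L. \<Sum>l\<in>L. t (j, k) * t (j, l) * R k l) / 2))"
begin

abbreviation "K \<equiv> {1..w} \<times> L"

text \<open>
  A factor \<open>A\<close> with \<open>R = A A\<^sup>T\<close>; it writes the limiting scores as linear combinations of
  independent standard normal variables.
\<close>

definition loading :: "nat \<Rightarrow> nat \<Rightarrow> real" where
  "loading = (SOME a. \<forall>k\<in>L. \<forall>l\<in>L. R k l = (\<Sum>r\<in>L. a k r * a l r))"

lemma loading: "k \<in> L \<Longrightarrow> l \<in> L \<Longrightarrow> R k l = (\<Sum>r\<in>L. loading k r * loading l r)"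
  using someI_ex[OF psd_gram[OF L R_sym R_psd]] unfolding loading_def by blast

abbreviation "G \<equiv> gauss_vec K"

definition Z :: "(nat \<times> nat \<Rightarrow> real) \<Rightarrow> nat \<times> nat \<Rightarrow> real" where
  "Z z k = (if k \<in> K then \<Sum>r\<in>L. loading (snd k) r * z (fst k, r) else 0)"

sublocale G: prob_space G by (rule prob_space_gauss_vec)

lemma finite_K: "finite K" using L by simp

lemma coordinate_measurable: "p \<in> K \<Longrightarrow> (\<lambda>z. z p) \<in> borel_measurable G"
  using measurable_component_singleton[of p K "\<lambda>_. std_normal_distribution"] by simp

lemma Z_measurable: "(\<lambda>z. Z z k) \<in> borel_measurable G"
proof (cases "k \<in> K")
  case True
  then show ?thesis
    by (auto simp: Z_def intro!: borel_measurable_sum borel_measurable_times coordinate_measurable)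
qed (simp add: Z_def)

lemma Z_borel: "Z \<in> borel_measurable G"
  by (rule measurable_coordinatewise_then_product) (rule Z_measurable)

lemma char_Z:
  "(\<integral>z. iexp (\<Sum>k\<in>K. t k * Z z k) \<partial>G)
    = of_real (exp (- (\<Sum>j\<in>{1..w}. \<Sum>k\<in>L. \<Sum>l\<in>L. t (j, k) * t (j, l) * R k l) / 2))"
proof -
  define c where "c p = (\<Sum>l\<in>L. t (fst p, l) * loading l (snd p))" for p
  have lin: "(\<Sum>k\<in>K. t k * Z z k) = (\<Sum>p\<in>K. c p * z p)" for z
  proof -
    have "(\<Sum>k\<in>K. t k * Z z k) = (\<Sum>j\<in>{1..w}. \<Sum>l\<in>L. t (j, l) * (\<Sum>r\<in>L. loading l r * z (j, r)))"
      by (subst sum.cartesian_product') (simp add: Z_def)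
    also have "\<dots> = (\<Sum>j\<in>{1..w}. \<Sum>r\<in>L. (\<Sum>l\<in>L. t (j, l) * loading l r) * z (j, r))"
      unfolding sum_distrib_left sum_distrib_right by (subst sum.swap) (simp add: mult_ac)
    also have "\<dots> = (\<Sum>p\<in>K. c p * z p)"
      by (subst sum.cartesian_product') (simp add: c_def)
    finally show ?thesis .
  qed
  have "(\<Sum>p\<in>K. (c p)\<^sup>2) = (\<Sum>j\<in>{1..w}. \<Sum>r\<in>L. (c (j, r))\<^sup>2)"
    by (rule sum.cartesian_product')
  also have "\<dots> = (\<Sum>j\<in>{1..w}. \<Sum>k\<in>L. \<Sum>l\<in>L. t (j, k) * t (j, l) * R k l)"
  proof (rule sum.cong[OF refl])
    fix j
    have "(\<Sum>r\<in>L. (c (j, r))\<^sup>2)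
        = (\<Sum>r\<in>L. \<Sum>k\<in>L. \<Sum>l\<in>L. t (j, k) * t (j, l) * (loading k r * loading l r))"
      by (simp add: c_def power2_eq_square sum_product mult_ac)
    also have "\<dots> = (\<Sum>k\<in>L. \<Sum>l\<in>L. \<Sum>r\<in>L. t (j, k) * t (j, l) * (loading k r * loading l r))"
      by (subst sum.swap, rule sum.cong[OF refl], rule sum.swap)
    also have "\<dots> = (\<Sum>k\<in>L. \<Sum>l\<in>L. t (j, k) * t (j, l) * R k l)"
      by (intro sum.cong refl) (simp add: loading sum_distrib_left)
    finally show "(\<Sum>r\<in>L. (c (j, r))\<^sup>2) = (\<Sum>k\<in>L. \<Sum>l\<in>L. t (j, k) * t (j, l) * R k l)" .
  qed
  finally show ?thesis unfolding lin char_gauss_vec[OF finite_K] by simp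
qed

sublocale char_convergence K M X G Z
proof (rule char_convergence.intro)
  show "finite K" by (rule finite_K)
  show "prob_space (M n)" for n by (rule M)
  show "prob_space G" by (rule G.prob_space_axioms)
  show "(\<lambda>\<omega>. X n \<omega> k) \<in> borel_measurable (M n)" if "k \<in> K" for n k using that by (rule X)
  show "(\<lambda>z. Z z k) \<in> borel_measurable G" for k by (rule Z_measurable)
  show "X n \<omega> k = 0" if "k \<notin> K" for n \<omega> k using that by (rule X0)
  show "Z z k = 0" if "k \<notin> K" for z k using that by (simp add: Z_def)
  show "(\<lambda>n. \<integral>\<omega>. iexp (\<Sum>k\<in>K. t k * X n \<omega> k) \<partial>M n) \<longlonglongrightarrow> (\<integral>z. iexp (\<Sum>k\<in>K. t k * Z z k) \<partial>G)" for t
    unfolding char_Z by (rule char_X)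
qed

text \<open>
  Some loading of model \<open>l\<close> is nonzero because \<open>R l l > 0\<close>, and rescaling that one normal coordinate
  moves the score strictly, so that it vanishes for at most one scale.
\<close>

lemma AE_Z_nonzero: "AE z in G. \<forall>k\<in>K. Z z k \<noteq> 0"
proof (rule AE_finite_allI[OF finite_K])
  fix k assume k: "k \<in> K"
  obtain j l where jl: "k = (j, l)" "j \<in> {1..w}" "l \<in> L" using k by auto
  have "\<exists>r\<in>L. loading l r \<noteq> 0"
  proof (rule ccontr)
    assume "\<not> ?thesis"
    then have "(\<Sum>r\<in>L. loading l r * loading l r) = 0" by (intro sum.neutral) auto
    then show False using R_pos[OF jl(3)] loading[OF jl(3) jl(3)] by linarith
  qed
  then obtain r where r: "r \<in> L" "loading l r \<noteq> 0" by blast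
  have jr: "(j, r) \<in> K" using jl r by simp
  \<comment> \<open>Scales the single normal coordinate that belongs to flip \<open>j\<close> and factor \<open>r\<close>.\<close>
  define c where "c s p = (if p = (j, r) then s else 1)" for s :: real and p :: "nat \<times> nat"
  have scaled: "Z (\<lambda>p\<in>K. c s p * z p) k = Z z k + (s - 1) * (loading l r * z (j, r))" for s z
  proof -
    have "Z (\<lambda>p\<in>K. c s p * z p) k = (\<Sum>q\<in>L. loading l q * (c s (j, q) * z (j, q)))"
      using jl by (simp add: Z_def)
    also have "\<dots> = (\<Sum>q\<in>L. loading l q * z (j, q) + (if q = r then (s - 1) * (loading l r * z (j, r)) else 0))"
      by (intro sum.cong refl) (simp add: c_def algebra_simps)
    also have "\<dots> = Z z k + (s - 1) * (loading l r * z (j, r))"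
      using jl r L by (simp add: Z_def sum.distrib)
    finally show ?thesis .
  qed
  have "AE x in std_normal_distribution. x \<noteq> (0::real)"
    by (subst AE_std_normal_iff) (auto intro: AE_lborel_singleton)
  then have z0: "AE z in G. z (j, r) \<noteq> 0"
    by (intro AE_PiM_component[OF _ jr] prob_space_normal_density) auto
  show "AE z in G. Z z k \<noteq> 0"
  proof (rule gauss_vec_null_of_scaling[OF finite_K, where c = c])
    show "c s p \<noteq> 0" if "s \<in> {1..2}" for s p using that by (auto simp: c_def)
    show "Measurable.pred G (\<lambda>z. Z z k = 0)" using Z_measurable[of k] by measurable
    show "AE z in G. \<forall>s\<in>{1..2}. \<forall>t\<in>{1..2}. Z (\<lambda>p\<in>K. c s p * z p) k = 0
        \<longrightarrow> Z (\<lambda>p\<in>K. c t p * z p) k = 0 \<longrightarrow> s = t"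
      using z0
    proof eventually_elim
      case (elim z)
      show ?case unfolding scaled
      proof (intro ballI impI)
        fix s t :: real
        assume "Z z k + (s - 1) * (loading l r * z (j, r)) = 0" "Z z k + (t - 1) * (loading l r * z (j, r)) = 0"
        then have "(s - 1) * (loading l r * z (j, r)) = (t - 1) * (loading l r * z (j, r))" by linarith
        then show "s = t" using elim r by simp
      qed
    qed
  qed
qed

lemma Z_block_scale:
  "Z (\<lambda>p\<in>K. block_scale i j s p * z p) = (\<lambda>k. block_scale i j s k * Z z k)"
proof
  fix k
  show "Z (\<lambda>p\<in>K. block_scale i j s p * z p) k = block_scale i j s k * Z z k"
    by (cases k) (simp add: Z_def block_scale_def sum_distrib_left mult_ac)
qed

text \<open>
  Since \<open>Z\<close> is linear and acts on each row separately, rescaling the rows of the underlying normal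
  variables rescales the rows of \<open>Z\<close>.  The law of \<open>Z\<close> can be singular; the rescaled
  arrays stay in its support nevertheless, because that support is a product of linear
  subspaces, one for each row.
\<close>

lemma AE_not_of_scaling:
  assumes ij: "i \<in> {1..w}" "j \<in> {1..w}" "i \<noteq> j" and S: "S \<in> sets borel"
    and once: "\<And>x s t. (\<And>l. l \<in> L \<Longrightarrow> x (i, l) \<noteq> 0) \<Longrightarrow> (\<And>l. l \<in> L \<Longrightarrow> x (j, l) \<noteq> 0)
      \<Longrightarrow> 0 < s \<Longrightarrow> s < t \<Longrightarrow> (\<lambda>p. block_scale i j s p * x p) \<in> S
      \<Longrightarrow> (\<lambda>p. block_scale i j t p * x p) \<in> S \<Longrightarrow> False"
  shows "AE z in G. Z z \<notin> S"
proof (rule gauss_vec_null_of_scaling[OF finite_K, where c = "block_scale i j"])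
  show "block_scale i j s p \<noteq> 0" if "s \<in> {1..2}" for s p using that by (auto simp: block_scale_def)
  show "Measurable.pred G (\<lambda>z. Z z \<in> S)" using Z_borel S by measurable
  show "AE z in G. \<forall>s\<in>{1..2}. \<forall>t\<in>{1..2}. Z (\<lambda>p\<in>K. block_scale i j s p * z p) \<in> S
      \<longrightarrow> Z (\<lambda>p\<in>K. block_scale i j t p * z p) \<in> S \<longrightarrow> s = t"
    using AE_Z_nonzero
  proof eventually_elim
    case (elim z)
    have nz: "Z z (i, l) \<noteq> 0" "Z z (j, l) \<noteq> 0" if "l \<in> L" for l using elim ij that by auto
    show ?case unfolding Z_block_scale
    proof (intro ballI impI)
      fix s t :: real
      assume *: "s \<in> {1..2}" "t \<in> {1..2}" "(\<lambda>k. block_scale i j s k * Z z k) \<in> S"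
        "(\<lambda>k. block_scale i j t k * Z z k) \<in> S"
      then have "0 < s" "0 < t" by auto
      then show "s = t"
        using once[OF nz, of s t] once[OF nz, of t s] * by (cases s t rule: linorder_cases) auto
    qed
  qed
qed

definition below :: "nat \<Rightarrow> nat \<Rightarrow> (nat \<times> nat \<Rightarrow> real) set" where
  "below j i = {x. flip_stat \<psi> L j x < flip_stat \<psi> L i x}"

definition tied :: "nat \<Rightarrow> nat \<Rightarrow> (nat \<times> nat \<Rightarrow> real) set" where
  "tied j i = {x. flip_stat \<psi> L j x = flip_stat \<psi> L i x}"

text \<open>
  For \<open>i = 1\<close> this is the rejection region in the space of score arrays.
\<close>

definition high_rank :: "nat \<Rightarrow> nat \<Rightarrow> (nat \<times> nat \<Rightarrow> real) set" where
  "high_rank k i = {x. k \<le> card {j \<in> {1..w}. flip_stat \<psi> L j x < flip_stat \<psi> L i x}}"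

lemma AE_not_frontier_below:
  "AE z in G. \<forall>p\<in>{1..w} \<times> {1..w}. Z z \<notin> frontier (below (fst p) (snd p))"
proof (rule AE_finite_allI)
  fix p assume p: "p \<in> {1..w} \<times> {1..w}"
  obtain j i where ji: "p = (j, i)" "j \<in> {1..w}" "i \<in> {1..w}" using p by auto
  show "AE z in G. Z z \<notin> frontier (below (fst p) (snd p))"
  proof (cases "j = i")
    case True
    then show ?thesis using ji by (simp add: below_def)
  next
    case False
    show ?thesis unfolding ji below_def fst_conv snd_conv
    proof (rule AE_not_of_scaling[of i j])
      show "frontier {x. flip_stat \<psi> L j x < flip_stat \<psi> L i x} \<in> sets borel"
        by (intro borel_closed frontier_closed)
    qed (use ji False frontier_comparison_once[OF L psi, of i j] in blast)+
  qed
qed simp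

lemma not_frontier_high_rank:
  assumes "\<forall>p\<in>{1..w} \<times> {1..w}. x \<notin> frontier (below (fst p) (snd p))" "i \<in> {1..w}"
  shows "x \<notin> frontier (high_rank k i)"
proof -
  obtain V where V: "open V" "x \<in> V" "\<And>y j. y \<in> V \<Longrightarrow> j \<in> {1..w} \<Longrightarrow> y \<in> below j i \<longleftrightarrow> x \<in> below j i"
    using locally_constant_off_frontiers[of "{1..w}" x "\<lambda>j. below j i"] assms by auto
  have "y \<in> high_rank k i \<longleftrightarrow> x \<in> high_rank k i" if "y \<in> V" for y
  proof -
    have "{j \<in> {1..w}. flip_stat \<psi> L j y < flip_stat \<psi> L i y} = {j \<in> {1..w}. flip_stat \<psi> L j x < flip_stat \<psi> L i x}"
      using V(3)[OF that] by (auto simp: below_def)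
    then show ?thesis by (simp add: high_rank_def)
  qed
  then show ?thesis by (rule not_frontierI[OF V(1,2)])
qed

text \<open>
  A tie at a point off both frontiers persists in a whole neighbourhood.  Thus ties in the limit come
  from flat stretches of \<open>\<psi>\<close> and show up as ties for large \<open>n\<close> as well.
\<close>

lemma in_interior_tied:
  assumes fr: "x \<notin> frontier (below j i)" "x \<notin> frontier (below i j)" and x: "x \<in> tied j i"
  shows "x \<in> interior (tied j i)"
proof -
  obtain V where V: "open V" "x \<in> V"
    "\<And>y S. y \<in> V \<Longrightarrow> S \<in> {below j i, below i j} \<Longrightarrow> y \<in> S \<longleftrightarrow> x \<in> S"
    using locally_constant_off_frontiers[of "{below j i, below i j}" x "\<lambda>S. S"] fr by auto
  have "V \<subseteq> tied j i"
  proof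
    fix y assume y: "y \<in> V"
    then show "y \<in> tied j i" using V(3)[OF y, of "below j i"] V(3)[OF y, of "below i j"] x
      by (auto simp: below_def tied_def)
  qed
  then show ?thesis using V(2) interior_maximal[OF _ V(1)] by blast
qed

definition swap :: "nat \<Rightarrow> nat \<Rightarrow> (nat \<times> nat \<Rightarrow> real) \<Rightarrow> nat \<times> nat \<Rightarrow> real" where
  "swap i i' x k = x (Transposition.transpose i i' (fst k), snd k)"

lemma swap_high_rank:
  assumes "i \<in> {1..w}" "i' \<in> {1..w}"
  shows "swap i i' x \<in> high_rank k i \<longleftrightarrow> x \<in> high_rank k i'"
proof -
  let ?\<tau> = "Transposition.transpose i i'"
  have st: "flip_stat \<psi> L j (swap i i' x) = flip_stat \<psi> L (?\<tau> j) x" for j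
    by (simp add: flip_stat_def swap_def)
  have bij: "bij_betw ?\<tau> {1..w} {1..w}"
    by (rule bij_betw_transpose_iff) (simp only: assms)
  have "{j \<in> {1..w}. flip_stat \<psi> L j x < flip_stat \<psi> L i' x}
      = ?\<tau> ` {j \<in> {1..w}. flip_stat \<psi> L (?\<tau> j) x < flip_stat \<psi> L i' x}"
  proof (intro equalityI subsetI)
    fix j assume j: "j \<in> {j \<in> {1..w}. flip_stat \<psi> L j x < flip_stat \<psi> L i' x}"
    then have "?\<tau> j \<in> {1..w}" using bij by (auto simp: bij_betw_def)
    then show "j \<in> ?\<tau> ` {j \<in> {1..w}. flip_stat \<psi> L (?\<tau> j) x < flip_stat \<psi> L i' x}"
      using j by (intro image_eqI[of _ _ "?\<tau> j"]) auto
  next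
    fix j assume "j \<in> ?\<tau> ` {j \<in> {1..w}. flip_stat \<psi> L (?\<tau> j) x < flip_stat \<psi> L i' x}"
    then obtain j' where "j = ?\<tau> j'" "j' \<in> {1..w}" "flip_stat \<psi> L (?\<tau> j') x < flip_stat \<psi> L i' x" by auto
    then show "j \<in> {j \<in> {1..w}. flip_stat \<psi> L j x < flip_stat \<psi> L i' x}" using bij by (auto simp: bij_betw_def)
  qed
  then have "card {j \<in> {1..w}. flip_stat \<psi> L j x < flip_stat \<psi> L i' x}
      = card {j \<in> {1..w}. flip_stat \<psi> L (?\<tau> j) x < flip_stat \<psi> L i' x}"
    by (simp add: card_image inj_on_subset[OF inj_transpose])
  then show ?thesis by (simp add: high_rank_def st)
qed

text \<open>
  Exchangeability of the flips in the limit.  Exchanging rows of \<open>Z\<close> leaves its characteristic function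
  unchanged, so the portmanteau theorem applies to the constant sequence of exchanged vectors and
  compares the probabilities of open sets.  The statement speaks of interiors because \<open>high_rank k i\<close> need not be measurable.
\<close>

lemma prob_high_rank_le:
  assumes i: "i \<in> {1..w}" "i' \<in> {1..w}"
  shows "\<P>(z in G. Z z \<in> interior (high_rank k i))
    \<le> \<P>(z in G. Z z \<in> interior (high_rank k i'))"
proof -
  let ?\<tau> = "Transposition.transpose i i'"
  have bij: "bij_betw ?\<tau> {1..w} {1..w}"
    by (rule bij_betw_transpose_iff) (simp only: i)
  have \<tau>: "?\<tau> j \<in> {1..w} \<longleftrightarrow> j \<in> {1..w}" for j
    using i by (auto simp: Transposition.transpose_def)
  have char: "(\<integral>z. iexp (\<Sum>k\<in>K. t k * swap i i' (Z z) k) \<partial>G) = (\<integral>z. iexp (\<Sum>k\<in>K. t k * Z z k) \<partial>G)" for t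
  proof -
    define u where "u k = t (?\<tau> (fst k), snd k)" for k :: "nat \<times> nat"
    have "(\<Sum>k\<in>K. t k * x (?\<tau> (fst k), snd k)) = (\<Sum>k\<in>K. u k * x k)" for x :: "nat \<times> nat \<Rightarrow> real"
      by (rule sum.reindex_bij_witness[of _ "\<lambda>k. (?\<tau> (fst k), snd k)" "\<lambda>k. (?\<tau> (fst k), snd k)"])
        (auto simp: u_def \<tau> simp del: atLeastAtMost_iff One_nat_def)
    then have "(\<integral>z. iexp (\<Sum>k\<in>K. t k * swap i i' (Z z) k) \<partial>G) = (\<integral>z. iexp (\<Sum>k\<in>K. u k * Z z k) \<partial>G)"
      by (simp add: swap_def del: of_real_sum)
    also have "(\<Sum>j\<in>{1..w}. \<Sum>k\<in>L. \<Sum>l\<in>L. u (j, k) * u (j, l) * R k l)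
        = (\<Sum>j\<in>{1..w}. \<Sum>k\<in>L. \<Sum>l\<in>L. t (j, k) * t (j, l) * R k l)"
      unfolding u_def fst_conv snd_conv
      by (rule sum.reindex_bij_betw[OF bij, where g = "\<lambda>j. \<Sum>k\<in>L. \<Sum>l\<in>L. t (j, k) * t (j, l) * R k l"])
    then have "(\<integral>z. iexp (\<Sum>k\<in>K. u k * Z z k) \<partial>G) = (\<integral>z. iexp (\<Sum>k\<in>K. t k * Z z k) \<partial>G)"
      unfolding char_Z by simp
    finally show ?thesis .
  qed
  \<comment> \<open>A constant sequence converges to everything with the same characteristic function.\<close>
  interpret swapped: char_convergence K "\<lambda>_. G" "\<lambda>_ z. swap i i' (Z z)" G Z
  proof (rule char_convergence.intro)
    show "finite K" by (rule finite_K)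
    show "prob_space G" "prob_space G" by (rule G.prob_space_axioms)+
    show "(\<lambda>z. swap i i' (Z z) k) \<in> borel_measurable G" for k
      unfolding swap_def by (rule Z_measurable)
    show "(\<lambda>z. Z z k) \<in> borel_measurable G" for k by (rule Z_measurable)
    show "Z z k = 0" if "k \<notin> K" for z k using that by (simp add: Z_def)
    show "swap i i' (Z z) k = 0" if "k \<notin> K" for z k
    proof -
      have "(?\<tau> (fst k), snd k) \<notin> K"
        using that \<tau>[of "fst k"] by (simp only: mem_Times_iff fst_conv snd_conv simp_thms)
      then show ?thesis by (simp only: swap_def Z_def if_False)
    qed
    show "(\<lambda>n. \<integral>z. iexp (\<Sum>k\<in>K. t k * swap i i' (Z z) k) \<partial>G) \<longlonglongrightarrow> (\<integral>z. iexp (\<Sum>k\<in>K. t k * Z z k) \<partial>G)" for t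
      unfolding char by (rule tendsto_const)
  qed
  have cont: "continuous_on UNIV (swap i i')"
    by (rule continuous_on_coordinatewise_then_product) (simp add: swap_def)
  have "open (swap i i' -` interior (high_rank k i))"
    by (intro open_vimage[OF open_interior cont])
  moreover have "swap i i' -` interior (high_rank k i) \<subseteq> high_rank k i'"
    using interior_subset[of "high_rank k i"] swap_high_rank[OF i] by blast
  ultimately have sub: "swap i i' -` interior (high_rank k i) \<subseteq> interior (high_rank k i')"
    by (rule interior_maximal[rotated])
  have ev: "{z \<in> space G. Z z \<in> interior (high_rank k i')} \<in> G.events"
    using measurable_sets[OF Z_borel, of "interior (high_rank k i')"]
    by (simp add: vimage_def Int_def conj_commute)
  show ?thesis
  proof (rule dense_le)
    fix c assume "c < \<P>(z in G. Z z \<in> interior (high_rank k i))"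
    then have "c < \<P>(z in G. swap i i' (Z z) \<in> interior (high_rank k i))"
      using swapped.portmanteau_open[OF open_interior] by (simp add: eventually_const_iff)
    also have "\<dots> \<le> \<P>(z in G. Z z \<in> interior (high_rank k i'))"
      using sub ev by (intro G.finite_measure_mono) auto
    finally show "c \<le> \<P>(z in G. Z z \<in> interior (high_rank k i'))" by simp
  qed
qed

definition limit_prob :: "nat \<Rightarrow> real" where
  "limit_prob k = \<P>(z in G. Z z \<in> interior (high_rank k 1))"

lemma event_interior: "{z \<in> space G. Z z \<in> interior S} \<in> G.events"
  using measurable_sets[OF Z_borel, of "interior S"] by (simp add: vimage_def Int_def conj_commute)

lemma card_interior_measurable:
  "(\<lambda>z. real (card {i \<in> {1..w}. Z z \<in> interior (high_rank k i)})) \<in> borel_measurable G"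
proof -
  have "(\<lambda>z. \<Sum>i\<in>{1..w}. indicator (interior (high_rank k i)) (Z z) :: real) \<in> borel_measurable G"
    by (intro borel_measurable_sum measurable_compose[OF Z_borel] borel_measurable_indicator) simp
  moreover have "(\<Sum>i\<in>{1..w}. indicator (interior (high_rank k i)) (Z z) :: real)
      = real (card {i \<in> {1..w}. Z z \<in> interior (high_rank k i)})" for z
    by (simp add: indicator_def of_bool_def sum.If_cases Int_def)
  ultimately show ?thesis by (simp only:)
qed

text \<open>
  By exchangeability, the limiting rejection probability is the expected proportion of flips of high
  rank.
\<close>

lemma w_limit_prob:
  "real w * limit_prob k = G.expectation (\<lambda>z. real (card {i \<in> {1..w}. Z z \<in> interior (high_rank k i)}))"
proof -
  have eq: "\<P>(z in G. Z z \<in> interior (high_rank k i)) = limit_prob k" if "i \<in> {1..w}" for i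
    unfolding limit_prob_def using that w by (intro antisym prob_high_rank_le) auto
  have "real w * limit_prob k = (\<Sum>i\<in>{1..w}. \<P>(z in G. Z z \<in> interior (high_rank k i)))"
  proof -
    have "(\<Sum>i\<in>{1..w}. \<P>(z in G. Z z \<in> interior (high_rank k i))) = (\<Sum>i\<in>{1..w}. limit_prob k)"
      by (intro sum.cong refl eq)
    then show ?thesis by simp
  qed
  also have "\<dots> = (\<Sum>i\<in>{1..w}. G.expectation (indicator {z \<in> space G. Z z \<in> interior (high_rank k i)}))"
    using event_interior by simp
  also have "\<dots> = G.expectation (\<lambda>z. \<Sum>i\<in>{1..w}. indicator {z \<in> space G. Z z \<in> interior (high_rank k i)} z)"
    using event_interior by (subst Bochner_Integration.integral_sum) (auto simp: G.emeasure_eq_measure simp del: One_nat_def)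
  also have "\<dots> = G.expectation (\<lambda>z. real (card {i \<in> {1..w}. Z z \<in> interior (high_rank k i)}))"
  proof (rule Bochner_Integration.integral_cong[OF refl])
    fix z assume "z \<in> space G"
    then have "(\<Sum>i\<in>{1..w}. indicator {z \<in> space G. Z z \<in> interior (high_rank k i)} z)
        = (\<Sum>i\<in>{1..w}. if Z z \<in> interior (high_rank k i) then 1 else (0::real))"
      by (intro sum.cong refl) (auto simp: indicator_def)
    also have "\<dots> = real (card {i \<in> {1..w}. Z z \<in> interior (high_rank k i)})"
      by (simp add: sum.If_cases Int_def)
    finally show "(\<Sum>i\<in>{1..w}. indicator {z \<in> space G. Z z \<in> interior (high_rank k i)} z)
        = real (card {i \<in> {1..w}. Z z \<in> interior (high_rank k i)})" .
  qed
  finally show ?thesis .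
qed

lemma AE_not_frontier_high_rank: "AE z in G. \<forall>i\<in>{1..w}. Z z \<notin> frontier (high_rank k i)"
  using AE_not_frontier_below by eventually_elim (use not_frontier_high_rank in blast)

lemma limit_prob_le: "real w * limit_prob k \<le> real (w - k)"
proof -
  have le: "card {i \<in> {1..w}. x \<in> interior (high_rank k i)} \<le> w - k" for x
  proof -
    have "card {i \<in> {1..w}. x \<in> interior (high_rank k i)} \<le> card {i \<in> {1..w}. x \<in> high_rank k i}"
      using interior_subset by (intro card_mono) auto
    also have "\<dots> \<le> w - k"
      using card_high_rank_le[of "{1..w}" k "\<lambda>j. flip_stat \<psi> L j x"] by (simp add: high_rank_def)
    finally show ?thesis .
  qed
  have "G.expectation (\<lambda>z. real (card {i \<in> {1..w}. Z z \<in> interior (high_rank k i)})) \<le> real (w - k)"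
  proof (cases "integrable G (\<lambda>z. real (card {i \<in> {1..w}. Z z \<in> interior (high_rank k i)}))")
    case True
    then show ?thesis using le by (intro G.integral_le_const) auto
  qed (simp add: not_integrable_integral_eq)
  then show ?thesis unfolding w_limit_prob .
qed

lemma limit_prob_eq:
  assumes "AE z in G. \<forall>p\<in>{1..w} \<times> {1..w}. fst p \<noteq> snd p \<longrightarrow> Z z \<notin> tied (fst p) (snd p)"
  shows "real w * limit_prob k = real (w - k)"
proof -
  have "AE z in G. real (card {i \<in> {1..w}. Z z \<in> interior (high_rank k i)}) = real (w - k)"
    using assms AE_not_frontier_high_rank[of k]
  proof eventually_elim
    case (elim z)
    have "{i \<in> {1..w}. Z z \<in> interior (high_rank k i)} = {i \<in> {1..w}. Z z \<in> high_rank k i}"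
      using elim(2) closure_subset interior_subset by (fastforce simp: frontier_def)
    moreover have "inj_on (\<lambda>j. flip_stat \<psi> L j (Z z)) {1..w}"
      using elim(1) by (auto simp: inj_on_def tied_def)
    ultimately show ?case
      using card_high_rank_eq[of "{1..w}" "\<lambda>j. flip_stat \<psi> L j (Z z)" k] by (simp add: high_rank_def)
  qed
  then have "G.expectation (\<lambda>z. real (card {i \<in> {1..w}. Z z \<in> interior (high_rank k i)}))
      = G.expectation (\<lambda>z. real (w - k))"
    by (intro integral_cong_AE card_interior_measurable) auto
  then show ?thesis unfolding w_limit_prob
    by (simp only: lebesgue_integral_const G.prob_space) simp
qed

lemma AE_untied_of_jointly_increasing:
  assumes "jointly_increasing_on L \<psi>"
  shows "AE z in G. \<forall>p\<in>{1..w} \<times> {1..w}. fst p \<noteq> snd p \<longrightarrow> Z z \<notin> interior (tied (fst p) (snd p))"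
proof (rule AE_finite_allI)
  fix p assume p: "p \<in> {1..w} \<times> {1..w}"
  obtain j i where ji: "p = (j, i)" "j \<in> {1..w}" "i \<in> {1..w}" using p by auto
  show "AE z in G. fst p \<noteq> snd p \<longrightarrow> Z z \<notin> interior (tied (fst p) (snd p))"
  proof (cases "j = i")
    case True
    then show ?thesis using ji by simp
  next
    case False
    have "AE z in G. Z z \<notin> interior (tied j i)"
    proof (rule AE_not_of_scaling[of i j])
      show "interior (tied j i) \<in> sets borel" by simp
      fix x :: "nat \<times> nat \<Rightarrow> real" and s t :: real
      assume nz: "\<And>l. l \<in> L \<Longrightarrow> x (i, l) \<noteq> 0" "\<And>l. l \<in> L \<Longrightarrow> x (j, l) \<noteq> 0"
        and st: "0 < s" "s < t"
        and t: "(\<lambda>p. block_scale i j s p * x p) \<in> interior (tied j i)"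
          "(\<lambda>p. block_scale i j t p * x p) \<in> interior (tied j i)"
      have tie: "(\<lambda>p. block_scale i j s p * x p) \<in> tied j i" "(\<lambda>p. block_scale i j t p * x p) \<in> tied j i"
        using t interior_subset by auto
      have "i \<noteq> j" using False by simp
      show False
        by (rule tie_once[where z = x and s = s and t = t, OF assms \<open>i \<noteq> j\<close> nz st
              tie(1)[unfolded tied_def mem_Collect_eq] tie(2)[unfolded tied_def mem_Collect_eq]])
    qed (use ji False in auto)
    then show ?thesis using ji by simp
  qed
qed simp

text \<open>
  Excluding ties that are stable under small perturbations excludes all ties.
\<close>

lemma AE_untied:
  assumes "AE z in G. \<forall>p\<in>{1..w} \<times> {1..w}. fst p \<noteq> snd p \<longrightarrow> Z z \<notin> interior (tied (fst p) (snd p))"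
  shows "AE z in G. \<forall>p\<in>{1..w} \<times> {1..w}. fst p \<noteq> snd p \<longrightarrow> Z z \<notin> tied (fst p) (snd p)"
  using assms AE_not_frontier_below
proof eventually_elim
  case (elim z)
  show ?case
  proof (intro ballI impI notI)
    fix p assume p: "p \<in> {1..w} \<times> {1..w}" "fst p \<noteq> snd p" "Z z \<in> tied (fst p) (snd p)"
    have "Z z \<notin> frontier (below (fst p) (snd p))" "Z z \<notin> frontier (below (snd p) (fst p))"
      using elim(2) p(1) by (auto simp: mem_Times_iff)
    then have "Z z \<in> interior (tied (fst p) (snd p))" using p(3) by (rule in_interior_tied)
    then show False using elim(1) p by blast
  qed
qed

text \<open>
  Stable ties form an open set, whose limiting probability is at most the limit of the probabilities
  of ties.
\<close>

lemma AE_untied_of_asymptotically_untied: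
  assumes "\<And>j i. j \<in> {1..w} \<Longrightarrow> i \<in> {1..w} \<Longrightarrow> j \<noteq> i \<Longrightarrow>
    (\<lambda>n. \<P>(\<omega> in M n. X n \<omega> \<in> tied j i)) \<longlonglongrightarrow> 0"
  shows "AE z in G. \<forall>p\<in>{1..w} \<times> {1..w}. fst p \<noteq> snd p \<longrightarrow> Z z \<notin> interior (tied (fst p) (snd p))"
proof (rule AE_finite_allI)
  fix p assume p: "p \<in> {1..w} \<times> {1..w}"
  obtain j i where ji: "p = (j, i)" "j \<in> {1..w}" "i \<in> {1..w}" using p by auto
  show "AE z in G. fst p \<noteq> snd p \<longrightarrow> Z z \<notin> interior (tied (fst p) (snd p))"
  proof (cases "j = i")
    case True
    then show ?thesis using ji by simp
  next
    case False
    let ?c = "\<P>(z in G. Z z \<in> interior (tied j i))"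
    have "?c = 0"
    proof (rule ccontr)
      assume "?c \<noteq> 0"
      then have c: "?c / 2 < ?c" "0 < ?c / 2" using zero_less_measure_iff by auto
      have "\<forall>\<^sub>F n in sequentially. ?c / 2 < \<P>(\<omega> in M n. X n \<omega> \<in> interior (tied j i))"
        by (rule portmanteau_open[OF open_interior c(1)])
      moreover have "\<forall>\<^sub>F n in sequentially. \<P>(\<omega> in M n. X n \<omega> \<in> tied j i) < ?c / 2"
        by (rule order_tendstoD(2)[OF assms[OF ji(2,3) False] c(2)])
      ultimately have "\<forall>\<^sub>F n in sequentially. False"
      proof eventually_elim
        case (elim n)
        interpret P: prob_space "M n" by (rule M)
        have [measurable]: "(\<lambda>\<omega>. flip_stat \<psi> L j (X n \<omega>)) \<in> borel_measurable (M n)"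
          "(\<lambda>\<omega>. flip_stat \<psi> L i (X n \<omega>)) \<in> borel_measurable (M n)" using stat ji by auto
        have "{\<omega> \<in> space (M n). X n \<omega> \<in> tied j i} \<in> P.events"
          unfolding tied_def mem_Collect_eq by measurable
        then have "\<P>(\<omega> in M n. X n \<omega> \<in> interior (tied j i))
            \<le> \<P>(\<omega> in M n. X n \<omega> \<in> tied j i)"
          using interior_subset by (intro P.finite_measure_mono) auto
        then show ?case using elim by linarith
      qed
      then show False by simp
    qed
    then have "AE z in G. Z z \<notin> interior (tied j i)"
      by (subst AE_iff_measurable[OF event_interior[of "tied j i"]])
        (auto simp: G.emeasure_eq_measure simp del: One_nat_def)
    then show ?thesis using ji by simp
  qed
qed simp

lemma high_rank_event:
  "{\<omega> \<in> space (M n). X n \<omega> \<in> high_rank k 1} \<in> sets (M n)"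
proof -
  let ?T = "\<lambda>j \<omega>. flip_stat \<psi> L j (X n \<omega>)"
  have "(\<lambda>\<omega>. \<Sum>j\<in>{1..w}. indicator {\<omega> \<in> space (M n). ?T j \<omega> < ?T 1 \<omega>} \<omega> :: real) \<in> borel_measurable (M n)"
    using stat w by (intro borel_measurable_sum borel_measurable_indicator borel_measurable_less) auto
  then have "{\<omega> \<in> space (M n). real k \<le> (\<Sum>j\<in>{1..w}. indicator {\<omega> \<in> space (M n). ?T j \<omega> < ?T 1 \<omega>} \<omega>)} \<in> sets (M n)"
    by (intro borel_measurable_le borel_measurable_const)
  also have "{\<omega> \<in> space (M n). real k \<le> (\<Sum>j\<in>{1..w}. indicator {\<omega> \<in> space (M n). ?T j \<omega> < ?T 1 \<omega>} \<omega>)}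
      = {\<omega> \<in> space (M n). X n \<omega> \<in> high_rank k 1}"
  proof (intro Collect_cong conj_cong refl)
    fix \<omega> assume \<omega>: "\<omega> \<in> space (M n)"
    have "(\<Sum>j\<in>{1..w}. indicator {\<omega> \<in> space (M n). ?T j \<omega> < ?T 1 \<omega>} \<omega>)
        = (\<Sum>j\<in>{1..w}. if ?T j \<omega> < ?T 1 \<omega> then 1 else (0::real))"
      using \<omega> by (intro sum.cong refl) (auto simp: indicator_def)
    also have "\<dots> = real (card {j \<in> {1..w}. ?T j \<omega> < ?T 1 \<omega>})"
      by (simp add: sum.If_cases Int_def)
    finally show "real k \<le> (\<Sum>j\<in>{1..w}. indicator {\<omega> \<in> space (M n). ?T j \<omega> < ?T 1 \<omega>} \<omega>)
        \<longleftrightarrow> X n \<omega> \<in> high_rank k 1"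
      by (simp add: high_rank_def)
  qed
  finally show ?thesis .
qed

text \<open>
  The rejection region is a Boolean combination of comparisons of two flips, so its frontier is
  negligible; the portmanteau inequality for its interior and for the interior of its complement then
  determine the limit.
\<close>

lemma prob_high_rank_tendsto:
  "(\<lambda>n. \<P>(\<omega> in M n. X n \<omega> \<in> high_rank k 1)) \<longlonglongrightarrow> limit_prob k"
proof (rule order_tendstoI)
  let ?E = "high_rank k 1"
  fix c assume "c < limit_prob k"
  then have "\<forall>\<^sub>F n in sequentially. c < \<P>(\<omega> in M n. X n \<omega> \<in> interior ?E)"
    unfolding limit_prob_def by (rule portmanteau_open[OF open_interior])
  then show "\<forall>\<^sub>F n in sequentially. c < \<P>(\<omega> in M n. X n \<omega> \<in> ?E)"
  proof eventually_elim
    case (elim n)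
    interpret P: prob_space "M n" by (rule M)
    have "\<P>(\<omega> in M n. X n \<omega> \<in> interior ?E) \<le> \<P>(\<omega> in M n. X n \<omega> \<in> ?E)"
      using interior_subset high_rank_event by (intro P.finite_measure_mono) auto
    then show ?case using elim by linarith
  qed
next
  let ?E = "high_rank k 1"
  fix c assume c: "limit_prob k < c"
  have "\<P>(z in G. Z z \<in> interior (- ?E)) = \<P>(z in G. \<not> Z z \<in> interior ?E)"
  proof (rule G.finite_measure_eq_AE)
    show "AE z in G. z \<in> {z \<in> space G. Z z \<in> interior (- ?E)} \<longleftrightarrow> z \<in> {z \<in> space G. \<not> Z z \<in> interior ?E}"
      using AE_not_frontier_high_rank[of k]
    proof eventually_elim
      case (elim z)
      then have "Z z \<notin> frontier ?E" using w by simp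
      then show ?case using interior_subset[of ?E] closure_subset[of ?E]
        by (auto simp: frontier_def interior_complement)
    qed
    have "space G - {z \<in> space G. Z z \<in> interior ?E} \<in> G.events" using event_interior by auto
    then show "{z \<in> space G. \<not> Z z \<in> interior ?E} \<in> G.events"
      by (auto simp: set_diff_eq cong: conj_cong)
  qed (rule event_interior)
  also have "\<dots> = 1 - limit_prob k"
    unfolding limit_prob_def by (rule G.prob_neg) (rule event_interior)
  finally have "1 - c < \<P>(z in G. Z z \<in> interior (- ?E))" using c by simp
  then have "\<forall>\<^sub>F n in sequentially. 1 - c < \<P>(\<omega> in M n. X n \<omega> \<in> interior (- ?E))"
    by (rule portmanteau_open[OF open_interior])
  then show "\<forall>\<^sub>F n in sequentially. \<P>(\<omega> in M n. X n \<omega> \<in> ?E) < c"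
  proof eventually_elim
    case (elim n)
    interpret P: prob_space "M n" by (rule M)
    have "\<P>(\<omega> in M n. X n \<omega> \<in> interior (- ?E)) \<le> \<P>(\<omega> in M n. \<not> X n \<omega> \<in> ?E)"
    proof (rule P.finite_measure_mono)
      show "{\<omega> \<in> space (M n). X n \<omega> \<in> interior (- ?E)} \<subseteq> {\<omega> \<in> space (M n). \<not> X n \<omega> \<in> ?E}"
        using interior_subset by auto
      have "space (M n) - {\<omega> \<in> space (M n). X n \<omega> \<in> ?E} \<in> P.events" using high_rank_event by auto
      moreover have "space (M n) - {\<omega> \<in> space (M n). X n \<omega> \<in> ?E} = {\<omega> \<in> space (M n). \<not> X n \<omega> \<in> ?E}" by auto
      ultimately show "{\<omega> \<in> space (M n). \<not> X n \<omega> \<in> ?E} \<in> P.events" by simp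
    qed
    also have "\<dots> = 1 - \<P>(\<omega> in M n. X n \<omega> \<in> ?E)"
      by (rule P.prob_neg) (rule high_rank_event)
    finally show ?case using elim by linarith
  qed
qed
end

section \<open>Asymptotic normality of the scores and the test\<close>

locale flip_test =
  fixes D :: "'a flip_glm" and L :: "nat set"
  assumes model: "response_model D" and flips: "random_flips D" and reg: "regularity D"
    and L_subset: "L \<subseteq> {1..nmodels D}" and null: "\<forall>l\<in>L. null_true D l"
begin

abbreviation "M \<equiv> pspace D"
abbreviation "w \<equiv> nflips D"

definition \<nu> :: "nat \<Rightarrow> nat \<Rightarrow> nat \<Rightarrow> 'a \<Rightarrow> real" where
  "\<nu> n l i = nu D n l (gamma_true D l) i"

text \<open>
  The effective scores at the true nuisance parameters, indexed by flip and model.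
\<close>

definition U :: "nat \<Rightarrow> nat \<times> nat \<Rightarrow> 'a \<Rightarrow> real" where
  "U n k = eff_score D n (fst k) (snd k) (gamma_true D (snd k))"

lemma M: "prob_space (M n)" using model by (simp add: response_model_def)

lemma finite_L: "finite L" using L_subset finite_subset by blast

lemma L_true: "l \<in> L \<Longrightarrow> l \<in> true_nulls D"
  using L_subset null by (auto simp: true_nulls_def)

lemma w: "1 \<le> w" using flips by (simp add: random_flips_def)

text \<open>
  The null hypothesis enters here: it makes \<open>mu\<close>, which is evaluated at \<open>beta_null\<close>, the true mean.
\<close>

lemma response_facts:
  assumes l: "l \<in> L" and i: "i < n"
  shows "response D n l i \<in> borel_measurable (M n)"
    and "integrable (M n) (\<lambda>\<omega>. (response D n l i \<omega>)\<^sup>2)"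
    and "(\<integral>\<omega>. response D n l i \<omega> \<partial>M n) = mu D n l (gamma_true D l) i"
proof -
  have l': "l \<in> {1..nmodels D}" using l L_subset by blast
  have "\<forall>n. \<forall>l\<in>{1..nmodels D}. \<forall>i<n.
        let \<eta> = lin_pred D n (beta_true D l) (gamma_true D l) i in
        response D n l i \<in> borel_measurable (pspace D n) \<and>
        (\<exists>\<theta>. edf_params (family D l) \<theta> (dispersion D n l i) \<and>
             distr (pspace D n) borel (response D n l i)
               = edf_law (family D l) \<theta> (dispersion D n l i)) \<and>
        \<eta> \<in> link (family D l) ` mean_space (family D l) \<and>
        (\<integral>\<omega>. response D n l i \<omega> \<partial>pspace D n) = inv_link (family D l) \<eta>"
    using model unfolding response_model_def by blast
  then have *: "response D n l i \<in> borel_measurable (M n) \<and>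
        (\<exists>\<theta>. edf_params (family D l) \<theta> (dispersion D n l i) \<and>
             distr (M n) borel (response D n l i) = edf_law (family D l) \<theta> (dispersion D n l i)) \<and>
        (\<integral>\<omega>. response D n l i \<omega> \<partial>M n)
          = inv_link (family D l) (lin_pred D n (beta_true D l) (gamma_true D l) i)"
    using l' i unfolding Let_def by blast
  then show m: "response D n l i \<in> borel_measurable (M n)" by blast
  from * obtain \<theta> where \<theta>: "edf_params (family D l) \<theta> (dispersion D n l i)"
    "distr (M n) borel (response D n l i) = edf_law (family D l) \<theta> (dispersion D n l i)" by blast
  have "integrable (distr (M n) borel (response D n l i)) (\<lambda>y. y\<^sup>2)"
    using \<theta> by (simp add: edf_params_def)
  then show "integrable (M n) (\<lambda>\<omega>. (response D n l i \<omega>)\<^sup>2)"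
    by (subst (asm) integrable_distr_eq[OF m]) simp_all
  have "beta_true D l = beta_null D l" using null l by (simp add: null_true_def)
  then show "(\<integral>\<omega>. response D n l i \<omega> \<partial>M n) = mu D n l (gamma_true D l) i"
    using * by (simp add: mu_def)
qed

lemma \<nu>_facts:
  assumes l: "l \<in> L" and i: "i < n"
  shows "\<nu> n l i \<in> borel_measurable (M n)"
    and "integrable (M n) (\<lambda>\<omega>. (\<nu> n l i \<omega>)\<^sup>2)"
    and "(\<integral>\<omega>. \<nu> n l i \<omega> \<partial>M n) = 0"
proof -
  interpret prob_space "M n" by (rule M)
  note [measurable] = response_facts(1)[OF l i]
  have int: "integrable (M n) (response D n l i)"
    by (rule square_integrable_imp_integrable[OF response_facts(1,2)[OF l i]])
  show "\<nu> n l i \<in> borel_measurable (M n)" unfolding \<nu>_def nu_def[abs_def] by measurable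
  have "integrable (M n) (\<lambda>\<omega>. (response D n l i \<omega> - mu D n l (gamma_true D l) i)\<^sup>2)"
    unfolding power2_diff using response_facts(2)[OF l i] int
    by (intro Bochner_Integration.integrable_add Bochner_Integration.integrable_diff) auto
  then show "integrable (M n) (\<lambda>\<omega>. (\<nu> n l i \<omega>)\<^sup>2)"
    unfolding \<nu>_def nu_def power_mult_distrib by (rule integrable_mult_right)
  have "(\<integral>\<omega>. response D n l i \<omega> - mu D n l (gamma_true D l) i \<partial>M n) = 0"
    using int response_facts(3)[OF l i] by (simp add: prob_space)
  then show "(\<integral>\<omega>. \<nu> n l i \<omega> \<partial>M n) = 0"
    unfolding \<nu>_def nu_def by (simp only: integral_mult_right_zero mult_zero_right)
qed

definition S :: "nat \<Rightarrow> nat \<Rightarrow> real" where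
  "S k l = lim (\<lambda>n. (\<Sum>i<n. \<integral>\<omega>. \<nu> n k i \<omega> * \<nu> n l i \<omega> \<partial>M n) / real n)"

lemma covariance:
  assumes "k \<in> L" "l \<in> L"
  shows "(\<lambda>n. (\<Sum>i<n. \<integral>\<omega>. \<nu> n k i \<omega> * \<nu> n l i \<omega> \<partial>M n) / real n) \<longlonglongrightarrow> S k l"
    and "0 < S k k"
proof -
  obtain \<Sigma> where \<Sigma>: "\<forall>l\<in>true_nulls D. \<Sigma> l l > 0 \<and>
        (\<forall>l'\<in>true_nulls D.
           (\<lambda>n. (\<Sum>i<n. cov (pspace D n) (nu D n l (gamma_true D l) i)
                                         (nu D n l' (gamma_true D l') i)) / real n)
             \<longlonglongrightarrow> \<Sigma> l l')"
    using reg unfolding regularity_def by blast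
  have c: "cov (M n) (nu D n k (gamma_true D k) i) (nu D n l (gamma_true D l) i)
      = (\<integral>\<omega>. \<nu> n k i \<omega> * \<nu> n l i \<omega> \<partial>M n)" if "i < n" "k \<in> L" "l \<in> L" for n i k l
    using \<nu>_facts(3)[OF that(2,1)] \<nu>_facts(3)[OF that(3,1)] by (simp add: cov_def \<nu>_def)
  have lim: "(\<lambda>n. (\<Sum>i<n. \<integral>\<omega>. \<nu> n k i \<omega> * \<nu> n l i \<omega> \<partial>M n) / real n) \<longlonglongrightarrow> \<Sigma> k l"
    if "k \<in> L" "l \<in> L" for k l
  proof -
    have "(\<lambda>n. (\<Sum>i<n. cov (M n) (nu D n k (gamma_true D k) i) (nu D n l (gamma_true D l) i)) / real n) \<longlonglongrightarrow> \<Sigma> k l"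
      using \<Sigma> L_true that by blast
    then show ?thesis using c that by simp
  qed
  have S: "S k l = \<Sigma> k l" if "k \<in> L" "l \<in> L" for k l
    unfolding S_def by (rule limI[OF lim[OF that]])
  show "(\<lambda>n. (\<Sum>i<n. \<integral>\<omega>. \<nu> n k i \<omega> * \<nu> n l i \<omega> \<partial>M n) / real n) \<longlonglongrightarrow> S k l"
    using lim[OF assms] S[OF assms] by simp
  show "0 < S k k" using S[OF assms(1,1)] \<Sigma> L_true[OF assms(1)] by simp
qed

lemma S_sym: "k \<in> L \<Longrightarrow> l \<in> L \<Longrightarrow> S k l = S l k"
  by (simp add: S_def mult.commute)

text \<open>
  A limit of averages of \<open>E (\<Sum>k. x k * \<nu> k)\<^sup>2\<close>.
\<close>

lemma S_psd: "0 \<le> (\<Sum>k\<in>L. \<Sum>l\<in>L. x k * x l * S k l)"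
proof (rule LIMSEQ_le_const)
  show "(\<lambda>n. \<Sum>k\<in>L. \<Sum>l\<in>L. x k * x l * ((\<Sum>i<n. \<integral>\<omega>. \<nu> n k i \<omega> * \<nu> n l i \<omega> \<partial>M n) / real n))
      \<longlonglongrightarrow> (\<Sum>k\<in>L. \<Sum>l\<in>L. x k * x l * S k l)"
    by (intro tendsto_sum tendsto_mult_left covariance)
  have "0 \<le> (\<Sum>k\<in>L. \<Sum>l\<in>L. x k * x l * ((\<Sum>i<n. \<integral>\<omega>. \<nu> n k i \<omega> * \<nu> n l i \<omega> \<partial>M n) / real n))" for n
  proof -
    interpret prob_space "M n" by (rule M)
    have int: "integrable (M n) (\<lambda>\<omega>. \<nu> n k i \<omega> * \<nu> n l i \<omega>)" if "k \<in> L" "l \<in> L" "i < n" for k l i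
      by (rule integrable_mult_of_square_integrable[OF \<nu>_facts(1)[OF that(1,3)] \<nu>_facts(1)[OF that(2,3)]
            \<nu>_facts(2)[OF that(1,3)] \<nu>_facts(2)[OF that(2,3)]])
    have quad: "0 \<le> (\<Sum>k\<in>L. \<Sum>l\<in>L. x k * x l * expectation (\<lambda>\<omega>. \<nu> n k i \<omega> * \<nu> n l i \<omega>))" if i: "i < n" for i
    proof -
      have "0 \<le> expectation (\<lambda>\<omega>. (\<Sum>k\<in>L. x k * \<nu> n k i \<omega>)\<^sup>2)" by simp
      also have "(\<lambda>\<omega>. (\<Sum>k\<in>L. x k * \<nu> n k i \<omega>)\<^sup>2)
          = (\<lambda>\<omega>. \<Sum>k\<in>L. \<Sum>l\<in>L. x k * x l * (\<nu> n k i \<omega> * \<nu> n l i \<omega>))"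
        by (simp add: power2_eq_square sum_product mult_ac)
      also have "expectation (\<lambda>\<omega>. \<Sum>k\<in>L. \<Sum>l\<in>L. x k * x l * (\<nu> n k i \<omega> * \<nu> n l i \<omega>))
          = (\<Sum>k\<in>L. expectation (\<lambda>\<omega>. \<Sum>l\<in>L. x k * x l * (\<nu> n k i \<omega> * \<nu> n l i \<omega>)))"
        using i by (intro Bochner_Integration.integral_sum Bochner_Integration.integrable_sum integrable_mult_right int)
      also have "\<dots> = (\<Sum>k\<in>L. \<Sum>l\<in>L. expectation (\<lambda>\<omega>. x k * x l * (\<nu> n k i \<omega> * \<nu> n l i \<omega>)))"
        using i by (intro sum.cong refl Bochner_Integration.integral_sum integrable_mult_right int)
      finally show ?thesis by (simp only: integral_mult_right_zero)
    qed
    have "(\<Sum>k\<in>L. \<Sum>l\<in>L. x k * x l * ((\<Sum>i<n. expectation (\<lambda>\<omega>. \<nu> n k i \<omega> * \<nu> n l i \<omega>)) / real n))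
        = (\<Sum>k\<in>L. \<Sum>l\<in>L. \<Sum>i<n. x k * x l * expectation (\<lambda>\<omega>. \<nu> n k i \<omega> * \<nu> n l i \<omega>)) / real n"
      by (simp add: sum_distrib_left sum_divide_distrib)
    also have "(\<Sum>k\<in>L. \<Sum>l\<in>L. \<Sum>i<n. x k * x l * expectation (\<lambda>\<omega>. \<nu> n k i \<omega> * \<nu> n l i \<omega>))
        = (\<Sum>k\<in>L. \<Sum>i<n. \<Sum>l\<in>L. x k * x l * expectation (\<lambda>\<omega>. \<nu> n k i \<omega> * \<nu> n l i \<omega>))"
      by (intro sum.cong refl sum.swap)
    also have "\<dots> = (\<Sum>i<n. \<Sum>k\<in>L. \<Sum>l\<in>L. x k * x l * expectation (\<lambda>\<omega>. \<nu> n k i \<omega> * \<nu> n l i \<omega>))"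
      by (rule sum.swap)
    also have "0 \<le> (\<Sum>i<n. \<Sum>k\<in>L. \<Sum>l\<in>L. x k * x l * expectation (\<lambda>\<omega>. \<nu> n k i \<omega> * \<nu> n l i \<omega>)) / real n"
      by (rule divide_nonneg_nonneg, rule sum_nonneg, rule quad) simp_all
    finally show ?thesis .
  qed
  then show "\<exists>N. \<forall>n\<ge>N. 0 \<le> (\<Sum>k\<in>L. \<Sum>l\<in>L. x k * x l * ((\<Sum>i<n. \<integral>\<omega>. \<nu> n k i \<omega> * \<nu> n l i \<omega> \<partial>M n) / real n))"
    by blast
qed

lemma lindeberg:
  assumes l: "l \<in> L" and e: "0 < e"
  shows "(\<lambda>n. \<Sum>i<n. \<integral>\<omega>. (\<nu> n l i \<omega> / sqrt (real n))\<^sup>2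
    * indicator {e<..} \<bar>\<nu> n l i \<omega> / sqrt (real n)\<bar> \<partial>M n) \<longlonglongrightarrow> 0"
proof -
  have "\<forall>l\<in>true_nulls D. \<forall>\<epsilon>>0.
        (\<lambda>n. (\<Sum>i<n. \<integral>\<omega>. (nu D n l (gamma_true D l) i \<omega>)\<^sup>2
                 * indicator {\<omega>. \<bar>nu D n l (gamma_true D l) i \<omega>\<bar> > \<epsilon> * sqrt (real n)} \<omega>
               \<partial>pspace D n) / real n) \<longlonglongrightarrow> 0"
    using reg unfolding regularity_def by blast
  then have "(\<lambda>n. (\<Sum>i<n. \<integral>\<omega>. (\<nu> n l i \<omega>)\<^sup>2
      * indicator {\<omega>. \<bar>\<nu> n l i \<omega>\<bar> > e * sqrt (real n)} \<omega> \<partial>M n) / real n) \<longlonglongrightarrow> 0"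
    unfolding \<nu>_def using L_true[OF l] e by blast
  moreover have "(\<Sum>i<n. \<integral>\<omega>. (\<nu> n l i \<omega> / sqrt (real n))\<^sup>2 * indicator {e<..} \<bar>\<nu> n l i \<omega> / sqrt (real n)\<bar> \<partial>M n)
      = (\<Sum>i<n. \<integral>\<omega>. (\<nu> n l i \<omega>)\<^sup>2 * indicator {\<omega>. \<bar>\<nu> n l i \<omega>\<bar> > e * sqrt (real n)} \<omega> \<partial>M n) / real n" for n
  proof (cases "n = 0")
    case False
    have "(\<nu> n l i \<omega> / sqrt (real n))\<^sup>2 * indicator {e<..} \<bar>\<nu> n l i \<omega> / sqrt (real n)\<bar>
        = (\<nu> n l i \<omega>)\<^sup>2 * indicator {\<omega>. \<bar>\<nu> n l i \<omega>\<bar> > e * sqrt (real n)} \<omega> / real n" for i \<omega>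
      using False by (simp add: indicator_def power_divide pos_less_divide_eq)
    then show ?thesis by (simp only: integral_divide_zero sum_divide_distrib)
  qed simp
  ultimately show ?thesis by (simp only:)
qed

lemma flip_one: "\<omega> \<in> space (M n) \<Longrightarrow> i < n \<Longrightarrow> flip D n 1 \<omega> i = 1"
  using flips by (simp add: random_flips_def)

lemma flip_measurable:
  assumes "j \<in> {1..w}" "i < n"
  shows "(\<lambda>\<omega>. flip D n j \<omega> i) \<in> borel_measurable (M n)"
proof (cases "j = 1")
  case True
  have "(\<lambda>\<omega>. flip D n j \<omega> i) \<in> borel_measurable (M n) \<longleftrightarrow> (\<lambda>\<omega>. 1 :: real) \<in> borel_measurable (M n)"
    using True flip_one assms(2) by (intro measurable_cong) simp
  then show ?thesis by simp
next
  case False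
  then have "flip D n j \<in> measurable (M n) (count_space (sign_vectors n))"
    using flips assms(1) by (auto simp: random_flips_def)
  then show ?thesis by (rule measurable_compose) simp
qed

lemma U_measurable:
  assumes "k \<in> {1..w} \<times> L"
  shows "U n k \<in> borel_measurable (M n)"
proof -
  have "(\<lambda>\<omega>. flip D n (fst k) \<omega> i * \<nu> n (snd k) i \<omega>) \<in> borel_measurable (M n)" if "i < n" for i
    using assms that by (intro borel_measurable_times flip_measurable \<nu>_facts(1)) auto
  then show ?thesis
    unfolding U_def eff_score_def[abs_def] \<nu>_def
    by (intro borel_measurable_divide borel_measurable_sum borel_measurable_const) auto
qed

text \<open>
  The contribution \<open>\<nu>\<close> as a function of the response vector of its unit, which is what the independence
  assumptions speak about.
\<close>

definition unit_score :: "nat \<Rightarrow> nat \<Rightarrow> nat \<Rightarrow> (nat \<Rightarrow> real) \<Rightarrow> real" where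
  "unit_score n l i u = score_row D n l (gamma_true D l) $$ (0, i) * (u l - mu D n l (gamma_true D l) i)"

lemma unit_score:
  "l \<in> L \<Longrightarrow> unit_score n l i (unit_vec D n i \<omega>) = \<nu> n l i \<omega>"
  using L_subset by (auto simp: unit_score_def unit_vec_def \<nu>_def nu_def)

lemma unit_score_measurable:
  assumes "l \<in> L"
  shows "unit_score n l i \<in> borel_measurable (unit_vec_space D)"
proof -
  have "(\<lambda>u. u l) \<in> borel_measurable (unit_vec_space D)"
    unfolding unit_vec_space_def using assms L_subset by (intro measurable_component_singleton) auto
  then show ?thesis unfolding unit_score_def[abs_def] by measurable
qed

lemma char_U_product:
  "(\<integral>\<omega>. iexp (\<Sum>k\<in>{1..w} \<times> L. t k * U n k \<omega>) \<partial>M n)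
    = (\<Prod>i<n. \<integral>\<omega>. iexp (\<Sum>l\<in>L. t (1, l) * (\<nu> n l i \<omega> / sqrt (real n)))
        * (\<Prod>j\<in>{2..w}. of_real (cos (\<Sum>l\<in>L. t (j, l) * (\<nu> n l i \<omega> / sqrt (real n))))) \<partial>M n)"
proof -
  interpret prob_space "M n" by (rule M)
  define f where "f j i u = (\<Sum>l\<in>L. t (j, l) * (unit_score n l i u / sqrt (real n)))" for j i u
  have fm: "f j i \<in> borel_measurable (unit_vec_space D)" for j i
    unfolding f_def by (intro borel_measurable_sum borel_measurable_times borel_measurable_const
        borel_measurable_divide unit_score_measurable)
  have fX: "f j i (unit_vec D n i \<omega>) = (\<Sum>l\<in>L. t (j, l) * (\<nu> n l i \<omega> / sqrt (real n)))" for j i \<omega>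
    unfolding f_def by (intro sum.cong refl) (simp add: unit_score)
  have "(\<integral>\<omega>. iexp (\<Sum>k\<in>{1..w} \<times> L. t k * U n k \<omega>) \<partial>M n)
      = expectation (\<lambda>\<omega>. iexp (\<Sum>i<n. f 1 i (unit_vec D n i \<omega>)
          + (\<Sum>j\<in>{2..w}. flip D n j \<omega> i * f j i (unit_vec D n i \<omega>))))"
  proof (rule Bochner_Integration.integral_cong[OF refl])
    fix \<omega> assume \<omega>: "\<omega> \<in> space (M n)"
    have set_eq: "{1..w} = insert 1 {2..w}" using w by auto
    have "(\<Sum>k\<in>{1..w} \<times> L. t k * U n k \<omega>)
        = (\<Sum>j\<in>{1..w}. \<Sum>l\<in>L. \<Sum>i<n. t (j, l) * (flip D n j \<omega> i * (\<nu> n l i \<omega> / sqrt (real n))))"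
      by (subst sum.cartesian_product') (simp add: U_def eff_score_def \<nu>_def sum_divide_distrib sum_distrib_left)
    also have "\<dots> = (\<Sum>j\<in>{1..w}. \<Sum>i<n. \<Sum>l\<in>L. t (j, l) * (flip D n j \<omega> i * (\<nu> n l i \<omega> / sqrt (real n))))"
      by (intro sum.cong refl sum.swap)
    also have "\<dots> = (\<Sum>i<n. \<Sum>j\<in>{1..w}. \<Sum>l\<in>L. t (j, l) * (flip D n j \<omega> i * (\<nu> n l i \<omega> / sqrt (real n))))"
      by (rule sum.swap)
    also have "\<dots> = (\<Sum>i<n. \<Sum>j\<in>{1..w}. flip D n j \<omega> i * f j i (unit_vec D n i \<omega>))"
      unfolding fX sum_distrib_left by (intro sum.cong refl) (simp only: mult_ac)
    also have "\<dots> = (\<Sum>i<n. f 1 i (unit_vec D n i \<omega>) + (\<Sum>j\<in>{2..w}. flip D n j \<omega> i * f j i (unit_vec D n i \<omega>)))"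
      unfolding set_eq using flip_one[OF \<omega>] by (intro sum.cong refl) simp
    finally show "iexp (\<Sum>k\<in>{1..w} \<times> L. t k * U n k \<omega>) = iexp (\<Sum>i<n. f 1 i (unit_vec D n i \<omega>)
          + (\<Sum>j\<in>{2..w}. flip D n j \<omega> i * f j i (unit_vec D n i \<omega>)))"
      by (simp only:)
  qed
  also have "\<dots> = (\<Prod>i<n. expectation (\<lambda>\<omega>. iexp (f 1 i (unit_vec D n i \<omega>))
      * (\<Prod>j\<in>{2..w}. of_real (cos (f j i (unit_vec D n i \<omega>))))))"
  proof (rule char_flipped_sum[where X = "unit_vec D n" and g = "flip D n" and N = "unit_vec_space D"
        and J = "{2..w}" and f = "f 1" and h = f])
    show "indep_vars (\<lambda>_. unit_vec_space D) (unit_vec D n) {..<n}"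
      using model unfolding response_model_def by blast
    show "indep_vars (\<lambda>_. count_space (sign_vectors n)) (flip D n) {2..w}"
      using flips unfolding random_flips_def by blast
    show "distr (M n) (count_space (sign_vectors n)) (flip D n j) = uniform_count_measure (sign_vectors n)"
      if "j \<in> {2..w}" for j
      using flips that unfolding random_flips_def by blast
    have "indep_var (data_space D n) (data D n) (PiM {2..w} (\<lambda>_. count_space (sign_vectors n)))
            (\<lambda>\<omega>. \<lambda>j\<in>{2..w}. flip D n j \<omega>)"
      using flips unfolding random_flips_def by blast
    then show "indep_var (PiM {..<n} (\<lambda>_. unit_vec_space D)) (\<lambda>\<omega>. \<lambda>i\<in>{..<n}. unit_vec D n i \<omega>)
        (PiM {2..w} (\<lambda>_. count_space (sign_vectors n))) (\<lambda>\<omega>. \<lambda>j\<in>{2..w}. flip D n j \<omega>)"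
      by (simp only: data_space_def data_def[abs_def])
  qed (use fm in simp_all)
  finally show ?thesis by (simp only: fX)
qed

lemma char_U_tendsto:
  "(\<lambda>n. \<integral>\<omega>. iexp (\<Sum>k\<in>{1..w} \<times> L. t k * U n k \<omega>) \<partial>M n)
    \<longlonglongrightarrow> of_real (exp (- (\<Sum>j\<in>{1..w}. \<Sum>k\<in>L. \<Sum>l\<in>L. t (j, k) * t (j, l) * S k l) / 2))"
proof -
  have set_eq: "{1..w} = insert 1 {2..w}" using w by auto
  have "(\<lambda>n. \<Prod>i<n. \<integral>\<omega>. iexp (\<Sum>l\<in>L. t (1, l) * (\<nu> n l i \<omega> / sqrt (real n)))
        * (\<Prod>j\<in>{2..w}. of_real (cos (\<Sum>l\<in>L. t (j, l) * (\<nu> n l i \<omega> / sqrt (real n))))) \<partial>M n)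
      \<longlonglongrightarrow> of_real (exp (- (\<Sum>j\<in>insert 1 {2..w}. \<Sum>k\<in>L. \<Sum>l\<in>L. t (j, k) * t (j, l) * S k l) / 2))"
  proof (rule flip_factor_product_tendsto[where x = "\<lambda>n i l \<omega>. \<nu> n l i \<omega> / sqrt (real n)" and t = "\<lambda>j l. t (j, l)"])
    show "(\<lambda>\<omega>. \<nu> n l i \<omega> / sqrt (real n)) \<in> borel_measurable (M n)" if "i < n" "l \<in> L" for n i l
      using \<nu>_facts(1)[OF that(2,1)] by simp
    show "integrable (M n) (\<lambda>\<omega>. (\<nu> n l i \<omega> / sqrt (real n))\<^sup>2)" if "i < n" "l \<in> L" for n i l
      unfolding power_divide by (rule integrable_divide) (rule \<nu>_facts(2)[OF that(2,1)])
    show "(\<integral>\<omega>. \<nu> n l i \<omega> / sqrt (real n) \<partial>M n) = 0" if "i < n" "l \<in> L" for n i l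
      by (simp only: integral_divide_zero \<nu>_facts(3)[OF that(2,1)] div_0)
    show "(\<lambda>n. \<Sum>i<n. \<integral>\<omega>. \<nu> n k i \<omega> / sqrt (real n) * (\<nu> n l i \<omega> / sqrt (real n)) \<partial>M n) \<longlonglongrightarrow> S k l"
      if "k \<in> L" "l \<in> L" for k l
    proof -
      have "\<nu> n k i \<omega> / sqrt (real n) * (\<nu> n l i \<omega> / sqrt (real n)) = \<nu> n k i \<omega> * \<nu> n l i \<omega> / real n" for n i \<omega>
        by simp
      then show ?thesis
        using covariance(1)[OF that] by (simp only: integral_divide_zero sum_divide_distrib)
    qed
  qed (use M finite_L lindeberg in auto)
  then show ?thesis unfolding char_U_product set_eq[symmetric] .
qed

lemma U_tight:
  assumes k: "k \<in> {1..w} \<times> L" and e: "0 < e"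
  shows "\<exists>B>0. \<forall>\<^sub>F n in sequentially. \<P>(\<omega> in M n. B < \<bar>U n k \<omega>\<bar>) < e"
proof -
  obtain j l where jl: "k = (j, l)" "j \<in> {1..w}" "l \<in> L" using k by auto
  define \<sigma> where "\<sigma> = sqrt (S l l)"
  have \<sigma>: "\<sigma>\<^sup>2 = S l l" using covariance(2)[OF jl(3,3)] by (simp add: \<sigma>_def)
  \<comment> \<open>A weight concentrated at \<open>k\<close> gives the characteristic function of the single score.\<close>
  have "(\<lambda>n. \<integral>\<omega>. iexp (s * U n k \<omega>) \<partial>M n) \<longlonglongrightarrow> (\<integral>z. iexp (s * (\<sigma> * z)) \<partial>std_normal_distribution)" for s
  proof -
    define t where "t q = (if q = k then s else 0)" for q
    have "(\<Sum>q\<in>{1..w} \<times> L. t q * x q) = s * x k" for x :: "nat \<times> nat \<Rightarrow> real"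
      using k finite_L by (subst sum.remove[of _ k]) (auto simp: t_def intro!: sum.neutral)
    then have 1: "(\<lambda>n. \<integral>\<omega>. iexp (s * U n k \<omega>) \<partial>M n)
        \<longlonglongrightarrow> of_real (exp (- (\<Sum>j\<in>{1..w}. \<Sum>k\<in>L. \<Sum>l\<in>L. t (j, k) * t (j, l) * S k l) / 2))"
      using char_U_tendsto[of t] by (simp only:)
    have "(\<Sum>j'\<in>{1..w}. \<Sum>k'\<in>L. \<Sum>l'\<in>L. t (j', k') * t (j', l') * S k' l')
        = (\<Sum>j'\<in>{1..w}. if j' = j then (\<Sum>k'\<in>L. if k' = l then (\<Sum>l'\<in>L. if l' = l then s * s * S l l else 0) else 0) else 0)"
      unfolding t_def jl(1) by (intro sum.cong refl) (auto intro!: sum.cong sum.neutral)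
    also have "\<dots> = s * s * S l l" using jl finite_L by simp
    finally have 2: "(\<Sum>j'\<in>{1..w}. \<Sum>k'\<in>L. \<Sum>l'\<in>L. t (j', k') * t (j', l') * S k' l') = (s * \<sigma>)\<^sup>2"
      by (simp add: power_mult_distrib \<sigma> power2_eq_square[of s])
    have "(\<integral>z. iexp (s * (\<sigma> * z)) \<partial>std_normal_distribution) = of_real (exp (- (s * \<sigma>)\<^sup>2 / 2))"
      using fun_cong[OF char_std_normal_distribution, of "s * \<sigma>"] by (simp add: char_def mult_ac)
    then show ?thesis using 1 unfolding 2 by (simp only:)
  qed
  then obtain B where "0 < B" "\<forall>\<^sub>F n in sequentially. \<P>(\<omega> in M n. B < \<bar>U n k \<omega>\<bar>) < e"
    by (rule tight_of_char_tendsto[where M = M and N = std_normal_distribution and X = "\<lambda>n. U n k"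
          and Z = "\<lambda>z. \<sigma> * z", OF M _ U_measurable[OF k] _ _ e, rotated 2])
      (auto intro: prob_space_normal_density)
  then show ?thesis by blast
qed

definition c :: "nat \<Rightarrow> real" where
  "c l = (SOME c. 0 < c \<and> (\<forall>j\<in>{1..w}.
     tendsto_in_prob M (\<lambda>n \<omega>. score_var D n j l (gamma_hat D n l \<omega>) \<omega>) c))"

lemma c:
  assumes "l \<in> L"
  shows "0 < c l" and "j \<in> {1..w} \<Longrightarrow>
    tendsto_in_prob M (\<lambda>n \<omega>. score_var D n j l (gamma_hat D n l \<omega>) \<omega>) (c l)"
proof -
  have "\<forall>l\<in>true_nulls D. \<exists>c>0. \<forall>j\<in>{1..w}.
        tendsto_in_prob M (\<lambda>n \<omega>. score_var D n j l (gamma_hat D n l \<omega>) \<omega>) c"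
    using reg unfolding regularity_def by blast
  then have "\<exists>c. 0 < c \<and> (\<forall>j\<in>{1..w}. tendsto_in_prob M (\<lambda>n \<omega>. score_var D n j l (gamma_hat D n l \<omega>) \<omega>) c)"
    using L_true[OF assms] by blast
  from someI_ex[OF this] show "0 < c l" "j \<in> {1..w} \<Longrightarrow>
    tendsto_in_prob M (\<lambda>n \<omega>. score_var D n j l (gamma_hat D n l \<omega>) \<omega>) (c l)"
    unfolding c_def by blast+
qed

text \<open>
  Plugging in the nuisance estimators and standardizing amounts in the limit to division by a
  constant that does not depend on the flip; the flips therefore remain exchangeable.
\<close>

lemma std_score_tendsto:
  assumes k: "k \<in> {1..w} \<times> L"
  shows "tendsto_in_prob M (\<lambda>n \<omega>. std_score D n (fst k) (snd k) \<omega> - U n k \<omega> / sqrt (c (snd k))) 0"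
  unfolding std_score_def
proof (rule slutsky_quotient[OF M])
  have l: "snd k \<in> L" "fst k \<in> {1..w}" using k by auto
  show "U n k \<in> borel_measurable (M n)" for n by (rule U_measurable[OF k])
  show "\<exists>B>0. \<forall>\<^sub>F n in sequentially. \<P>(\<omega> in M n. B < \<bar>U n k \<omega>\<bar>) < e" if "0 < e" for e
    by (rule U_tight[OF k that])
  have "\<forall>l\<in>true_nulls D. \<forall>j\<in>{1..w}. tendsto_in_prob M
          (\<lambda>n \<omega>. eff_score D n j l (gamma_hat D n l \<omega>) \<omega> - eff_score D n j l (gamma_true D l) \<omega>) 0"
    using reg unfolding regularity_def by blast
  then show "tendsto_in_prob M (\<lambda>n \<omega>. eff_score D n (fst k) (snd k) (gamma_hat D n (snd k) \<omega>) \<omega> - U n k \<omega>) 0"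
    unfolding U_def using L_true[OF l(1)] l(2) by blast
  show "tendsto_in_prob M (\<lambda>n \<omega>. score_var D n (fst k) (snd k) (gamma_hat D n (snd k) \<omega>) \<omega>) (c (snd k))"
    by (rule c(2)[OF l])
  show "0 < c (snd k)" by (rule c(1)[OF l(1)])
qed

lemma std_score_measurable:
  assumes k: "k \<in> {1..w} \<times> L"
  shows "std_score D n (fst k) (snd k) \<in> borel_measurable (M n)"
proof -
  have "(\<lambda>\<omega>. (std_score D n (fst k) (snd k) \<omega> - U n k \<omega> / sqrt (c (snd k))) + U n k \<omega> / sqrt (c (snd k)))
      \<in> borel_measurable (M n)"
    by (intro borel_measurable_add borel_measurable_divide borel_measurable_const
        tendsto_in_probD(1)[OF std_score_tendsto[OF k]] U_measurable[OF k])
  then show ?thesis by simp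
qed

text \<open>
  The array of standardized scores of the models in \<open>L\<close>.
\<close>

definition X :: "nat \<Rightarrow> 'a \<Rightarrow> nat \<times> nat \<Rightarrow> real" where
  "X n \<omega> k = (if k \<in> {1..w} \<times> L then std_score D n (fst k) (snd k) \<omega> else 0)"

lemma X_eq: "k \<in> {1..w} \<times> L \<Longrightarrow> X n \<omega> k = std_score D n (fst k) (snd k) \<omega>"
  by (simp add: X_def)

lemma flip_stat_X: "j \<in> {1..w} \<Longrightarrow> flip_stat \<psi> L j (X n \<omega>) = test_stat D \<psi> L n j \<omega>"
  unfolding flip_stat_def test_stat_def
  by (intro arg_cong[of _ _ \<psi>] restrict_ext) (simp add: X_eq)

definition R :: "nat \<Rightarrow> nat \<Rightarrow> real" where
  "R k l = S k l / (sqrt (c k) * sqrt (c l))"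

text \<open>
  The rows of the array of standardized scores are asymptotically independent with the common
  covariance matrix \<open>R\<close>; the unflipped first row is not distinguished from the others.
\<close>

lemma char_X_tendsto:
  "(\<lambda>n. \<integral>\<omega>. iexp (\<Sum>k\<in>{1..w} \<times> L. t k * X n \<omega> k) \<partial>M n)
    \<longlonglongrightarrow> of_real (exp (- (\<Sum>j\<in>{1..w}. \<Sum>k\<in>L. \<Sum>l\<in>L. t (j, k) * t (j, l) * R k l) / 2))"
proof (rule char_tendsto_of_tendsto_in_prob[OF M])
  let ?K = "{1..w} \<times> L"
  let ?u = "\<lambda>k. t k / sqrt (c (snd k))"
  have eq: "(\<Sum>k\<in>?K. t k * X n \<omega> k) - (\<Sum>k\<in>?K. ?u k * U n k \<omega>)
      = (\<Sum>k\<in>?K. t k * (std_score D n (fst k) (snd k) \<omega> - U n k \<omega> / sqrt (c (snd k))))" for n \<omega>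
    unfolding sum_subtractf[symmetric] by (intro sum.cong refl) (simp add: X_eq right_diff_distrib)
  show "tendsto_in_prob M (\<lambda>n \<omega>. (\<Sum>k\<in>?K. t k * X n \<omega> k) - (\<Sum>k\<in>?K. ?u k * U n k \<omega>)) 0"
    unfolding eq using finite_L by (intro tendsto_in_prob_linear_combination M std_score_tendsto) auto
  show "(\<lambda>\<omega>. \<Sum>k\<in>?K. ?u k * U n k \<omega>) \<in> borel_measurable (M n)" for n
    by (intro borel_measurable_sum borel_measurable_times borel_measurable_const U_measurable)
  show "(\<lambda>\<omega>. \<Sum>k\<in>?K. t k * X n \<omega> k) \<in> borel_measurable (M n)" for n
  proof (intro borel_measurable_sum borel_measurable_times borel_measurable_const)
    fix k assume "k \<in> ?K"
    then show "(\<lambda>\<omega>. X n \<omega> k) \<in> borel_measurable (M n)"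
      using std_score_measurable[of k n] by (simp add: X_eq cong: measurable_cong)
  qed
  have "(\<Sum>j\<in>{1..w}. \<Sum>k\<in>L. \<Sum>l\<in>L. ?u (j, k) * ?u (j, l) * S k l)
      = (\<Sum>j\<in>{1..w}. \<Sum>k\<in>L. \<Sum>l\<in>L. t (j, k) * t (j, l) * R k l)"
    by (intro sum.cong refl) (simp add: R_def)
  then show "(\<lambda>n. \<integral>\<omega>. iexp (\<Sum>k\<in>?K. ?u k * U n k \<omega>) \<partial>M n)
      \<longlonglongrightarrow> of_real (exp (- (\<Sum>j\<in>{1..w}. \<Sum>k\<in>L. \<Sum>l\<in>L. t (j, k) * t (j, l) * R k l) / 2))"
    using char_U_tendsto[of ?u] by (simp only:)
qed

lemma flip_limit:
  assumes psi: "nondecreasing_on L \<psi>"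
    and stat: "\<And>n j. j \<in> {1..w} \<Longrightarrow> test_stat D \<psi> L n j \<in> borel_measurable (M n)"
  shows "flip_limit w L \<psi> R M X"
proof (rule flip_limit.intro)
  show "1 \<le> w" by (rule w)
  show "finite L" by (rule finite_L)
  show "nondecreasing_on L \<psi>" by (rule psi)
  show "R k l = R l k" if "k \<in> L" "l \<in> L" for k l
    using S_sym[OF that] by (simp add: R_def mult.commute)
  show "0 < R l l" if "l \<in> L" for l
    using covariance(2)[OF that that] c(1)[OF that] by (simp add: R_def)
  show "0 \<le> (\<Sum>k\<in>L. \<Sum>l\<in>L. x k * x l * R k l)" for x
    using S_psd[of "\<lambda>k. x k / sqrt (c k)"] by (simp add: R_def)
  show "prob_space (M n)" for n by (rule M)
  show "(\<lambda>\<omega>. X n \<omega> k) \<in> borel_measurable (M n)" if "k \<in> {1..w} \<times> L" for n k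
    unfolding X_eq[OF that] by (rule std_score_measurable[OF that])
  show "X n \<omega> k = 0" if "k \<notin> {1..w} \<times> L" for n \<omega> k using that by (simp only: X_def if_False)
  show "(\<lambda>\<omega>. flip_stat \<psi> L j (X n \<omega>)) \<in> borel_measurable (M n)" if "j \<in> {1..w}" for n j
    unfolding flip_stat_X[OF that] by (rule stat[OF that])
  show "(\<lambda>n. \<integral>\<omega>. iexp (\<Sum>k\<in>{1..w} \<times> L. t k * X n \<omega> k) \<partial>M n)
      \<longlonglongrightarrow> of_real (exp (- (\<Sum>j\<in>{1..w}. \<Sum>k\<in>L. \<Sum>l\<in>L. t (j, k) * t (j, l) * R k l) / 2))" for t
    by (rule char_X_tendsto)
qed

end

lemma quantile_index:
  fixes \<alpha> :: real and w :: nat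
  assumes "0 < \<alpha>" "\<alpha> < 1" "1 \<le> w"
  defines "k \<equiv> nat \<lceil>(1 - \<alpha>) * real w\<rceil>"
  shows "1 \<le> k" "k \<le> w" "real (w - k) = of_int \<lfloor>\<alpha> * real w\<rfloor>"
proof -
  have "(1 - \<alpha>) * real w = - (\<alpha> * real w) + of_int (int w)" by (simp add: left_diff_distrib)
  then have c: "\<lceil>(1 - \<alpha>) * real w\<rceil> = - \<lfloor>\<alpha> * real w\<rfloor> + int w"
    by (simp only: ceiling_add_of_int ceiling_minus)
  have f: "0 \<le> \<lfloor>\<alpha> * real w\<rfloor>" using assms by simp
  have "\<alpha> * real w < real w" using assms by simp
  then have f': "\<lfloor>\<alpha> * real w\<rfloor> < int w" by (simp add: floor_less_iff)
  have ki: "int k = int w - \<lfloor>\<alpha> * real w\<rfloor>" using f' by (simp add: k_def c)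
  show "1 \<le> k" "k \<le> w" using f f' ki by linarith+
  then have "int (w - k) = \<lfloor>\<alpha> * real w\<rfloor>" using ki by simp
  then show "real (w - k) = of_int \<lfloor>\<alpha> * real w\<rfloor>" by (metis of_int_of_nat_eq)
qed

theorem theorem4:
  fixes D :: "'a flip_glm" and L :: "nat set" and \<psi> :: "(nat \<Rightarrow> real) \<Rightarrow> real" and \<alpha> :: real
  assumes "response_model D"
    and "nuisance_estimators D"
    and "random_flips D"
    and "regularity D"
    and "L \<subseteq> {1..nmodels D}" and "L \<noteq> {}"
    and H_L: "\<forall>l\<in>L. null_true D l"
    and "nondecreasing_on L \<psi>"
    and "\<forall>n. \<forall>j\<in>{1..nflips D}. test_stat D \<psi> L n j \<in> borel_measurable (pspace D n)"
    and "0 < \<alpha>" and "\<alpha> < 1"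
  shows "(jointly_increasing_on L \<psi> \<or> asymptotically_untied D \<psi> L \<longrightarrow>
            rejection_prob D \<psi> L \<alpha> \<longlonglongrightarrow> of_int \<lfloor>\<alpha> * real (nflips D)\<rfloor> / real (nflips D))
       \<and> (\<exists>p \<le> of_int \<lfloor>\<alpha> * real (nflips D)\<rfloor> / real (nflips D). rejection_prob D \<psi> L \<alpha> \<longlonglongrightarrow> p)
       \<and> of_int \<lfloor>\<alpha> * real (nflips D)\<rfloor> / real (nflips D) \<le> \<alpha>"
proof -
  interpret T: flip_test D L
    using assms(1,3,4,5) H_L by unfold_locales
  interpret F: flip_limit "nflips D" L \<psi> T.R "pspace D" T.X
    by (rule T.flip_limit) (use assms(8,9) in blast)+
  define k where "k = nat \<lceil>(1 - \<alpha>) * real (nflips D)\<rceil>"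
  note k = quantile_index[OF assms(10,11) T.w, folded k_def]
  have w: "0 < real (nflips D)" using T.w by simp
  have rejects: "rejects D \<psi> L \<alpha> n \<omega> \<longleftrightarrow> T.X n \<omega> \<in> F.high_rank k 1" for n \<omega>
  proof -
    have "{j \<in> {1..nflips D}. flip_stat \<psi> L j (T.X n \<omega>) < flip_stat \<psi> L 1 (T.X n \<omega>)}
        = {j \<in> {1..nflips D}. test_stat D \<psi> L n j \<omega> < test_stat D \<psi> L n 1 \<omega>}"
      using T.flip_stat_X[where \<psi> = \<psi>] T.w by (intro Collect_cong conj_cong refl) simp
    then show ?thesis
      unfolding rejects_def k_def[symmetric] order_stat_less_iff[OF k(1,2)] F.high_rank_def by simp
  qed
  have lim: "rejection_prob D \<psi> L \<alpha> \<longlonglongrightarrow> F.limit_prob k"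
    using F.prob_high_rank_tendsto[of k] unfolding rejection_prob_def[abs_def] rejects .
  have le: "F.limit_prob k \<le> of_int \<lfloor>\<alpha> * real (nflips D)\<rfloor> / real (nflips D)"
    using F.limit_prob_le[of k] w unfolding k(3) by (simp add: pos_le_divide_eq mult.commute)
  have eq: "F.limit_prob k = of_int \<lfloor>\<alpha> * real (nflips D)\<rfloor> / real (nflips D)"
    if "jointly_increasing_on L \<psi> \<or> asymptotically_untied D \<psi> L"
  proof -
    have "AE z in F.G. \<forall>p\<in>{1..nflips D} \<times> {1..nflips D}. fst p \<noteq> snd p
        \<longrightarrow> F.Z z \<notin> interior (F.tied (fst p) (snd p))"
      using that
    proof
      assume "jointly_increasing_on L \<psi>"
      then show ?thesis by (rule F.AE_untied_of_jointly_increasing)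
    next
      assume untied: "asymptotically_untied D \<psi> L"
      show ?thesis
      proof (rule F.AE_untied_of_asymptotically_untied)
        fix j i assume ji: "j \<in> {1..nflips D}" "i \<in> {1..nflips D}" "j \<noteq> i"
        show "(\<lambda>n. measure (pspace D n) {\<omega> \<in> space (pspace D n). T.X n \<omega> \<in> F.tied j i}) \<longlonglongrightarrow> 0"
          using untied ji unfolding asymptotically_untied_def F.tied_def mem_Collect_eq
            T.flip_stat_X[OF ji(1)] T.flip_stat_X[OF ji(2)] by blast
      qed
    qed
    then have "real (nflips D) * F.limit_prob k = of_int \<lfloor>\<alpha> * real (nflips D)\<rfloor>"
      unfolding k(3)[symmetric] by (intro F.limit_prob_eq F.AE_untied)
    then show ?thesis using w by (simp add: field_simps)
  qed
  have "of_int \<lfloor>\<alpha> * real (nflips D)\<rfloor> \<le> \<alpha> * real (nflips D)" by (rule of_int_floor_le)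
  then have "of_int \<lfloor>\<alpha> * real (nflips D)\<rfloor> / real (nflips D) \<le> \<alpha>"
    using w by (simp add: pos_divide_le_eq)
  then show ?thesis using lim le eq by auto
qed

end
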